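(* Consider an open set $A\subset\mathbb{R}$, a $C^2$-family $\alpha\in A\mapsto f_\alpha\in\mathcal{A}(\mathbb{T}_{\hat\rho})$, with $\hat\rho>0$, and a rotation number $\theta\in\mathbb{R}$ fulfilling: (G1) for every $1\le i+j\le2$ there exist constants $c^{i,j}_{x,\alpha}$ such that $\|\partial_{x,\alpha}^{i,j}f_\alpha\|_{A,\hat\rho}\le c^{i,j}_{x,\alpha}$ (for convenience write $c_x=c^{1,0}_{x,\alpha}$, $c_{x\alpha}=c^{1,1}_{x,\alpha}$, etc.); (G2) $\theta\in\mathcal{D}(\gamma,\tau)$. Assume that we have a pair $(h,\alpha)\in\mathcal{A}(\mathbb{T}_\rho)\times A$, with $\rho>0$, fulfilling: (H1) the map $h$ satisfies $\mathrm{dist}(h(\bar{\mathbb{T}}_\rho),\partial\mathbb{T}_{\hat\rho})>0$ and $\langle h-\mathrm{id}\rangle=0$; moreover, there exist constants $\sigma_1$ and $\sigma_2$ such that $\|h'\|_\rho<\sigma_1$ and $\|1/h'\|_\rho<\sigma_2$; (H2) given $b(x)=\dfrac{\partial_\alpha f_\alpha(h(x))}{h'(x+\theta)}$, there exists a constant $\sigma_b$ such that $|1/\langle b\rangle|<\sigma_b$. Then, for any $0<\delta<\rho/2$ and $0<\rho_\infty<\rho-2\delta$, there exist explicit constants $\mathfrak{C}_1$, $\mathfrak{C}_2$ and $\mathfrak{C}_3$ (depending on the previously defined constants) such that: (T1) Existence: if $$\frac{\mathfrak{C}_1\|e\|_\rho}{\gamma^2\rho^{2\tau}}<1,\qquad\text{with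 } e(x)=f_\alpha(h(x))-h(x+\theta),$$ then there exists a pair $(h_\infty,\alpha_\infty)\in\mathcal{A}(\mathbb{T}_{\rho_\infty})\times A$ such that $f_{\alpha_\infty}(h_\infty(x))=h_\infty(x+\theta)$, that also satisfies (H1) and (H2) (on the strip $\mathbb{T}_{\rho_\infty}$). (T2) Closeness: the pair $(h_\infty,\alpha_\infty)$ is close to the original one: $$\|h_\infty-h\|_{\rho_\infty}<\frac{\mathfrak{C}_2\|e\|_\rho}{\gamma\rho^\tau},\qquad|\alpha_\infty-\alpha|<\mathfrak{C}_3\|e\|_\rho.$$
   Context: Notation. $\mathbb{T}=\mathbb{R}/\mathbb{Z}$; $\mathbb{T}_\rho=\{x\in\mathbb{C}/\mathbb{Z}:|\mathrm{Im}\,x|<\rho\}$, with closure $\bar{\mathbb{T}}_\rho$ and boundary $\partial\mathbb{T}_\rho=\{|\mathrm{Im}\,x|=\rho\}$. $\mathrm{Per}(\mathbb{T}_\rho)$ is the Banach space of periodic continuous functions $f:\bar{\mathbb{T}}_\rho\to\mathbb{C}$, holomorphic in $\mathbb{T}_\rho$, with $f(\mathbb{T})\subset\mathbb{R}$, and norm $\|f\|_\rho=\sup_{x\in\mathbb{T}_\rho}|f(x)|$. $\langle f\rangle$ is the average (zeroth Fourier coefficient). $\mathcal{A}(\mathbb{T}_\rho)=\{f\in\mathrm{Hom}(\mathbb{T}):f-\mathrm{id}\in\mathrm{Per}(\mathbb{T}_\rho)\}$, where $\mathrm{Hom}(\mathbb{T})$ denotes the circle homeomorphisms. $\|\partial_{x,\alpha}^{i,j}f\|_{A,\rho}=\sup_{\alpha\in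 A}\|\partial_{x,\alpha}^{i,j}f_\alpha\|_\rho$, where $\partial_{x,\alpha}^{i,j}=\partial_x^i\partial_\alpha^j$. For $\gamma>0$, $\tau\ge1$: $\mathcal{D}(\gamma,\tau)=\{\theta\in\mathbb{R}:|q\theta-p|\ge\gamma|q|^{-\tau}\ \forall(p,q)\in\mathbb{Z}^2,\ q\ne0\}$.
   Formalization: In (T2) the strict inequalities, false when e=0, are stated as ≤ always and < when ‖e‖≠0; the constants may also depend on ‖h'‖, ‖1/h'‖, |1/⟨b⟩|, dist(h(T̄_ρ),∂T_ρ̂) and dist(α,∂A), as they must for the result to hold. *)

theory Defs
  imports "HOL-Analysis.Analysis"
begin

text \<open>
  Functions on \<open>\<complex>/\<int>\<close> are represented by functions \<open>\<complex> \<Rightarrow> \<complex>\<close> on the universal cover, and circle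
  homeomorphisms by their lifts; only the values on the closed strip are relevant. Since all
  sets below are invariant under integer translations, distances in \<open>\<complex>/\<int>\<close> between them agree with
  distances in \<open>\<complex>\<close>.
\<close>

definition strip :: "real \<Rightarrow> complex set" where
  "strip \<rho> = {x. \<bar>Im x\<bar> < \<rho>}"

definition closed_strip :: "real \<Rightarrow> complex set" where
  "closed_strip \<rho> = {x. \<bar>Im x\<bar> \<le> \<rho>}"

definition strip_boundary :: "real \<Rightarrow> complex set" where
  "strip_boundary \<rho> = {x. \<bar>Im x\<bar> = \<rho>}"

definition Per :: "real \<Rightarrow> (complex \<Rightarrow> complex) set" where
  "Per \<rho> = {f. continuous_on (closed_strip \<rho>) f \<and> f holomorphic_on strip \<rho> \<and>
               (\<forall>x \<in> closed_strip \<rho>. f (x + 1) = f x) \<and> f ` \<real> \<subseteq> \<real>}"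

text \<open>Extended-real-valued, so that the norm of an unbounded function is \<open>\<infinity>\<close>
  (derivatives need not extend continuously to the boundary of the strip).\<close>

definition strip_norm :: "real \<Rightarrow> (complex \<Rightarrow> complex) \<Rightarrow> ereal" where
  "strip_norm \<rho> f = (SUP x \<in> strip \<rho>. ereal (cmod (f x)))"

definition average :: "(complex \<Rightarrow> complex) \<Rightarrow> complex" where
  "average f = integral {0..1} (\<lambda>t. f (complex_of_real t))"

text \<open>The class \<open>\<A>(\<T>\<^sub>\<rho>)\<close>. As \<open>f - id\<close> is 1-periodic on the reals, \<open>f\<close> is the lift of a circle
  homeomorphism iff it restricts to a homeomorphism of the real line.\<close>

definition circle_maps :: "real \<Rightarrow> (complex \<Rightarrow> complex) set" where
  "circle_maps \<rho> = {f. (\<lambda>x. f x - x) \<in> Per \<rho> \<and> (\<exists>g. homeomorphism \<real> \<real> f g)}"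

definition d_x :: "(real \<Rightarrow> complex \<Rightarrow> complex) \<Rightarrow> real \<Rightarrow> complex \<Rightarrow> complex" where
  "d_x f = (\<lambda>\<alpha> x. deriv (f \<alpha>) x)"

definition d_alpha :: "(real \<Rightarrow> complex \<Rightarrow> complex) \<Rightarrow> real \<Rightarrow> complex \<Rightarrow> complex" where
  "d_alpha f = (\<lambda>\<alpha> x. vector_derivative (\<lambda>\<beta>. f \<beta> x) (at \<alpha>))"

definition pd :: "nat \<Rightarrow> nat \<Rightarrow> (real \<Rightarrow> complex \<Rightarrow> complex) \<Rightarrow> real \<Rightarrow> complex \<Rightarrow> complex" where
  "pd i j f = (d_x ^^ i) ((d_alpha ^^ j) f)"

definition family_norm :: "real set \<Rightarrow> real \<Rightarrow> (real \<Rightarrow> complex \<Rightarrow> complex) \<Rightarrow> ereal" where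
  "family_norm A \<rho> g = (SUP \<alpha> \<in> A. strip_norm \<rho> (g \<alpha>))"

text \<open>Differentiability of \<open>\<alpha> \<mapsto> f\<^sub>\<alpha>\<close> in the supremum norm. The derivative with respect
  to this norm is necessarily the pointwise one, \<^const>\<open>d_alpha\<close>, and it
  belongs to \<^const>\<open>Per\<close> again, which is closed under uniform limits.\<close>

definition sup_differentiable_on :: "real set \<Rightarrow> real \<Rightarrow> (real \<Rightarrow> complex \<Rightarrow> complex) \<Rightarrow> bool" where
  "sup_differentiable_on A \<rho> f \<longleftrightarrow>
     (\<forall>\<alpha> \<in> A. uniform_limit (closed_strip \<rho>)
        (\<lambda>\<beta> x. (f \<beta> x - f \<alpha> x) / of_real (\<beta> - \<alpha>)) (d_alpha f \<alpha>) (at \<alpha>))"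

definition C2_family :: "real set \<Rightarrow> real \<Rightarrow> (real \<Rightarrow> complex \<Rightarrow> complex) \<Rightarrow> bool" where
  "C2_family A \<rho> f \<longleftrightarrow>
     (\<forall>\<alpha> \<in> A. f \<alpha> \<in> circle_maps \<rho>) \<and>
     sup_differentiable_on A \<rho> f \<and>
     sup_differentiable_on A \<rho> (d_alpha f) \<and>
     (\<forall>\<alpha> \<in> A. uniform_limit (closed_strip \<rho>)
        (d_alpha (d_alpha f)) (d_alpha (d_alpha f) \<alpha>) (at \<alpha>))"

definition diophantine :: "real \<Rightarrow> real \<Rightarrow> real set" where
  "diophantine \<gamma> \<tau> =
     {\<theta>. \<forall>p q :: int. q \<noteq> 0 \<longrightarrow>
        \<bar>of_int q * \<theta> - of_int p\<bar> \<ge> \<gamma> * \<bar>of_int q\<bar> powr (- \<tau>)}"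

text \<open>In the next two hypotheses the nonvanishing conditions are implicit in writing \<open>1/h'\<close> and
  \<open>1/\<langle>b\<rangle>\<close>; they are needed because \<open>1/0 = 0\<close> in HOL.\<close>

definition admissible_conj ::
  "real \<Rightarrow> real \<Rightarrow> real \<Rightarrow> real \<Rightarrow> (complex \<Rightarrow> complex) \<Rightarrow> bool" where
  "admissible_conj \<rho> \<rho>hat \<sigma>1 \<sigma>2 h \<longleftrightarrow>
     setdist (h ` closed_strip \<rho>) (strip_boundary \<rho>hat) > 0 \<and>
     average (\<lambda>x. h x - x) = 0 \<and>
     strip_norm \<rho> (deriv h) < ereal \<sigma>1 \<and>
     (\<forall>x \<in> strip \<rho>. deriv h x \<noteq> 0) \<and>
     strip_norm \<rho> (\<lambda>x. 1 / deriv h x) < ereal \<sigma>2"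

definition twist_fun ::
  "(real \<Rightarrow> complex \<Rightarrow> complex) \<Rightarrow> real \<Rightarrow> (complex \<Rightarrow> complex) \<Rightarrow> real \<Rightarrow> complex \<Rightarrow> complex" where
  "twist_fun f \<theta> h \<alpha> = (\<lambda>x. d_alpha f \<alpha> (h x) / deriv h (x + of_real \<theta>))"

definition nondegenerate ::
  "(real \<Rightarrow> complex \<Rightarrow> complex) \<Rightarrow> real \<Rightarrow> real \<Rightarrow> (complex \<Rightarrow> complex) \<Rightarrow> real \<Rightarrow> bool" where
  "nondegenerate f \<theta> \<sigma>b h \<alpha> \<longleftrightarrow>
     average (twist_fun f \<theta> h \<alpha>) \<noteq> 0 \<and> cmod (1 / average (twist_fun f \<theta> h \<alpha>)) < \<sigma>b"

definition conj_error ::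
  "(real \<Rightarrow> complex \<Rightarrow> complex) \<Rightarrow> real \<Rightarrow> (complex \<Rightarrow> complex) \<Rightarrow> real \<Rightarrow> complex \<Rightarrow> complex" where
  "conj_error f \<theta> h \<alpha> = (\<lambda>x. f \<alpha> (h x) - h (x + of_real \<theta>))"

text \<open>Distance to the boundary, with the convention that it is \<open>\<infinity>\<close> if the boundary is empty
  (\<^const>\<open>infdist\<close> would give 0).\<close>

definition frontier_dist :: "real set \<Rightarrow> real \<Rightarrow> ereal" where
  "frontier_dist A \<alpha> = (INF y \<in> frontier A. ereal (dist \<alpha> y))"

text \<open>
  The quantities on which the constants of the theorem may depend besides the given bounds:
  the sizes of the left-hand sides of the open conditions on the initial pair \<open>(h, \<alpha>)\<close>.
  Their distance to the respective thresholds is what limits the size of the admissible correction.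
\<close>

definition initial_sizes ::
  "real set \<Rightarrow> (real \<Rightarrow> complex \<Rightarrow> complex) \<Rightarrow> real \<Rightarrow> real \<Rightarrow> real \<Rightarrow> (complex \<Rightarrow> complex) \<Rightarrow> real
   \<Rightarrow> ereal \<Rightarrow> ereal \<Rightarrow> real \<Rightarrow> real \<Rightarrow> ereal \<Rightarrow> bool" where
  "initial_sizes A f \<theta> \<rho> \<rho>hat h \<alpha> s1 s2 sb dh dA \<longleftrightarrow>
     strip_norm \<rho> (deriv h) = s1 \<and>
     strip_norm \<rho> (\<lambda>x. 1 / deriv h x) = s2 \<and>
     cmod (1 / average (twist_fun f \<theta> h \<alpha>)) = sb \<and>
     setdist (h ` closed_strip \<rho>) (strip_boundary \<rho>hat) = dh \<and>
     frontier_dist A \<alpha> = dA"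

end

(*  The conjugacy is found by a quasi-Newton iteration. For an approximate solution (h, alpha) with
    error e, differentiating the definition of e shows that f'(h) h' = h'(. + theta) + e'. Looking for
    the correction in the form h' xi therefore reduces the linearized equation, up to the quadratically
    small term e' xi, to the cohomological equation xi - xi(. + theta) = eta with constant coefficients. The
    correction of alpha gives eta zero average, which is possible because <b> is nonzero. Solving for the
    Fourier coefficients, the Diophantine condition bounds xi at the price of a polynomial loss in the
    width of the strip. The error becomes quadratically small at each step, which beats the loss when the
    widths decrease geometrically. The strict inequalities in (H1) and (H2) survive since
    the total displacement is bounded by a multiple of the initial error. *)

theory Submission
  imports Defs "HOL-Complex_Analysis.Complex_Analysis" "HOL-Real_Asymp.Real_Asymp"
begin

section \<open>Periodic holomorphic functions on strips\<close>

text \<open>The constants are quantified before the family and the pair, so they may depend only on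
  the given bounds, the widths and the numbers in \<open>initial_sizes\<close>. Between each initial
  size and its threshold a relaxed bound is placed (\<open>L1\<close>, \<open>L2\<close>,
  \<open>Lb\<close>, and \<open>d\<close> for the distance to the boundary). One radius
  \<open>\<mu>\<close> is then chosen so that every pair within distance \<open>\<mu>\<close> of the
  initial one, measured in the parameter, in \<open>h\<close> and in \<open>h'\<close>, obeys the
  relaxed bounds. The same step constant therefore serves at every iterate, apart from the power of
  the width lost at that step. The Fourier series is estimated term by term, which costs
  \<open>coh_order \<tau>\<close> powers of the width rather than \<open>\<tau>\<close>. This excess
  depends only on \<open>\<rho>\<close>, \<open>\<rho>inf\<close> and \<open>\<tau>\<close>, so the
  final constants absorb it. All iterates live on open strips, where locally uniform limits behave
  well. Continuity up to the boundary and the homeomorphism property are recovered once, for the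
  limit, on the smaller strip of half-width \<open>\<rho>inf\<close>.\<close>

definition strip_per :: "real \<Rightarrow> (complex \<Rightarrow> complex) \<Rightarrow> bool" where
  "strip_per r \<eta> \<longleftrightarrow> \<eta> holomorphic_on strip r \<and> (\<forall>z\<in>strip r. \<eta> (z + 1) = \<eta> z)"

definition real_on_reals :: "(complex \<Rightarrow> complex) \<Rightarrow> bool" where
  "real_on_reals \<eta> \<longleftrightarrow> (\<forall>t::real. \<eta> (of_real t) \<in> \<real>)"

lemma strip_mono: "r \<le> r' \<Longrightarrow> strip r \<subseteq> strip r'"
  by (auto simp: strip_def)

lemma strip_eq_Int: "strip r = {z. Im z < r} \<inter> {z. Im z > - r}"
  by (auto simp: strip_def)

lemma open_strip: "open (strip r)"
  unfolding strip_eq_Int by (intro open_Int open_halfspace_Im_lt open_halfspace_Im_gt)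

lemma convex_strip: "convex (strip r)"
  unfolding strip_eq_Int by (intro convex_Int convex_halfspace_Im_lt convex_halfspace_Im_gt)

lemma strip_add_real [simp]: "z + of_real t \<in> strip r \<longleftrightarrow> z \<in> strip r"
  by (simp add: strip_def)

lemma real_add_strip [simp]: "of_real t + z \<in> strip r \<longleftrightarrow> z \<in> strip r"
  by (simp add: strip_def)

lemma strip_add_1 [simp]: "z + 1 \<in> strip r \<longleftrightarrow> z \<in> strip r"
  by (simp add: strip_def)

lemma of_real_strip [simp]: "r > 0 \<Longrightarrow> of_real t \<in> strip r"
  by (simp add: strip_def)

lemma cball_strip: "z \<in> strip (r - d) \<Longrightarrow> cball z d \<subseteq> strip r"
proof
  fix w assume z: "z \<in> strip (r - d)" and w: "w \<in> cball z d"
  have "\<bar>Im (w - z)\<bar> \<le> d"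
    using abs_Im_le_cmod[of "w - z"] w by (simp add: dist_norm norm_minus_commute)
  with z show "w \<in> strip r" by (auto simp: strip_def)
qed

lemma strip_per_mono: "strip_per r \<eta> \<Longrightarrow> r' \<le> r \<Longrightarrow> strip_per r' \<eta>"
  using strip_mono[of r' r] by (auto simp: strip_per_def intro: holomorphic_on_subset)

lemma strip_perD:
  assumes "strip_per r \<eta>"
  shows "\<eta> holomorphic_on strip r" "\<And>z. z \<in> strip r \<Longrightarrow> \<eta> (z + 1) = \<eta> z"
    "\<And>z. z \<in> strip r \<Longrightarrow> \<eta> field_differentiable at z"
    "\<And>z. z \<in> strip r \<Longrightarrow> (\<eta> has_field_derivative deriv \<eta> z) (at z)"
    "continuous_on (strip r) \<eta>"
proof -
  show h: "\<eta> holomorphic_on strip r" and "\<And>z. z \<in> strip r \<Longrightarrow> \<eta> (z + 1) = \<eta> z"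
    using assms by (auto simp: strip_per_def)
  show "\<eta> field_differentiable at z" if "z \<in> strip r" for z
    using holomorphic_on_imp_differentiable_at[OF h open_strip that] .
  show "(\<eta> has_field_derivative deriv \<eta> z) (at z)" if "z \<in> strip r" for z
    using holomorphic_derivI[OF h open_strip that] .
  show "continuous_on (strip r) \<eta>"
    by (rule holomorphic_on_imp_continuous_on[OF h])
qed

lemma periodic_int:
  assumes per: "\<And>w. w \<in> strip r \<Longrightarrow> g (w + 1) = g w" and z: "z \<in> strip r"
  shows "g (z + of_int n) = g z"
proof (induction n rule: int_induct[of _ 0])
  case (step1 i)
  have "z + of_int i \<in> strip r" using z by (simp add: strip_def)
  from per[OF this] step1 show ?case by (simp add: algebra_simps)
next
  case (step2 i)
  have "z + of_int (i - 1) \<in> strip r" using z by (simp add: strip_def)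
  from per[OF this] step2 show ?case by (simp add: algebra_simps)
qed simp

text \<open>The additive constant \<open>c\<close> covers periodic functions (\<open>c = 0\<close>)
  and lifts of circle maps (\<open>c = 1\<close>) alike, since differentiation removes it.\<close>

lemma deriv_periodic:
  assumes "\<And>z. z \<in> strip r \<Longrightarrow> \<eta> (z + 1) = \<eta> z + c" "\<eta> holomorphic_on strip r" "z \<in> strip r"
  shows "deriv \<eta> (z + 1) = deriv \<eta> z"
proof -
  have "((\<lambda>w. \<eta> (w + 1)) has_field_derivative deriv \<eta> (z + 1)) (at z)"
    unfolding DERIV_shift[symmetric]
    by (rule holomorphic_derivI[OF assms(2) open_strip]) (use assms(3) in simp)
  moreover have "((\<lambda>w. \<eta> (w + 1)) has_field_derivative deriv \<eta> z) (at z)"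
  proof (rule has_field_derivative_transform_within_open[OF _ open_strip[of r] assms(3)])
    show "((\<lambda>w. \<eta> w + c) has_field_derivative deriv \<eta> z) (at z)"
      using holomorphic_derivI[OF assms(2) open_strip assms(3)] by (auto intro!: derivative_eq_intros)
  qed (use assms(1) in auto)
  ultimately show ?thesis by (rule DERIV_unique)
qed

lemma strip_per_shift:
  assumes "strip_per r \<eta>"
  shows "strip_per r (\<lambda>z. \<eta> (z + of_real t))"
proof -
  have "(\<lambda>z. \<eta> (z + of_real t)) holomorphic_on strip r"
    using strip_perD(1)[OF assms]
    by (intro holomorphic_on_compose_gen[of "\<lambda>z. z + of_real t" _ \<eta>, unfolded o_def]) (auto intro!: holomorphic_intros)
  moreover have "\<eta> (z + 1 + of_real t) = \<eta> (z + of_real t)" if "z \<in> strip r" for z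
    using strip_perD(2)[OF assms, of "z + of_real t"] that by (simp add: algebra_simps)
  ultimately show ?thesis by (auto simp: strip_per_def)
qed

lemma strip_per_add: "strip_per r f \<Longrightarrow> strip_per r g \<Longrightarrow> strip_per r (\<lambda>z. f z + g z)"
  and strip_per_diff: "strip_per r f \<Longrightarrow> strip_per r g \<Longrightarrow> strip_per r (\<lambda>z. f z - g z)"
  and strip_per_mult: "strip_per r f \<Longrightarrow> strip_per r g \<Longrightarrow> strip_per r (\<lambda>z. f z * g z)"
  and strip_per_const: "strip_per r (\<lambda>z. c)"
  and strip_per_minus: "strip_per r f \<Longrightarrow> strip_per r (\<lambda>z. - f z)"
  and strip_per_divide: "strip_per r f \<Longrightarrow> strip_per r g \<Longrightarrow> (\<And>z. z \<in> strip r \<Longrightarrow> g z \<noteq> 0) \<Longrightarrow>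
     strip_per r (\<lambda>z. f z / g z)"
  by (simp_all add: strip_per_def holomorphic_on_add holomorphic_on_diff holomorphic_on_mult
      holomorphic_on_const holomorphic_on_minus holomorphic_on_divide)

text \<open>On the real line the complex derivative is the derivative of the restriction to that
  line, whose imaginary part vanishes identically.\<close>

lemma real_on_reals_deriv:
  assumes "\<eta> holomorphic_on strip r" "real_on_reals \<eta>" "r > 0"
  shows "real_on_reals (deriv \<eta>)"
  unfolding real_on_reals_def
proof
  fix t :: real
  have "((\<lambda>s::real. \<eta> (of_real s)) has_vector_derivative deriv \<eta> (of_real t)) (at t)"
    using holomorphic_derivI[OF assms(1) open_strip, of "of_real t"] assms(3)
    by (intro has_vector_derivative_real_field) auto
  then have "((\<lambda>s::real. Im (\<eta> (of_real s))) has_vector_derivative Im (deriv \<eta> (of_real t))) (at t)"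
    by (rule bounded_linear.has_vector_derivative[OF bounded_linear_Im])
  moreover have "(\<lambda>s::real. Im (\<eta> (of_real s))) = (\<lambda>s. 0)"
    using assms(2) by (auto simp: real_on_reals_def complex_is_Real_iff)
  ultimately have "((\<lambda>s::real. 0) has_vector_derivative Im (deriv \<eta> (of_real t))) (at t)" by simp
  then have "Im (deriv \<eta> (of_real t)) = 0"
    using vector_derivative_unique_at has_vector_derivative_const by blast
  then show "deriv \<eta> (of_real t) \<in> \<real>" by (simp add: complex_is_Real_iff)
qed

text \<open>A derivative is paid for with a width \<open>d\<close>: the disc of radius
  \<open>d\<close> about a point of the narrower strip stays in the wider one.\<close>

lemma Cauchy_deriv_bound:
  assumes "\<eta> holomorphic_on strip r" "\<And>z. z \<in> strip r \<Longrightarrow> cmod (\<eta> z) \<le> B" "0 < d" "z \<in> strip (r - d)"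
  shows "cmod (deriv \<eta> z) \<le> B / d"
proof -
  have sub: "cball z d \<subseteq> strip r" using cball_strip assms(4) by blast
  have "norm ((deriv ^^ 1) \<eta> z) \<le> fact 1 * B / d ^ 1"
  proof (rule Cauchy_inequality)
    show "\<eta> holomorphic_on ball z d"
      using holomorphic_on_subset[OF assms(1)] sub ball_subset_cball by blast
    show "continuous_on (cball z d) \<eta>"
      using holomorphic_on_imp_continuous_on[OF assms(1)] sub continuous_on_subset by blast
    show "norm (\<eta> x) \<le> B" if "norm (z - x) = d" for x
      using sub that by (intro assms(2)) (auto simp: dist_norm)
  qed fact
  then show ?thesis by simp
qed

lemma average_cong: "(\<And>t. t \<in> {0..1} \<Longrightarrow> f (of_real t) = g (of_real t)) \<Longrightarrow> average f = average g"
  unfolding average_def by (rule integral_cong) auto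

lemma average_bound:
  assumes "continuous_on {0..1} (\<lambda>t::real. f (of_real t))" "\<And>t::real. cmod (f (of_real t)) \<le> B"
  shows "cmod (average f) \<le> B"
  unfolding average_def using integral_bound[OF _ assms(1), of B] assms(2) by simp

lemma continuous_on_real_strip:
  assumes "continuous_on (strip r) \<eta>" "z \<in> strip r"
  shows "continuous_on S (\<lambda>t::real. \<eta> (of_real t + z))"
  by (rule continuous_on_compose2[OF assms(1)]) (use assms(2) in \<open>auto intro!: continuous_intros\<close>)

lemma continuous_on_reals:
  assumes "continuous_on (strip r) \<eta>" "r > 0"
  shows "continuous_on S (\<lambda>t::real. \<eta> (of_real t))"
  by (rule continuous_on_compose2[OF assms(1)]) (use assms(2) in \<open>auto intro!: continuous_intros\<close>)

lemma average_primitive: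
  assumes "\<And>w. w \<in> strip r \<Longrightarrow> (P has_field_derivative \<eta> w) (at w)" "z \<in> strip r"
  shows "average (\<lambda>t. \<eta> (t + z)) = P (1 + z) - P z"
proof -
  have "((\<lambda>t::real. P (of_real t + z)) has_vector_derivative \<eta> (of_real t + z)) (at t within {0..1})" for t
    using assms(1)[of "of_real t + z"] assms(2)
    by (intro has_vector_derivative_real_field) (simp add: DERIV_shift)
  then have "((\<lambda>t::real. \<eta> (of_real t + z)) has_integral (P (1 + z) - P z)) {0..1}"
    using fundamental_theorem_of_calculus[of 0 1 "\<lambda>t::real. P (of_real t + z)" "\<lambda>t. \<eta> (of_real t + z)"] by simp
  then show ?thesis unfolding average_def by (rule integral_unique)
qed

text \<open>A primitive \<open>P\<close> of \<open>\<eta>\<close> satisfies \<open>P (z + 1) - P z = const\<close>, which replaces moving the contour.\<close>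

lemma average_shift:
  assumes "strip_per r \<eta>" "z \<in> strip r"
  shows "average (\<lambda>t. \<eta> (t + z)) = average \<eta>"
proof -
  obtain P where P': "\<And>w. w \<in> strip r \<Longrightarrow> (P has_field_derivative \<eta> w) (at w within strip r)"
    using holomorphic_convex_primitive'[OF convex_strip open_strip strip_perD(1)[OF assms(1)]] by blast
  then have P: "\<And>w. w \<in> strip r \<Longrightarrow> (P has_field_derivative \<eta> w) (at w)"
    using at_within_open[OF _ open_strip] by metis
  have "((\<lambda>w. P (w + 1) - P w) has_field_derivative 0) (at w within strip r)" if w: "w \<in> strip r" for w
  proof -
    have "((\<lambda>w. P (w + 1)) has_field_derivative \<eta> (w + 1)) (at w)"
      using P[of "w + 1"] w by (simp add: DERIV_shift)
    then show ?thesis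
      using DERIV_diff[OF _ P[OF w], of "\<lambda>w. P (w + 1)" "\<eta> (w + 1)"] strip_perD(2)[OF assms(1) w]
      by (auto intro: has_field_derivative_at_within)
  qed
  from has_field_derivative_zero_constant[OF convex_strip this]
  obtain c where c: "\<And>w. w \<in> strip r \<Longrightarrow> P (w + 1) - P w = c" by blast
  have 0: "0 \<in> strip r" using assms(2) by (auto simp: strip_def)
  show ?thesis
    using average_primitive[OF P assms(2)] average_primitive[OF P 0] c[OF assms(2)] c[OF 0]
    by (simp add: add.commute)
qed

section \<open>Fourier coefficients and their exponential decay\<close>

definition char :: "int \<Rightarrow> complex \<Rightarrow> complex" where
  "char k z = exp (2 * of_real pi * \<i> * of_int k * z)"

definition fcoef :: "(complex \<Rightarrow> complex) \<Rightarrow> int \<Rightarrow> complex" where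
  "fcoef \<eta> k = average (\<lambda>z. \<eta> z * char (- k) z)"

lemma char_add: "char k (z + w) = char k z * char k w"
  by (simp add: char_def exp_add[symmetric] algebra_simps)

lemma char_int: "char (k + l) z = char k z * char l z"
  by (simp add: char_def exp_add[symmetric] algebra_simps)

lemma char_0 [simp]: "char 0 z = 1" "char k 0 = 1"
  by (simp_all add: char_def)

lemma char_1 [simp]: "char k 1 = 1"
proof -
  have "char k 1 = exp (2 * of_int k * of_real pi * \<i>)" by (simp add: char_def algebra_simps)
  then show ?thesis using exp_integer_2pi[of "of_int k"] by simp
qed

lemma norm_char: "cmod (char k z) = exp (- 2 * pi * of_int k * Im z)"
  by (simp add: char_def norm_exp_eq_Re)

lemma char_minus: "char (- k) z = inverse (char k z)"
  by (simp add: char_def exp_minus)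

lemma char_nz [simp]: "char k z \<noteq> 0"
  by (simp add: char_def)

lemma char_cnj: "char (- k) (of_real t) = cnj (char k (of_real t))"
  by (simp add: char_def exp_cnj)

lemma holomorphic_char [holomorphic_intros]: "char k holomorphic_on S"
  unfolding char_def[abs_def] by (intro holomorphic_intros)

lemma strip_per_char: "strip_per r (char k)"
  by (simp add: strip_per_def holomorphic_char char_add)

lemma average_cmult: "average (\<lambda>z. c * f z) = c * average f"
  by (simp add: average_def)

text \<open>For complex \<open>z\<close> this is a shift of the contour: by
  \<open>average_shift\<close> the coefficient may be computed on the horizontal line through
  \<open>z\<close>, where \<open>char (- k)\<close> acquires the constant factor
  \<open>char (- k) z\<close>.\<close>

lemma fcoef_shift:
  assumes "strip_per r \<eta>" "z \<in> strip r"
  shows "fcoef (\<lambda>t. \<eta> (t + z)) k = char k z * fcoef \<eta> k"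
proof -
  have "fcoef \<eta> k = average (\<lambda>t. \<eta> (t + z) * char (- k) (t + z))"
    unfolding fcoef_def using average_shift[OF strip_per_mult[OF assms(1) strip_per_char] assms(2)] by simp
  also have "\<dots> = average (\<lambda>t. char (- k) z * (\<eta> (t + z) * char (- k) t))"
    by (rule average_cong) (simp add: char_add algebra_simps)
  also have "\<dots> = char (- k) z * fcoef (\<lambda>t. \<eta> (t + z)) k"
    by (simp add: average_cmult fcoef_def)
  finally show ?thesis by (simp add: char_minus)
qed

text \<open>The contour is moved to whichever of the lines at height \<open>s\<close> and
  \<open>- s\<close> makes \<open>char (- k)\<close> small, so bounds on these two lines are all
  that enters.\<close>

lemma fcoef_bound:
  assumes "strip_per r \<eta>" "0 \<le> s" "s < r"
    and B: "\<And>t::real. cmod (\<eta> (of_real t + \<i> * of_real s)) \<le> B" "\<And>t::real. cmod (\<eta> (of_real t - \<i> * of_real s)) \<le> B"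
  shows "cmod (fcoef \<eta> k) \<le> B * exp (- 2 * pi * \<bar>of_int k\<bar> * s)"
proof -
  define z where "z = (if k \<ge> 0 then - (\<i> * of_real s) else \<i> * of_real s)"
  have z: "z \<in> strip r" using assms(2,3) by (auto simp: z_def strip_def)
  have "cmod (fcoef (\<lambda>t. \<eta> (t + z)) k) \<le> B"
    unfolding fcoef_def
  proof (rule average_bound)
    show "continuous_on {0..1} (\<lambda>t::real. \<eta> (of_real t + z) * char (- k) (of_real t))"
      unfolding char_def by (intro continuous_intros continuous_on_real_strip[OF strip_perD(5)[OF assms(1)] z])
    show "cmod (\<eta> (of_real t + z) * char (- k) (of_real t)) \<le> B" for t :: real
      using B[of t] by (simp add: norm_mult norm_char z_def)
  qed
  then have "exp (2 * pi * \<bar>of_int k\<bar> * s) * cmod (fcoef \<eta> k) \<le> B"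
    unfolding fcoef_shift[OF assms(1) z] by (simp add: norm_mult norm_char z_def split: if_splits)
  then show ?thesis
    by (simp add: exp_minus field_simps)
qed

text \<open>Periodicity reduces the supremum over a horizontal line to a compact segment, so every
  height \<open>s < r\<close> yields a finite bound even if the function is unbounded on the open
  strip.\<close>

lemma fcoef_decay:
  assumes "strip_per r \<eta>" "0 \<le> s" "s < r"
  shows "\<exists>C. \<forall>k. cmod (fcoef \<eta> k) \<le> C * exp (- 2 * pi * \<bar>of_int k\<bar> * s)"
proof -
  have bd: "\<exists>B. \<forall>t::real. cmod (\<eta> (of_real t + z)) \<le> B" if z: "z \<in> strip r" for z
  proof -
    have "bounded ((\<lambda>t::real. \<eta> (of_real t + z)) ` {0..1})"
      by (intro compact_imp_bounded compact_continuous_image continuous_on_real_strip[OF strip_perD(5)[OF assms(1)] z]) auto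
    then obtain B where B: "\<And>t::real. t \<in> {0..1} \<Longrightarrow> cmod (\<eta> (of_real t + z)) \<le> B"
      unfolding bounded_iff by blast
    have "cmod (\<eta> (of_real t + z)) \<le> B" for t :: real
    proof -
      have "\<eta> (of_real (frac t) + z + of_int \<lfloor>t\<rfloor>) = \<eta> (of_real (frac t) + z)"
        by (rule periodic_int[of r \<eta>]) (use z strip_perD(2)[OF assms(1)] in simp_all)
      moreover have "of_real (frac t) + z + of_int \<lfloor>t\<rfloor> = of_real t + z"
        by (simp add: frac_def)
      moreover have "frac t \<in> {0..1}" using frac_lt_1[of t] by (simp add: less_imp_le)
      ultimately show ?thesis using B[of "frac t"] by simp
    qed
    then show ?thesis by blast
  qed
  obtain B1 where B1: "\<And>t::real. cmod (\<eta> (of_real t + \<i> * of_real s)) \<le> B1"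
    using bd[of "\<i> * of_real s"] assms by (auto simp: strip_def)
  obtain B2 where B2: "\<And>t::real. cmod (\<eta> (of_real t - \<i> * of_real s)) \<le> B2"
    using bd[of "- (\<i> * of_real s)"] assms by (auto simp: strip_def)
  have "cmod (fcoef \<eta> k) \<le> max B1 B2 * exp (- 2 * pi * \<bar>of_int k\<bar> * s)" for k
    by (rule fcoef_bound[OF assms]) (use B1 B2 in \<open>auto simp: le_max_iff_disj\<close>)
  then show ?thesis by blast
qed

section \<open>Fourier series and the cohomological equation\<close>

lemma average_const [simp]: "average (\<lambda>z. c) = c"
  by (simp add: average_def)

lemma strip_per_integrable:
  assumes "strip_per r f" "r > 0"
  shows "(\<lambda>t::real. f (of_real t)) integrable_on {0..1}"
  by (intro integrable_continuous_real continuous_on_reals[OF strip_perD(5)[OF assms(1)] assms(2)])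

lemma average_diff:
  assumes "strip_per r f" "strip_per r g" "r > 0"
  shows "average (\<lambda>z. f z - g z) = average f - average g"
  unfolding average_def using assms by (intro integral_diff strip_per_integrable)

lemma average_add:
  assumes "strip_per r f" "strip_per r g" "r > 0"
  shows "average (\<lambda>z. f z + g z) = average f + average g"
  unfolding average_def using assms by (intro integral_add strip_per_integrable)

lemma average_cnj:
  "average (\<lambda>z. cnj (f z)) = cnj (average f)"
  unfolding average_def by (simp add: integral_cnj)

lemma fcoef_0: "fcoef \<eta> 0 = average \<eta>"
  by (simp add: fcoef_def)

lemma fcoef_const: "k \<noteq> 0 \<Longrightarrow> fcoef (\<lambda>z. c) k = 0"
proof -
  assume k: "k \<noteq> 0"
  have "average (\<lambda>t. char (- k) (t + 0)) = char (- k) (1 + 0) / (2 * of_real pi * \<i> * of_int (- k))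
      - char (- k) 0 / (2 * of_real pi * \<i> * of_int (- k))"
  proof (rule average_primitive[where r = 1])
    show "((\<lambda>z. char (- k) z / (2 * of_real pi * \<i> * of_int (- k))) has_field_derivative char (- k) w) (at w)" for w
      unfolding char_def using k by (auto intro!: derivative_eq_intros simp: field_simps)
  qed (simp add: strip_def)
  then show ?thesis by (simp add: fcoef_def average_cmult)
qed

lemma fcoef_cnj:
  assumes "real_on_reals \<eta>"
  shows "fcoef \<eta> (- k) = cnj (fcoef \<eta> k)"
proof -
  have "cnj (fcoef \<eta> k) = average (\<lambda>z. cnj (\<eta> z * char (- k) z))"
    unfolding fcoef_def by (rule average_cnj[symmetric])
  also have "\<dots> = fcoef \<eta> (- k)"
    unfolding fcoef_def
  proof (rule average_cong)
    fix t :: real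
    have "cnj (\<eta> (of_real t)) = \<eta> (of_real t)"
      using assms by (simp add: real_on_reals_def Reals_cnj_iff)
    then show "cnj (\<eta> (of_real t) * char (- k) (of_real t)) = \<eta> (of_real t) * char (- (- k)) (of_real t)"
      by (simp add: char_cnj)
  qed
  finally show ?thesis ..
qed

lemma char_eq_1_iff: "char 1 z = 1 \<longleftrightarrow> z \<in> \<int>"
proof
  assume "char 1 z = 1"
  then obtain n :: int where "Im z = 0" and n: "2 * pi * Re z = of_int (2 * n) * pi"
    by (auto simp: char_def exp_eq_1)
  then have "z = of_int n" by (simp add: complex_eq_iff)
  then show "z \<in> \<int>" by simp
qed (auto elim!: Ints_cases simp: char_def algebra_simps)

text \<open>The quotient \<open>g\<close> of \<open>F - F 0\<close> by \<open>char 1 - 1\<close> extends holomorphically over the integers, so the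
  Fourier coefficients of \<open>F - F 0\<close> telescope.\<close>

lemma quotient_by_char:
  assumes F: "strip_per r F" and r: "r > 0"
  shows "\<exists>g. strip_per r g \<and> (\<forall>z\<in>strip r. F z - F 0 = g z * char 1 z - g z)"
proof -
  define c where "c = 2 * of_real pi * \<i>"
  define g where "g z = (if z \<in> \<int> then deriv F 0 / c else (F z - F 0) / (char 1 z - 1))" for z
  have per: "g (z + 1) = g z" if "z \<in> strip r" for z
  proof -
    have "z + 1 \<in> \<int> \<longleftrightarrow> z \<in> \<int>" using Ints_add[of z 1] Ints_diff[of "z + 1" 1] by auto
    then show ?thesis using strip_perD(2)[OF F that] by (simp add: g_def char_add)
  qed
  have hol1: "g holomorphic_on strip r - \<int>"
  proof (rule holomorphic_transform)
    show "(\<lambda>z. (F z - F 0) / (char 1 z - 1)) holomorphic_on strip r - \<int>"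
      using holomorphic_on_subset[OF strip_perD(1)[OF F], of "strip r - \<int>"]
      by (intro holomorphic_intros) (auto simp: char_eq_1_iff)
  qed (simp add: g_def)
  have closedZ: "closed (\<int> :: complex set)" by simp
  \<comment> \<open>The singularity is removable: numerator and denominator, each divided by
    \<open>z\<close>, tend to \<open>deriv F 0\<close> and to \<open>c\<close>, the derivative of
    \<open>char 1\<close> at 0. This explains the value given to \<open>g\<close> on the
    integers.\<close>
  have at0: "g field_differentiable at 0"
  proof -
    define U where "U = strip r \<inter> ball 0 1"
    have U0: "0 \<in> U" "open U" using r open_strip by (auto simp: U_def strip_def)
    have UZ: "U - {0} \<subseteq> strip r - \<int>"
    proof
      fix z assume z: "z \<in> U - {0}"
      have "z \<notin> \<int>"
      proof
        assume "z \<in> \<int>"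
        then obtain n where "z = of_int n" by (auto elim: Ints_cases)
        with z show False by (auto simp: U_def)
      qed
      with z show "z \<in> strip r - \<int>" by (simp add: U_def)
    qed
    have "g holomorphic_on U"
    proof (rule no_isolated_singularity')
      show "g holomorphic_on U - {0}" using holomorphic_on_subset[OF hol1 UZ] .
      show "(g \<longlongrightarrow> g z) (at z within U)" if "z \<in> {0}" for z
      proof -
        have "(F has_field_derivative deriv F 0) (at 0)"
          using strip_perD(4)[OF F, of 0] r by (simp add: strip_def)
        then have 1: "((\<lambda>z. (F z - F 0) / z) \<longlongrightarrow> deriv F 0) (at 0)"
          by (simp add: has_field_derivative_iff)
        have "(char 1 has_field_derivative c) (at 0)"
          unfolding char_def[abs_def] c_def by (auto intro!: derivative_eq_intros)
        then have 2: "((\<lambda>z. (char 1 z - 1) / z) \<longlongrightarrow> c) (at 0)"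
          by (simp add: has_field_derivative_iff)
        have "((\<lambda>z. ((F z - F 0) / z) / ((char 1 z - 1) / z)) \<longlongrightarrow> deriv F 0 / c) (at 0)"
          by (intro tendsto_divide 1 2) (simp add: c_def)
        then have "((\<lambda>z. ((F z - F 0) / z) / ((char 1 z - 1) / z)) \<longlongrightarrow> g 0) (at 0 within U)"
          by (simp add: g_def tendsto_within_subset[OF _ subset_UNIV])
        moreover have "\<forall>\<^sub>F z in at 0 within U. ((F z - F 0) / z) / ((char 1 z - 1) / z) = g z"
        proof -
          have "z \<notin> \<int>" if "z \<in> U" "z \<noteq> 0" for z using that UZ by auto
          then show ?thesis by (auto simp: eventually_at_filter g_def intro!: always_eventually)
        qed
        ultimately show ?thesis using that by (simp add: tendsto_cong)
      qed
    qed (use U0 in auto)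
    then show ?thesis using U0 holomorphic_on_imp_differentiable_at by blast
  qed
  have "g field_differentiable at z" if z: "z \<in> strip r" for z
  proof (cases "z \<in> \<int>")
    case True
    then obtain n where n: "z = of_int n" by (auto elim: Ints_cases)
    have "((\<lambda>w. g (w + of_int (- n))) has_field_derivative deriv g 0) (at z)"
      using at0 unfolding DERIV_shift[symmetric] n by (simp add: DERIV_deriv_iff_field_differentiable)
    then have "(g has_field_derivative deriv g 0) (at z)"
      by (rule has_field_derivative_transform_within_open[OF _ open_strip z]) (rule periodic_int[of r g, OF per])
    then show ?thesis using field_differentiable_def by blast
  next
    case False
    have "open (strip r - \<int>)" using open_strip closedZ by (rule open_Diff)
    then show ?thesis using holomorphic_on_imp_differentiable_at[OF hol1] False z by blast
  qed
  then have "g holomorphic_on strip r"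
    by (simp add: holomorphic_on_def field_differentiable_at_within)
  moreover have "F z - F 0 = g z * char 1 z - g z" if z: "z \<in> strip r" for z
  proof (cases "z \<in> \<int>")
    case True
    then obtain n where n: "z = of_int n" by (auto elim: Ints_cases)
    have "F (0 + of_int n) = F 0"
      by (rule periodic_int[of r F]) (use r strip_perD(2)[OF F] in \<open>simp_all add: strip_def\<close>)
    moreover have "char 1 z = 1" using True by (simp add: char_eq_1_iff)
    ultimately show ?thesis by (simp add: n)
  next
    case False
    then have "char 1 z \<noteq> 1" by (simp add: char_eq_1_iff)
    then have "F z - F 0 = (F z - F 0) / (char 1 z - 1) * (char 1 z - 1)" by simp
    also have "\<dots> = g z * char 1 z - g z" using False by (simp add: g_def right_diff_distrib)
    finally show ?thesis .
  qed
  ultimately show ?thesis using per by (auto simp: strip_per_def)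
qed

text \<open>The coefficient of \<open>F - F 0\<close> at \<open>k\<close> is the difference of the
  coefficients of \<open>g\<close> at \<open>k - 1\<close> and at \<open>k\<close>. Symmetric
  partial sums thus collapse to four coefficients of \<open>g\<close>, two of which tend to 0 by
  exponential decay. Index \<open>n\<close> stands for the frequencies \<open>n + 1\<close> and
  \<open>- (n + 1)\<close>.\<close>

lemma fourier_sums_at_0:
  assumes F: "strip_per r F" and r: "r > 0"
  shows "(\<lambda>n. fcoef F (int (Suc n)) + fcoef F (- int (Suc n))) sums (F 0 - average F)"
proof -
  obtain g where g: "strip_per r g" and eq: "\<And>z. z \<in> strip r \<Longrightarrow> F z - F 0 = g z * char 1 z - g z"
    using quotient_by_char[OF assms] by blast
  have c: "fcoef (\<lambda>z. F z - F 0) k = fcoef g (k - 1) - fcoef g k" for k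
  proof -
    have "fcoef (\<lambda>z. F z - F 0) k = average (\<lambda>z. g z * char (- (k - 1)) z - g z * char (- k) z)"
      unfolding fcoef_def
      by (rule average_cong) (use eq r char_int[of 1 "- k"] in \<open>simp add: left_diff_distrib\<close>)
    also have "\<dots> = fcoef g (k - 1) - fcoef g k"
      unfolding fcoef_def by (intro average_diff[where r = r] strip_per_mult strip_per_char g r)
    finally show ?thesis .
  qed
  have c': "fcoef (\<lambda>z. F z - F 0) k = fcoef F k - fcoef (\<lambda>z. F 0) k" for k
  proof -
    have "fcoef (\<lambda>z. F z - F 0) k = average (\<lambda>z. F z * char (- k) z - F 0 * char (- k) z)"
      unfolding fcoef_def by (simp add: algebra_simps)
    also have "\<dots> = fcoef F k - fcoef (\<lambda>z. F 0) k"
      unfolding fcoef_def by (intro average_diff[where r = r] strip_per_mult strip_per_char strip_per_const F r)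
    finally show ?thesis .
  qed
  have nz: "fcoef F k = fcoef g (k - 1) - fcoef g k" if "k \<noteq> 0" for k
    using c[of k] c'[of k] fcoef_const[OF that] by simp
  \<comment> \<open>Frequency 0 enters only here; it identifies the two boundary terms that survive
    the limit.\<close>
  have z: "average F - F 0 = fcoef g (- 1) - fcoef g 0"
    using c[of 0] c'[of 0] by (simp add: fcoef_0)
  have part: "(\<Sum>n<N. fcoef F (int (Suc n)) + fcoef F (- int (Suc n)))
      = (fcoef g 0 - fcoef g (int N)) + (fcoef g (- int N - 1) - fcoef g (- 1))" for N
  proof (induction N)
    case (Suc N)
    have "- int (Suc N) - 1 = - int (Suc N) + - 1" "int (Suc N) - 1 = int N" "- int (Suc N) = - int N - 1" by simp_all
    moreover have "fcoef g (- 1 - int N) = fcoef g (- int N - 1)"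
      by (rule arg_cong[of _ _ "fcoef g"]) simp
    ultimately show ?case unfolding sum.lessThan_Suc Suc.IH by (simp add: nz)
  qed simp
  obtain C where C: "\<And>k. cmod (fcoef g k) \<le> C * exp (- 2 * pi * \<bar>of_int k\<bar> * (r / 2))"
    using fcoef_decay[OF g, of "r / 2"] r by auto
  have lim1: "(\<lambda>N. C * exp (- 2 * pi * real N * (r / 2))) \<longlonglongrightarrow> 0"
    using r by real_asymp
  have "(\<lambda>N. fcoef g (int N)) \<longlonglongrightarrow> 0"
    by (rule Lim_null_comparison[OF _ lim1]) (use C[of "int _"] in \<open>auto intro!: always_eventually\<close>)
  moreover have lim2: "(\<lambda>N. C * exp (- 2 * pi * (real N + 1) * (r / 2))) \<longlonglongrightarrow> 0"
    using r by real_asymp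
  have "(\<lambda>N. fcoef g (- int N - 1)) \<longlonglongrightarrow> 0"
  proof (rule Lim_null_comparison[OF _ lim2])
    have "cmod (fcoef g (- int N - 1)) \<le> C * exp (- 2 * pi * (real N + 1) * (r / 2))" for N
      using C[of "- int N - 1"] by (simp add: add.commute)
    then show "\<forall>\<^sub>F N in sequentially. cmod (fcoef g (- int N - 1)) \<le> C * exp (- 2 * pi * (real N + 1) * (r / 2))"
      by (rule always_eventually[OF allI])
  qed
  ultimately have "(\<lambda>N. (fcoef g 0 - fcoef g (int N)) + (fcoef g (- int N - 1) - fcoef g (- 1)))
      \<longlonglongrightarrow> (fcoef g 0 - 0) + (0 - fcoef g (- 1))"
    by (intro tendsto_intros)
  moreover have "(fcoef g 0 - 0) + (0 - fcoef g (- 1)) = F 0 - average F" using z by (simp add: algebra_simps)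
  ultimately show ?thesis unfolding sums_def part by simp
qed

text \<open>Translation by \<open>x\<close> moves the evaluation point to 0. The translate is
  holomorphic on the strip of half-width \<open>r - |Im x|\<close>, and \<open>fcoef_shift\<close>
  produces the characters.\<close>

lemma fourier_sums:
  assumes \<eta>: "strip_per r \<eta>" and x: "x \<in> strip r"
  shows "(\<lambda>n. fcoef \<eta> (int (Suc n)) * char (int (Suc n)) x + fcoef \<eta> (- int (Suc n)) * char (- int (Suc n)) x)
     sums (\<eta> x - average \<eta>)"
proof -
  define r' where "r' = r - \<bar>Im x\<bar>"
  have r': "r' > 0" using x by (simp add: strip_def r'_def)
  have sub: "t + x \<in> strip r" if "t \<in> strip r'" for t
    using that by (auto simp: strip_def r'_def)
  have "strip_per r' (\<lambda>t. \<eta> (t + x))"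
  proof -
    have "(\<lambda>t. \<eta> (t + x)) holomorphic_on strip r'"
      by (rule holomorphic_on_compose_gen[of "\<lambda>t. t + x" _ \<eta>, unfolded o_def])
         (use strip_perD(1)[OF \<eta>] sub in \<open>auto intro!: holomorphic_intros\<close>)
    moreover have "\<eta> (t + 1 + x) = \<eta> (t + x)" if "t \<in> strip r'" for t
      using strip_perD(2)[OF \<eta> sub[OF that]] by (simp add: algebra_simps)
    ultimately show ?thesis by (simp add: strip_per_def)
  qed
  from fourier_sums_at_0[OF this r'] show ?thesis
    by (simp add: fcoef_shift[OF \<eta> x] average_shift[OF \<eta> x] mult.commute del: of_nat_Suc)
qed

section \<open>Small divisors and the solution of the cohomological equation\<close>

lemma sin_ge_chord:
  assumes "0 \<le> y" "y \<le> 1 / 2"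
  shows "sin (pi * y) \<ge> 2 * y"
proof -
  have "convex_on {0..pi/2} (\<lambda>x. - sin x)"
    by (rule f''_ge0_imp_convex[where f' = "\<lambda>x. - cos x" and f'' = sin])
       (auto intro!: derivative_eq_intros sin_ge_zero)
  from convex_onD[OF this, of "2 * y" 0 "pi / 2"] assms
  show ?thesis by (simp add: algebra_simps)
qed

text \<open>With \<open>y\<close> the signed distance of \<open>k * \<theta>\<close> to the nearest
  integer, the divisor has modulus \<open>2 |sin (pi y)| >= 4 |y|\<close>, and the Diophantine
  condition with that integer as \<open>p\<close> bounds \<open>|y|\<close> from below.\<close>

lemma small_divisor:
  assumes "\<theta> \<in> diophantine \<gamma> \<tau>" "k \<noteq> 0"
  shows "cmod (1 - char k (of_real \<theta>)) \<ge> 4 * \<gamma> * \<bar>of_int k\<bar> powr (- \<tau>)"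
proof -
  define n where "n = round (of_int k * \<theta>)"
  define y where "y = of_int k * \<theta> - of_int n"
  have y: "\<bar>y\<bar> \<le> 1 / 2"
    using of_int_round_abs_le[of "of_int k * \<theta>"] by (simp add: y_def n_def abs_minus_commute)
  have "2 * of_real pi * \<i> * of_int k * of_real \<theta> = \<i> * of_real (2 * pi * y) + \<i> * (of_int n * (of_real pi * 2))"
    by (simp add: y_def algebra_simps)
  then have "char k (of_real \<theta>) = exp (\<i> * of_real (2 * pi * y)) * exp (\<i> * (of_int n * (of_real pi * 2)))"
    by (simp only: char_def exp_add)
  then have "cmod (1 - char k (of_real \<theta>)) = 2 * \<bar>sin (pi * y)\<bar>"
    using dist_exp_i_1[of "2 * pi * y"] by (simp add: norm_minus_commute)
  moreover have "\<bar>sin (pi * y)\<bar> \<ge> 2 * \<bar>y\<bar>"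
    using sin_ge_chord[of y] sin_ge_chord[of "- y"] y by (cases "y \<ge> 0") auto
  moreover have "\<bar>y\<bar> \<ge> \<gamma> * \<bar>of_int k\<bar> powr (- \<tau>)"
    using assms by (auto simp: diophantine_def y_def)
  ultimately show ?thesis by linarith
qed

lemma power_le_fact_exp: "0 \<le> (y::real) \<Longrightarrow> y ^ m \<le> fact m * exp y"
proof -
  assume y: "0 \<le> y"
  have "(\<Sum>n\<in>{m}. inverse (fact n) *\<^sub>R y ^ n) \<le> (\<Sum>n. inverse (fact n) *\<^sub>R y ^ n)"
    by (rule sum_le_suminf) (use y summable_exp_generic[of y] in auto)
  then show ?thesis by (simp add: exp_def field_simps)
qed

text \<open>The power of the frequency that exponential decay must supply: at least
  \<open>\<tau>\<close> to compensate the small divisor, and 2 more to leave a series dominated by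
  the sum of \<open>1 / k^2\<close>.\<close>

definition coh_order :: "real \<Rightarrow> nat" where
  "coh_order \<tau> = nat \<lceil>\<tau>\<rceil> + 2"

text \<open>The terms at \<open>k\<close> and \<open>- k\<close> each contribute a factor
  \<open>fact m / (4 * \<gamma>)\<close>, where \<open>m\<close> is \<open>coh_order \<tau>\<close>,
  and the sum \<open>pi^2 / 6\<close> of the inverse squares is estimated by 4.\<close>

definition coh_const :: "real \<Rightarrow> real \<Rightarrow> real" where
  "coh_const \<gamma> \<tau> = 2 * fact (coh_order \<tau>) / \<gamma>"

text \<open>Coefficient \<open>k\<close> is divided by \<open>1 - char k \<theta>\<close> for
  \<open>k \<noteq> 0\<close>, and the zero average disposes of the frequency where the divisor
  vanishes. On the narrower strip the decay of the coefficients beats the growth of the characters;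
  the surplus exponential is traded for a power of \<open>1 / \<delta>\<close>.\<close>

lemma cohomological_equation:
  assumes \<theta>: "\<theta> \<in> diophantine \<gamma> \<tau>" and \<gamma>: "\<gamma> > 0"
    and \<eta>: "strip_per r \<eta>" "real_on_reals \<eta>" "average \<eta> = 0"
    and B: "\<And>z. z \<in> strip r \<Longrightarrow> cmod (\<eta> z) \<le> B" and \<delta>: "0 < \<delta>" "\<delta> < r"
  shows "\<exists>u. strip_per (r - \<delta>) u \<and> real_on_reals u \<and>
    (\<forall>z\<in>strip (r - \<delta>). u z - u (z + of_real \<theta>) = \<eta> z \<and>
       cmod (u z) \<le> coh_const \<gamma> \<tau> / \<delta> ^ coh_order \<tau> * B)"
proof -
  define m where "m = coh_order \<tau>"
  define a where "a k = fcoef \<eta> k / (1 - char k (of_real \<theta>))" for k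
  define T where "T n z = a (int (Suc n)) * char (int (Suc n)) z + a (- int (Suc n)) * char (- int (Suc n)) z" for n z
  define M where "M n = B * fact m / (2 * \<gamma> * \<delta> ^ m) * (1 / (real n + 1)\<^sup>2)" for n
  define u where "u z = (\<Sum>n. T n z)" for z
  have B0: "B \<ge> 0" using B[of 0] \<delta> by (auto simp: strip_def intro: order_trans[OF norm_ge_zero])
  have coef_bound: "cmod (a k * char k z) \<le> B * fact m / (4 * \<gamma> * \<delta> ^ m) * (1 / (of_int \<bar>k\<bar>)\<^sup>2)"
    if k: "k \<noteq> 0" and z: "z \<in> strip (r - \<delta>)" for k z
  proof -
    define K where "K = real_of_int \<bar>k\<bar>"
    have K: "K \<ge> 1" using k by (simp add: K_def)
    \<comment> \<open>The coefficient is estimated at height \<open>r - \<delta> / 2\<close>,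
      strictly inside the strip, while \<open>z\<close> has height below
      \<open>r - \<delta>\<close>. The gap leaves the factor
      \<open>exp (- (pi * K * \<delta>))\<close>.\<close>
    have "cmod (fcoef \<eta> k) \<le> B * exp (- 2 * pi * \<bar>of_int k\<bar> * (r - \<delta> / 2))"
      by (rule fcoef_bound[OF \<eta>(1)]) (use \<delta> in \<open>auto intro!: B simp: strip_def\<close>)
    moreover have "cmod (char k z) \<le> exp (2 * pi * K * (r - \<delta>))"
    proof -
      have "- (of_int k * Im z) \<le> K * \<bar>Im z\<bar>"
        using abs_ge_minus_self[of "of_int k * Im z"] by (simp add: abs_mult K_def)
      also have "\<dots> \<le> K * (r - \<delta>)" using z K by (intro mult_left_mono) (auto simp: strip_def)
      finally have "2 * pi * (- (of_int k * Im z)) \<le> 2 * pi * (K * (r - \<delta>))" by (intro mult_left_mono) auto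
      then show ?thesis by (simp add: norm_char mult.assoc)
    qed
    ultimately have "cmod (fcoef \<eta> k) * cmod (char k z)
        \<le> (B * exp (- 2 * pi * K * (r - \<delta> / 2))) * exp (2 * pi * K * (r - \<delta>))"
      using B0 by (intro mult_mono) (auto simp: K_def)
    also have "\<dots> = B * exp (- (pi * K * \<delta>))"
      by (simp add: exp_add[symmetric] algebra_simps)
    also have "\<dots> \<le> B * exp (- (K * \<delta>))"
    proof -
      have "1 * (K * \<delta>) \<le> pi * (K * \<delta>)" using pi_ge_two K \<delta> by (intro mult_right_mono) auto
      then show ?thesis using B0 by (intro mult_left_mono) (auto simp: mult.assoc)
    qed
    also have "\<dots> \<le> B * (fact m / (K * \<delta>) ^ m)"
      using power_le_fact_exp[of "K * \<delta>" m] K \<delta> B0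
      by (intro mult_left_mono) (auto simp: exp_minus field_simps)
    finally have 1: "cmod (fcoef \<eta> k) * cmod (char k z) \<le> B * (fact m / (K * \<delta>) ^ m)" .
    have "K powr \<tau> \<le> K powr real (m - 2)"
      using K by (intro powr_mono) (auto simp: m_def coh_order_def, linarith)
    then have "K powr \<tau> \<le> K ^ (m - 2)" using K by (simp add: powr_realpow)
    also have "\<dots> = K ^ m / K ^ 2"
      using K by (subst power_diff) (auto simp: m_def coh_order_def)
    finally have 2: "K powr \<tau> \<le> K ^ m / K ^ 2" .
    have D: "cmod (1 - char k (of_real \<theta>)) \<ge> 4 * \<gamma> / K powr \<tau>"
      using small_divisor[OF \<theta> k] by (simp add: K_def powr_minus field_simps)
    have D0: "4 * \<gamma> / K powr \<tau> > 0" using \<gamma> K by simp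
    have "cmod (a k * char k z) = cmod (fcoef \<eta> k) * cmod (char k z) / cmod (1 - char k (of_real \<theta>))"
      by (simp add: a_def norm_mult norm_divide)
    also have "\<dots> \<le> B * (fact m / (K * \<delta>) ^ m) / (4 * \<gamma> / K powr \<tau>)"
      by (rule frac_le[OF _ 1 D0 D]) (use B0 K \<delta> in simp)
    also have "\<dots> = B * (fact m / (K * \<delta>) ^ m) / (4 * \<gamma>) * K powr \<tau>"
      by (simp only: divide_divide_eq_right times_divide_eq_left)
    also have "\<dots> \<le> B * (fact m / (K * \<delta>) ^ m) / (4 * \<gamma>) * (K ^ m / K ^ 2)"
      using 2 B0 K \<delta> \<gamma> by (intro mult_left_mono) auto
    also have "\<dots> = B * fact m / (4 * \<gamma> * \<delta> ^ m) * (1 / K\<^sup>2)"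
      using K \<delta> \<gamma> by (simp add: field_simps)
    finally show ?thesis by (simp add: K_def)
  qed
  have Tb: "cmod (T n z) \<le> M n" if "z \<in> strip (r - \<delta>)" for n z
  proof -
    have abs: "real_of_int \<bar>int (Suc n)\<bar> = real n + 1" "real_of_int \<bar>- int (Suc n)\<bar> = real n + 1" by simp_all
    have "cmod (T n z) \<le> B * fact m / (4 * \<gamma> * \<delta> ^ m) * (1 / (real n + 1)\<^sup>2) + B * fact m / (4 * \<gamma> * \<delta> ^ m) * (1 / (real n + 1)\<^sup>2)"
      unfolding T_def
      by (rule norm_triangle_mono)
         (use coef_bound[of "int (Suc n)" z, unfolded abs] coef_bound[of "- int (Suc n)" z, unfolded abs] that in simp_all)
    also have "\<dots> = M n" using \<gamma> \<delta> by (simp add: M_def field_simps)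
    finally show ?thesis .
  qed
  have Ms: "M sums (B * fact m / (2 * \<gamma> * \<delta> ^ m) * (pi\<^sup>2 / 6))"
    unfolding M_def using inverse_squares_sums by (intro sums_mult) (simp add: add.commute)
  have Mle: "suminf M \<le> coh_const \<gamma> \<tau> / \<delta> ^ m * B"
  proof -
    have "pi\<^sup>2 \<le> 4\<^sup>2" using pi_less_4 by (intro power_mono) auto
    then have "suminf M \<le> B * fact m / (2 * \<gamma> * \<delta> ^ m) * 4"
      using B0 \<gamma> \<delta> unfolding sums_unique[OF Ms, symmetric] by (intro mult_left_mono) auto
    also have "\<dots> = coh_const \<gamma> \<tau> / \<delta> ^ m * B" by (simp add: coh_const_def m_def)
    finally show ?thesis .
  qed
  have Ts: "summable (\<lambda>n. T n z)" if "z \<in> strip (r - \<delta>)" for z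
    by (rule summable_comparison_test'[OF sums_summable[OF Ms], of 0]) (use Tb[OF that] in auto)
  have ul: "uniform_limit (strip (r - \<delta>)) (\<lambda>N z. \<Sum>n<N. T n z) u sequentially"
    unfolding u_def using Tb sums_summable[OF Ms] by (rule Weierstrass_m_test)
  have "u holomorphic_on strip (r - \<delta>)"
  proof (rule holomorphic_uniform_sequence[OF open_strip])
    show "(\<lambda>z. \<Sum>n<N. T n z) holomorphic_on strip (r - \<delta>)" for N
      unfolding T_def by (intro holomorphic_intros)
    show "\<exists>d>0. cball x d \<subseteq> strip (r - \<delta>) \<and> uniform_limit (cball x d) (\<lambda>N z. \<Sum>n<N. T n z) u sequentially"
      if "x \<in> strip (r - \<delta>)" for x
      using open_contains_cball[THEN iffD1, OF open_strip, rule_format, OF that] uniform_limit_on_subset[OF ul] by blast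
  qed
  moreover have "u (z + 1) = u z" for z
    by (simp add: u_def T_def char_add)
  moreover have "real_on_reals u"
    unfolding real_on_reals_def
  proof
    fix t :: real
    \<comment> \<open>Conjugate symmetry makes the paired terms of \<open>T\<close> real on the real
      line.\<close>
    have "a (- k) = cnj (a k)" for k
      using fcoef_cnj[OF \<eta>(2)] by (simp add: a_def char_cnj)
    then have "Im (T n (of_real t)) = 0" for n
      by (simp add: T_def char_cnj del: of_nat_Suc)
    moreover have "(\<lambda>n. Im (T n (of_real t))) sums Im (u (of_real t))"
      unfolding u_def using Ts[of "of_real t"] \<delta> by (intro sums_Im summable_sums) (simp add: strip_def)
    ultimately have "(\<lambda>n. 0) sums Im (u (of_real t))" by simp
    then have "Im (u (of_real t)) = 0" by (rule sums_unique2[OF _ sums_zero])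
    then show "u (of_real t) \<in> \<real>" by (simp add: complex_is_Real_iff)
  qed
  moreover have "u z - u (z + of_real \<theta>) = \<eta> z" if z: "z \<in> strip (r - \<delta>)" for z
  proof -
    have "(\<lambda>n. T n z - T n (z + of_real \<theta>)) sums (u z - u (z + of_real \<theta>))"
      unfolding u_def using Ts[of z] Ts[of "z + of_real \<theta>"] z by (intro sums_diff summable_sums) auto
    moreover have "a k * char k z - a k * char k (z + of_real \<theta>) = fcoef \<eta> k * char k z" if "k \<noteq> 0" for k
    proof -
      have "4 * \<gamma> * \<bar>of_int k\<bar> powr (- \<tau>) > 0" using that \<gamma> by simp
      then have "1 - char k (of_real \<theta>) \<noteq> 0" using small_divisor[OF \<theta> that] by auto
      moreover have "a k * char k z - a k * char k (z + of_real \<theta>) = a k * (1 - char k (of_real \<theta>)) * char k z"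
        by (simp add: char_add algebra_simps)
      ultimately show ?thesis by (simp add: a_def)
    qed
    then have "T n z - T n (z + of_real \<theta>) = fcoef \<eta> (int (Suc n)) * char (int (Suc n)) z
        + fcoef \<eta> (- int (Suc n)) * char (- int (Suc n)) z" for n
      unfolding T_def by (simp add: add_diff_add del: of_nat_Suc)
    ultimately have "(\<lambda>n. fcoef \<eta> (int (Suc n)) * char (int (Suc n)) z
        + fcoef \<eta> (- int (Suc n)) * char (- int (Suc n)) z) sums (u z - u (z + of_real \<theta>))"
      by (simp del: of_nat_Suc)
    moreover have "z \<in> strip r" using z \<delta> by (simp add: strip_def)
    ultimately show ?thesis
      using sums_unique2[OF _ fourier_sums[OF \<eta>(1)]] \<eta>(3) by simp
  qed
  moreover have "cmod (u z) \<le> coh_const \<gamma> \<tau> / \<delta> ^ m * B" if "z \<in> strip (r - \<delta>)" for z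
    unfolding u_def using norm_suminf_le[OF Tb[OF that] sums_summable[OF Ms]] Mle by linarith
  ultimately show ?thesis unfolding strip_per_def m_def by blast
qed

section \<open>Taylor estimates for the family\<close>

lemma has_vector_derivativeI_quotient:
  fixes f :: "real \<Rightarrow> complex"
  assumes "((\<lambda>y. (f y - f x) / of_real (y - x)) \<longlongrightarrow> D) (at x)"
  shows "(f has_vector_derivative D) (at x)"
proof -
  have "((\<lambda>y. (f y - f x) / of_real (y - x) - D) \<longlongrightarrow> 0) (at x)"
    using tendsto_diff[OF assms tendsto_const[of D]] by simp
  then have "((\<lambda>y. norm ((f y - f x) / of_real (y - x) - D)) \<longlongrightarrow> 0) (at x)"
    by (rule tendsto_norm_zero)
  moreover have "\<forall>\<^sub>F y in at x. norm ((f y - f x) / of_real (y - x) - D)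
      = norm ((f y - f x) - (y - x) *\<^sub>R D) / norm (y - x)"
    unfolding eventually_at_filter
  proof (intro always_eventually allI impI)
    fix y assume "y \<noteq> x"
    then have "of_real (y - x) * ((f y - f x) / of_real (y - x)) = f y - f x" by simp
    then have "(f y - f x) - (y - x) *\<^sub>R D = of_real (y - x) * ((f y - f x) / of_real (y - x) - D)"
      by (simp only: right_diff_distrib scaleR_conv_of_real)
    then have "norm ((f y - f x) - (y - x) *\<^sub>R D) = \<bar>y - x\<bar> * norm ((f y - f x) / of_real (y - x) - D)"
      by (simp only: norm_mult norm_of_real)
    then show "norm ((f y - f x) / of_real (y - x) - D) = norm ((f y - f x) - (y - x) *\<^sub>R D) / norm (y - x)"
      using \<open>y \<noteq> x\<close> by simp
  qed
  ultimately have "((\<lambda>y. norm ((f y - f x) - (y - x) *\<^sub>R D) / norm (y - x)) \<longlongrightarrow> 0) (at x)"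
    by (simp only: tendsto_cong)
  then show ?thesis
    unfolding has_vector_derivative_def has_derivative_iff_norm by (simp add: bounded_linear_scaleR_left)
qed

lemma strip_norm_leD: "strip_norm r g \<le> ereal B \<Longrightarrow> z \<in> strip r \<Longrightarrow> cmod (g z) \<le> B"
proof -
  assume le: "strip_norm r g \<le> ereal B" and z: "z \<in> strip r"
  have "ereal (cmod (g z)) \<le> strip_norm r g" unfolding strip_norm_def by (rule SUP_upper[OF z])
  also note le
  finally show ?thesis by simp
qed

lemma strip_norm_leI: "(\<And>z. z \<in> strip r \<Longrightarrow> cmod (g z) \<le> B) \<Longrightarrow> strip_norm r g \<le> ereal B"
  unfolding strip_norm_def by (simp add: SUP_le_iff)

text \<open>A single \<open>M\<close> for all derivatives of order 1 and 2 stands in for the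
  individual constants; the theorem instantiates it with the sum of their absolute values.\<close>

locale C2_bounded_family =
  fixes A :: "real set" and f :: "real \<Rightarrow> complex \<Rightarrow> complex" and R M :: real
  assumes A_open: "open A" and R_pos: "R > 0" and C2: "C2_family A R f"
    and M_bound: "\<And>i j. 1 \<le> i + j \<Longrightarrow> i + j \<le> 2 \<Longrightarrow> family_norm A R (pd i j f) \<le> ereal M"
begin

abbreviation "fa \<equiv> d_alpha f"

lemma pd_bound:
  assumes "1 \<le> i + j" "i + j \<le> 2" "\<beta> \<in> A" "z \<in> strip R"
  shows "cmod (pd i j f \<beta> z) \<le> M"
proof (rule strip_norm_leD[OF _ assms(4)])
  show "strip_norm R (pd i j f \<beta>) \<le> ereal M"
    using M_bound[OF assms(1,2)] assms(3) by (auto simp: family_norm_def SUP_le_iff)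
qed

lemma
  assumes "\<beta> \<in> A" "z \<in> strip R"
  shows f_x_bound: "cmod (deriv (f \<beta>) z) \<le> M" and f_a_bound: "cmod (fa \<beta> z) \<le> M"
    and f_xx_bound: "cmod (deriv (deriv (f \<beta>)) z) \<le> M" and f_xa_bound: "cmod (deriv (fa \<beta>) z) \<le> M"
    and f_aa_bound: "cmod (d_alpha fa \<beta> z) \<le> M"
  using pd_bound[of 1 0 \<beta> z] pd_bound[of 0 1 \<beta> z] pd_bound[of 2 0 \<beta> z] pd_bound[of 1 1 \<beta> z] pd_bound[of 0 2 \<beta> z] assms
  by (simp_all add: pd_def d_x_def numeral_2_eq_2)

lemma
  assumes "\<beta> \<in> A"
  shows f_per: "strip_per R (\<lambda>z. f \<beta> z - z)" and f_real: "real_on_reals (f \<beta>)"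
    and f_per': "\<And>z. z \<in> closed_strip R \<Longrightarrow> f \<beta> (z + 1) = f \<beta> z + 1"
proof -
  have P: "(\<lambda>x. f \<beta> x - x) \<in> Per R" using C2 assms by (auto simp: C2_family_def circle_maps_def)
  have sub: "strip R \<subseteq> closed_strip R" by (auto simp: strip_def closed_strip_def)
  show per: "f \<beta> (z + 1) = f \<beta> z + 1" if "z \<in> closed_strip R" for z
  proof -
    have "f \<beta> (z + 1) - (z + 1) = f \<beta> z - z" using P that by (auto simp: Per_def)
    then show ?thesis by (simp add: algebra_simps)
  qed
  show "strip_per R (\<lambda>z. f \<beta> z - z)"
    using P sub per by (auto simp: Per_def strip_per_def)
  show "real_on_reals (f \<beta>)" unfolding real_on_reals_def
  proof
    fix t :: real
    have "f \<beta> (of_real t) - of_real t \<in> \<real>" using P by (auto simp: Per_def image_subset_iff)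
    from Reals_add[OF this Reals_of_real[of t]] show "f \<beta> (of_real t) \<in> \<real>" by simp
  qed
qed

lemma f_hol:
  assumes "\<beta> \<in> A"
  shows "f \<beta> holomorphic_on strip R"
  using holomorphic_on_add[OF strip_perD(1)[OF f_per[OF assms]] holomorphic_on_ident] by simp

lemma A_eventually: "\<beta> \<in> A \<Longrightarrow> \<forall>\<^sub>F b in at \<beta>. b \<in> A"
  using A_open eventually_at_topological by blast

lemma
  assumes "\<beta> \<in> A"
  shows f_quot: "uniform_limit (closed_strip R) (\<lambda>b x. (f b x - f \<beta> x) / of_real (b - \<beta>)) (fa \<beta>) (at \<beta>)"
    and fa_quot: "uniform_limit (closed_strip R) (\<lambda>b x. (fa b x - fa \<beta> x) / of_real (b - \<beta>)) (d_alpha fa \<beta>) (at \<beta>)"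
  using C2 assms by (auto simp: C2_family_def sup_differentiable_on_def)

lemma strip_closed_strip: "z \<in> strip R \<Longrightarrow> z \<in> closed_strip R"
  by (simp add: strip_def closed_strip_def)

lemma f_vec: "\<beta> \<in> A \<Longrightarrow> z \<in> closed_strip R \<Longrightarrow> ((\<lambda>b. f b z) has_vector_derivative fa \<beta> z) (at \<beta>)"
  and fa_vec: "\<beta> \<in> A \<Longrightarrow> z \<in> closed_strip R \<Longrightarrow> ((\<lambda>b. fa b z) has_vector_derivative d_alpha fa \<beta> z) (at \<beta>)"
  by (rule has_vector_derivativeI_quotient[OF tendsto_uniform_limitI[OF f_quot]]
       has_vector_derivativeI_quotient[OF tendsto_uniform_limitI[OF fa_quot]]; assumption)+

text \<open>On discs inside the strip the parameter derivative is a uniform limit of difference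
  quotients, each of which is holomorphic in the space variable.\<close>

lemma fa_hol:
  assumes "\<beta> \<in> A"
  shows "fa \<beta> holomorphic_on strip R"
proof -
  have "fa \<beta> field_differentiable at z" if z: "z \<in> strip R" for z
  proof -
    obtain d where d: "d > 0" "cball z d \<subseteq> strip R"
      using open_contains_cball[THEN iffD1, OF open_strip] z by blast
    have sub: "strip R \<subseteq> closed_strip R" by (auto simp: strip_def closed_strip_def)
    have hol: "(\<lambda>x. (f b x - f \<beta> x) / of_real (b - \<beta>)) holomorphic_on strip R" if "b \<in> A" "b \<noteq> \<beta>" for b
      using f_hol that assms by (intro holomorphic_intros) auto
    have ev: "\<forall>\<^sub>F b in at \<beta>. continuous_on (cball z d) (\<lambda>x. (f b x - f \<beta> x) / of_real (b - \<beta>))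
        \<and> (\<lambda>x. (f b x - f \<beta> x) / of_real (b - \<beta>)) holomorphic_on ball z d"
      using eventually_conj[OF A_eventually[OF assms] eventually_neq_at_within[of \<beta>]]
    proof (rule eventually_mono)
      fix b assume b: "b \<in> A \<and> b \<noteq> \<beta>"
      then have *: "(\<lambda>x. (f b x - f \<beta> x) / of_real (b - \<beta>)) holomorphic_on cball z d"
        by (intro holomorphic_on_subset[OF hol d(2)]) auto
      show "continuous_on (cball z d) (\<lambda>x. (f b x - f \<beta> x) / of_real (b - \<beta>))
        \<and> (\<lambda>x. (f b x - f \<beta> x) / of_real (b - \<beta>)) holomorphic_on ball z d"
        using holomorphic_on_imp_continuous_on[OF *] holomorphic_on_subset[OF * ball_subset_cball] by blast
    qed
    have "fa \<beta> holomorphic_on ball z d"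
    proof (rule holomorphic_uniform_limit[OF ev])
      show "uniform_limit (cball z d) (\<lambda>b x. (f b x - f \<beta> x) / of_real (b - \<beta>)) (fa \<beta>) (at \<beta>)"
        using d(2) sub by (intro uniform_limit_on_subset[OF f_quot[OF assms]]) blast
    qed simp_all
    then show ?thesis using d(1) by (intro holomorphic_on_imp_differentiable_at[of _ "ball z d"]) simp_all
  qed
  then show ?thesis by (simp add: holomorphic_on_def field_differentiable_at_within)
qed

lemma fa_per:
  assumes "\<beta> \<in> A"
  shows "strip_per R (fa \<beta>)"
proof -
  have "fa \<beta> (z + 1) = fa \<beta> z" if "z \<in> strip R" for z
  proof (rule tendsto_unique)
    have z: "z \<in> closed_strip R" "z + 1 \<in> closed_strip R" using that by (auto simp: strip_def closed_strip_def)
    show "((\<lambda>b. (f b z - f \<beta> z) / of_real (b - \<beta>)) \<longlongrightarrow> fa \<beta> z) (at \<beta>)"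
      using tendsto_uniform_limitI[OF f_quot[OF assms] z(1)] .
    have "\<forall>\<^sub>F b in at \<beta>. (f b (z + 1) - f \<beta> (z + 1)) / of_real (b - \<beta>) = (f b z - f \<beta> z) / of_real (b - \<beta>)"
      using A_eventually[OF assms] by eventually_elim (use f_per' z(1) assms in simp)
    then show "((\<lambda>b. (f b z - f \<beta> z) / of_real (b - \<beta>)) \<longlongrightarrow> fa \<beta> (z + 1)) (at \<beta>)"
      by (rule Lim_transform_eventually[OF tendsto_uniform_limitI[OF f_quot[OF assms] z(2)]])
  qed simp
  then show ?thesis using fa_hol[OF assms] by (simp add: strip_per_def)
qed

lemma fa_real:
  assumes "\<beta> \<in> A"
  shows "real_on_reals (fa \<beta>)"
  unfolding real_on_reals_def
proof
  fix t :: real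
  have t: "of_real t \<in> closed_strip R" using R_pos by (simp add: closed_strip_def)
  have ev: "\<forall>\<^sub>F b in at \<beta>. (f b (of_real t) - f \<beta> (of_real t)) / of_real (b - \<beta>) \<in> \<real>"
    using A_eventually[OF assms]
    by eventually_elim (use f_real assms in \<open>auto simp: real_on_reals_def intro!: Reals_divide Reals_diff\<close>)
  show "fa \<beta> (of_real t) \<in> \<real>"
    by (rule Lim_in_closed_set[OF closed_complex_Reals ev _ tendsto_uniform_limitI[OF f_quot[OF assms] t]]) simp
qed

lemma strip_bound_diff:
  assumes "g holomorphic_on strip R" "\<And>z. z \<in> strip R \<Longrightarrow> cmod (deriv g z) \<le> B" "z \<in> strip R" "w \<in> strip R"
  shows "cmod (g z - g w) \<le> B * cmod (z - w)"
  by (rule field_differentiable_bound[OF convex_strip[of R]])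
     (use holomorphic_derivI[OF assms(1) open_strip] assms in \<open>auto intro: has_field_derivative_at_within\<close>)

lemma f_lipschitz_x:
  "\<beta> \<in> A \<Longrightarrow> z \<in> strip R \<Longrightarrow> w \<in> strip R \<Longrightarrow> cmod (f \<beta> z - f \<beta> w) \<le> M * cmod (z - w)"
  and fa_lipschitz_x:
  "\<beta> \<in> A \<Longrightarrow> z \<in> strip R \<Longrightarrow> w \<in> strip R \<Longrightarrow> cmod (fa \<beta> z - fa \<beta> w) \<le> M * cmod (z - w)"
  by (rule strip_bound_diff[OF f_hol f_x_bound] strip_bound_diff[OF fa_hol f_xa_bound]; assumption)+

text \<open>Mean value inequality in the parameter. As \<open>A\<close> is an arbitrary open set,
  the segment between the two parameters has to be placed in \<open>A\<close> by assumption.\<close>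

lemma segment_bound:
  fixes g :: "real \<Rightarrow> complex"
  assumes "\<And>b. b \<in> A \<Longrightarrow> (g has_vector_derivative g' b) (at b)" "closed_segment \<beta> \<beta>' \<subseteq> A"
    "\<And>b. b \<in> A \<Longrightarrow> cmod (g' b) \<le> B"
  shows "cmod (g \<beta>' - g \<beta>) \<le> B * \<bar>\<beta>' - \<beta>\<bar>"
proof -
  have "norm (g \<beta>' - g \<beta>) \<le> B * norm (\<beta>' - \<beta>)"
  proof (rule differentiable_bound[of "closed_segment \<beta> \<beta>'" g "\<lambda>b x. x *\<^sub>R g' b"])
    show "(g has_derivative (\<lambda>x. x *\<^sub>R g' b)) (at b within closed_segment \<beta> \<beta>')" if "b \<in> closed_segment \<beta> \<beta>'" for b
      using assms(1)[of b] assms(2) that by (auto simp: has_vector_derivative_def intro: has_derivative_at_withinI)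
    show "onorm (\<lambda>x. x *\<^sub>R g' b) \<le> B" if "b \<in> closed_segment \<beta> \<beta>'" for b
    proof -
      have "onorm (\<lambda>x::real. x *\<^sub>R g' b) \<le> norm (g' b)"
        by (rule onorm_le) (simp add: mult.commute)
      also have "\<dots> \<le> B" using assms(2,3) that by blast
      finally show ?thesis .
    qed
  qed auto
  then show ?thesis by simp
qed

lemma
  assumes "closed_segment \<beta> \<beta>' \<subseteq> A" "z \<in> strip R"
  shows f_lipschitz_a: "cmod (f \<beta>' z - f \<beta> z) \<le> M * \<bar>\<beta>' - \<beta>\<bar>"
    and fa_lipschitz_a: "cmod (fa \<beta>' z - fa \<beta> z) \<le> M * \<bar>\<beta>' - \<beta>\<bar>"
  by (rule segment_bound[OF f_vec[OF _ strip_closed_strip[OF assms(2)]] assms(1) f_a_bound[OF _ assms(2)]]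
       segment_bound[OF fa_vec[OF _ strip_closed_strip[OF assms(2)]] assms(1) f_aa_bound[OF _ assms(2)]]; assumption)+

text \<open>Three pieces are added: the mixed second difference, the remainder in the space variable
  at fixed parameter, and the remainder in the parameter at fixed \<open>z\<close>. With a = |w - z|
  and b = |\<beta>' - \<beta>| they give M (a b + a^2 + b^2), which is at most M (a + b)^2.\<close>

lemma f_taylor:
  assumes seg: "closed_segment \<beta> \<beta>' \<subseteq> A" and z: "z \<in> strip R" and w: "w \<in> strip R"
  shows "cmod (f \<beta>' w - f \<beta> z - deriv (f \<beta>) z * (w - z) - fa \<beta> z * of_real (\<beta>' - \<beta>))
    \<le> M * (cmod (w - z) + \<bar>\<beta>' - \<beta>\<bar>)\<^sup>2"
proof -
  have \<beta>: "\<beta> \<in> A" using seg by auto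
  have M: "M \<ge> 0" using f_x_bound[OF \<beta> z] norm_ge_zero order_trans by blast
  \<comment> \<open>The map taking \<open>b\<close> to \<open>f b w - f b z\<close> has derivative
    \<open>fa b w - fa b z\<close>, which the bound on the mixed derivative makes small.\<close>
  have 1: "cmod ((f \<beta>' w - f \<beta>' z) - (f \<beta> w - f \<beta> z)) \<le> M * cmod (w - z) * \<bar>\<beta>' - \<beta>\<bar>"
  proof (rule segment_bound[OF _ seg])
    show "((\<lambda>b. f b w - f b z) has_vector_derivative fa b w - fa b z) (at b)" if "b \<in> A" for b
      using that z w strip_closed_strip by (intro has_vector_derivative_diff f_vec)
    show "cmod (fa b w - fa b z) \<le> M * cmod (w - z)" if "b \<in> A" for b
      using fa_lipschitz_x[OF that w z] .
  qed
  have 2: "cmod (f \<beta> w - f \<beta> z - deriv (f \<beta>) z * (w - z)) \<le> M * (cmod (w - z))\<^sup>2"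
  proof -
    define F where "F i = (deriv ^^ i) (f \<beta>)" for i :: nat
    have "cmod (F 0 w - (\<Sum>i\<le>1. F i z * (w - z) ^ i / fact i)) \<le> M * cmod (w - z) ^ Suc 1 / fact 1"
    proof (rule complex_Taylor[OF convex_strip[of R]])
      show "(F i has_field_derivative F (Suc i) x) (at x within strip R)" if "x \<in> strip R" "i \<le> 1" for i x
        using holomorphic_derivI[OF holomorphic_higher_deriv[OF f_hol[OF \<beta>] open_strip, of i] open_strip that(1)]
        unfolding F_def funpow.simps o_def by (rule has_field_derivative_at_within)
      show "cmod (F (Suc 1) x) \<le> M" if "x \<in> strip R" for x
        using f_xx_bound[OF \<beta> that] by (simp add: F_def)
    qed (use z w in auto)
    then show ?thesis by (simp add: F_def numeral_2_eq_2 diff_diff_eq)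
  qed
  have 3: "cmod (f \<beta>' z - f \<beta> z - fa \<beta> z * of_real (\<beta>' - \<beta>)) \<le> M * \<bar>\<beta>' - \<beta>\<bar>\<^sup>2"
  proof -
    have "norm (f \<beta>' z - f \<beta> z - (\<beta>' - \<beta>) *\<^sub>R fa \<beta> z) \<le> norm (\<beta>' - \<beta>) * (M * \<bar>\<beta>' - \<beta>\<bar>)"
    proof (rule vector_differentiable_bound_linearization[of "closed_segment \<beta> \<beta>'" _ "\<lambda>b. fa b z"])
      show "((\<lambda>b. f b z) has_vector_derivative fa x z) (at x within closed_segment \<beta> \<beta>')"
        if "x \<in> closed_segment \<beta> \<beta>'" for x
        using seg that by (intro has_vector_derivative_at_within[OF f_vec[OF _ strip_closed_strip[OF z]]]) blast
      show "norm (fa x z - fa \<beta> z) \<le> M * \<bar>\<beta>' - \<beta>\<bar>" if x: "x \<in> closed_segment \<beta> \<beta>'" for x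
      proof -
        have "closed_segment \<beta> x \<subseteq> closed_segment \<beta> \<beta>'" using x by (simp add: subset_closed_segment)
        then have "norm (fa x z - fa \<beta> z) \<le> M * \<bar>x - \<beta>\<bar>" using fa_lipschitz_a seg z by blast
        also have "\<dots> \<le> M * \<bar>\<beta>' - \<beta>\<bar>"
          using x M by (intro mult_left_mono) (auto simp: closed_segment_eq_real_ivl split: if_splits)
        finally show ?thesis .
      qed
    qed auto
    then show ?thesis by (simp add: scaleR_conv_of_real mult.commute power2_eq_square mult.left_commute)
  qed
  have "cmod (f \<beta>' w - f \<beta> z - deriv (f \<beta>) z * (w - z) - fa \<beta> z * of_real (\<beta>' - \<beta>))
      \<le> M * cmod (w - z) * \<bar>\<beta>' - \<beta>\<bar> + M * (cmod (w - z))\<^sup>2 + M * \<bar>\<beta>' - \<beta>\<bar>\<^sup>2"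
  proof -
    have e: "f \<beta>' w - f \<beta> z - deriv (f \<beta>) z * (w - z) - fa \<beta> z * of_real (\<beta>' - \<beta>)
      = ((f \<beta>' w - f \<beta>' z) - (f \<beta> w - f \<beta> z)) + (f \<beta> w - f \<beta> z - deriv (f \<beta>) z * (w - z))
        + (f \<beta>' z - f \<beta> z - fa \<beta> z * of_real (\<beta>' - \<beta>))" by (simp add: algebra_simps)
    show ?thesis unfolding e by (intro norm_triangle_mono 1 2 3)
  qed
  also have "\<dots> \<le> M * (cmod (w - z) + \<bar>\<beta>' - \<beta>\<bar>)\<^sup>2"
    using M by (simp add: power2_sum distrib_left)
  finally show ?thesis .
qed

end

section \<open>The quasi-Newton step\<close>

lemma average_real:
  assumes "real_on_reals \<eta>"
  shows "average \<eta> \<in> \<real>"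
proof -
  have "average (\<lambda>z. cnj (\<eta> z)) = average \<eta>"
    by (rule average_cong) (use assms in \<open>auto simp: real_on_reals_def Reals_cnj_iff\<close>)
  then show ?thesis by (simp add: average_cnj Reals_cnj_iff)
qed

lemma average_bound_strip:
  assumes "strip_per r \<eta>" "r > 0" "\<And>z. z \<in> strip r \<Longrightarrow> cmod (\<eta> z) \<le> B"
  shows "cmod (average \<eta>) \<le> B"
  using average_bound[OF continuous_on_reals[OF strip_perD(5)[OF assms(1)] assms(2)]] assms(2,3) by simp

lemma real_on_reals_add: "real_on_reals f \<Longrightarrow> real_on_reals g \<Longrightarrow> real_on_reals (\<lambda>z. f z + g z)"
  and real_on_reals_diff: "real_on_reals f \<Longrightarrow> real_on_reals g \<Longrightarrow> real_on_reals (\<lambda>z. f z - g z)"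
  and real_on_reals_mult: "real_on_reals f \<Longrightarrow> real_on_reals g \<Longrightarrow> real_on_reals (\<lambda>z. f z * g z)"
  and real_on_reals_divide: "real_on_reals f \<Longrightarrow> real_on_reals g \<Longrightarrow> real_on_reals (\<lambda>z. f z / g z)"
  and real_on_reals_minus: "real_on_reals f \<Longrightarrow> real_on_reals (\<lambda>z. - f z)"
  and real_on_reals_const: "c \<in> \<real> \<Longrightarrow> real_on_reals (\<lambda>z. c)"
  by (simp_all add: real_on_reals_def)

lemma real_on_reals_comp: "real_on_reals f \<Longrightarrow> real_on_reals g \<Longrightarrow> real_on_reals (\<lambda>z. f (g z))"
  unfolding real_on_reals_def by (metis Reals_cases)

lemma real_on_reals_shift: "real_on_reals f \<Longrightarrow> real_on_reals (\<lambda>z. f (z + of_real t))"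
  unfolding real_on_reals_def by (metis of_real_add)

text \<open>The part of membership in \<open>circle_maps\<close> that is carried through the
  iteration on open strips. Continuity on a closed strip and the homeomorphism property come back in
  \<open>in_circle_maps\<close>.\<close>

locale circle_lift =
  fixes r :: real and h :: "complex \<Rightarrow> complex"
  assumes r_pos: "r > 0" and per: "strip_per r (\<lambda>z. h z - z)" and real: "real_on_reals h"
begin

lemma hol: "h holomorphic_on strip r"
  using holomorphic_on_add[OF strip_perD(1)[OF per] holomorphic_on_ident] by simp

lemma h_add_1: "z \<in> strip r \<Longrightarrow> h (z + 1) = h z + 1"
  using strip_perD(2)[OF per, of z] by (simp add: algebra_simps)

lemma h_deriv: "z \<in> strip r \<Longrightarrow> (h has_field_derivative deriv h z) (at z)"
  by (rule holomorphic_derivI[OF hol open_strip])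

lemma deriv_per: "strip_per r (deriv h)"
  unfolding strip_per_def using deriv_periodic[OF h_add_1 hol] holomorphic_deriv[OF hol open_strip] by blast

lemma deriv_real: "real_on_reals (deriv h)"
  by (rule real_on_reals_deriv[OF hol real r_pos])

text \<open>A lift grows by 1 over a period. Consequently subtracting a constant from
  \<open>\<xi>\<close> lowers the average of \<open>h' \<xi>\<close> by exactly that constant, which
  is how the correction is given zero average.\<close>

lemma average_deriv: "average (deriv h) = 1"
proof -
  have 0: "0 \<in> strip r" using r_pos by (simp add: strip_def)
  have "average (\<lambda>t. deriv h (t + 0)) = h (1 + 0) - h 0"
    by (rule average_primitive[OF h_deriv 0])
  then show ?thesis using h_add_1[OF 0] by simp
qed

end

locale family_conj = C2_bounded_family A f R M + circle_lift r h
  for A f R M r h +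
  fixes \<alpha> \<theta> :: real
  assumes \<alpha>: "\<alpha> \<in> A" and h_strip: "\<And>z. z \<in> strip r \<Longrightarrow> h z \<in> strip R"
begin

lemma comp_per:
  assumes "g holomorphic_on strip R" "\<And>z. z \<in> strip R \<Longrightarrow> g (z + 1) = g z + c"
  shows "(\<lambda>z. g (h z)) holomorphic_on strip r" "z \<in> strip r \<Longrightarrow> g (h (z + 1)) = g (h z) + c"
  using holomorphic_on_compose_gen[OF hol assms(1)] h_strip assms(2)[of "h z"] h_add_1[of z]
  by (auto simp: o_def)

lemma f_h: "(\<lambda>z. f \<alpha> (h z)) holomorphic_on strip r" "z \<in> strip r \<Longrightarrow> f \<alpha> (h (z + 1)) = f \<alpha> (h z) + 1"
  by (rule comp_per[OF f_hol[OF \<alpha>] f_per'[OF \<alpha> strip_closed_strip]]; assumption)+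

lemma h_shift: "(\<lambda>z. h (z + of_real \<theta>)) holomorphic_on strip r"
  by (rule holomorphic_on_compose_gen[OF _ hol, of "\<lambda>z. z + of_real \<theta>", unfolded o_def])
     (auto intro!: holomorphic_intros)

lemma conj_error_per: "strip_per r (conj_error f \<theta> h \<alpha>)"
proof -
  have "conj_error f \<theta> h \<alpha> (z + 1) = conj_error f \<theta> h \<alpha> z" if "z \<in> strip r" for z
    using f_h(2)[OF that] h_add_1[of "z + of_real \<theta>"] that by (simp add: conj_error_def algebra_simps)
  then show ?thesis
    unfolding strip_per_def using holomorphic_on_diff[OF f_h(1) h_shift] by (simp add: conj_error_def[abs_def])
qed

lemma conj_error_real: "real_on_reals (conj_error f \<theta> h \<alpha>)"
  unfolding conj_error_def
  by (intro real_on_reals_diff real_on_reals_comp[OF f_real[OF \<alpha>] real] real_on_reals_shift[OF real])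

lemma conj_error_deriv:
  assumes z: "z \<in> strip r"
  shows "deriv (conj_error f \<theta> h \<alpha>) z = deriv (f \<alpha>) (h z) * deriv h z - deriv h (z + of_real \<theta>)"
proof (rule DERIV_imp_deriv)
  have "((\<lambda>z. f \<alpha> (h z)) has_field_derivative deriv (f \<alpha>) (h z) * deriv h z) (at z)"
    by (rule DERIV_chain2[OF holomorphic_derivI[OF f_hol[OF \<alpha>] open_strip h_strip[OF z]] h_deriv[OF z]])
  moreover have "((\<lambda>z. h (z + of_real \<theta>)) has_field_derivative deriv h (z + of_real \<theta>)) (at z)"
    using h_deriv[of "z + of_real \<theta>"] z unfolding DERIV_shift by simp
  ultimately show "(conj_error f \<theta> h \<alpha> has_field_derivative
      deriv (f \<alpha>) (h z) * deriv h z - deriv h (z + of_real \<theta>)) (at z)"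
    unfolding conj_error_def[abs_def] by (rule DERIV_diff)
qed

lemma fa_h_per: "strip_per r (\<lambda>z. fa \<alpha> (h z))"
  using comp_per[OF fa_hol[OF \<alpha>], of 0] strip_perD(2)[OF fa_per[OF \<alpha>]] by (simp add: strip_per_def)

lemma fa_h_real: "real_on_reals (\<lambda>z. fa \<alpha> (h z))"
  by (rule real_on_reals_comp[OF fa_real[OF \<alpha>] real])

end

text \<open>Let m be \<open>coh_order \<tau>\<close>. Per unit of error, V = W / \<delta>^(m + 1)
  bounds the correction, its derivative and the parameter shift. In the coefficient of the squared
  error, the linear remainder contributes V and the Taylor remainder M (2 V)^2. As \<delta> \<le> 1,
  the constant defined here, divided by \<delta>^(2 m + 2), dominates V + 4 M V^2. Inside
  \<open>W\<close>, the factor \<open>L2 * (1 + M * L2 * Lb)\<close> bounds the right-hand side of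
  the cohomological equation, the powers of 2 come from working with \<delta> / 2, and
  \<open>Lb * L2\<close> bounds the parameter shift.\<close>

definition step_const :: "real \<Rightarrow> real \<Rightarrow> real \<Rightarrow> real \<Rightarrow> real \<Rightarrow> real \<Rightarrow> real" where
  "step_const \<gamma> \<tau> M L1 L2 Lb = (let W = 2 * (1 + L1)\<^sup>2 * (coh_const \<gamma> \<tau> * 2 ^ coh_order \<tau> * (L2 * (1 + M * L2 * Lb))) + Lb * L2
     in W + 4 * M * W\<^sup>2)"

text \<open>Differentiating \<open>e = f \<circ> h - h(\<cdot> + \<theta>)\<close> gives \<open>f'(h) h' = h'(\<cdot> + \<theta>) + e'\<close>. With the ansatz \<open>\<Delta> = h' \<xi>\<close>, the
  linearized equation therefore becomes \<open>\<xi> - \<xi>(\<cdot> + \<theta>) = - (e + a \<partial>\<^sub>\<alpha>f(h)) / h'(\<cdot> + \<theta>)\<close> up to the quadratically small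
  term \<open>e' \<xi>\<close>. The number \<open>a\<close> makes the right-hand side have zero average, and the free additive constant of \<open>\<xi>\<close>
  preserves the normalization of \<open>h\<close>.\<close>

lemma (in family_conj) newton_step:
  assumes \<theta>: "\<theta> \<in> diophantine \<gamma> \<tau>" and \<gamma>: "\<gamma> > 0" and d: "d > 0"
    and h_im: "\<And>z. z \<in> strip r \<Longrightarrow> \<bar>Im (h z)\<bar> \<le> R - d"
    and L1: "\<And>z. z \<in> strip r \<Longrightarrow> cmod (deriv h z) \<le> L1"
    and nz: "\<And>z. z \<in> strip r \<Longrightarrow> deriv h z \<noteq> 0"
    and L2: "\<And>z. z \<in> strip r \<Longrightarrow> cmod (1 / deriv h z) \<le> L2"
    and Lb: "average (twist_fun f \<theta> h \<alpha>) \<noteq> 0" "cmod (1 / average (twist_fun f \<theta> h \<alpha>)) \<le> Lb"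
    and e: "\<And>z. z \<in> strip r \<Longrightarrow> cmod (conj_error f \<theta> h \<alpha> z) \<le> \<epsilon>"
    and \<delta>: "0 < \<delta>" "\<delta> \<le> 1" "\<delta> < r"
    and K: "K = step_const \<gamma> \<tau> M L1 L2 Lb / \<delta> ^ (2 * coh_order \<tau> + 2)"
  shows "\<exists>\<Delta> a. strip_per (r - \<delta>) \<Delta> \<and> real_on_reals \<Delta> \<and> average \<Delta> = 0 \<and> \<bar>a\<bar> \<le> K * \<epsilon> \<and>
    (\<forall>z\<in>strip (r - \<delta>). cmod (\<Delta> z) \<le> K * \<epsilon> \<and> cmod (deriv \<Delta> z) \<le> K * \<epsilon>) \<and>
    (K * \<epsilon> \<le> d / 2 \<longrightarrow> closed_segment \<alpha> (\<alpha> + a) \<subseteq> A \<longrightarrow>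
      (\<forall>z\<in>strip (r - \<delta>). cmod (conj_error f \<theta> (\<lambda>z. h z + \<Delta> z) (\<alpha> + a) z) \<le> K * \<epsilon>\<^sup>2))"
proof -
  define m where "m = coh_order \<tau>"
  \<comment> \<open>Half of the width is spent on the cohomological equation, the other half on the
    Cauchy estimate for \<open>deriv \<Delta>\<close>.\<close>
  define \<omega> where "\<omega> = \<delta> / 2"
  define b where "b = twist_fun f \<theta> h \<alpha>"
  define err where "err = conj_error f \<theta> h \<alpha>"
  define e\<theta> where "e\<theta> z = err z / deriv h (z + of_real \<theta>)" for z
  \<comment> \<open>Real parts are taken only to obtain a real number: both averages are real, so
    this is \<open>- average e\<theta> / average b\<close>, the value that gives
    \<open>\<eta>\<close> average 0.\<close>
  define a where "a = - Re (average e\<theta>) / Re (average b)"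
  define \<eta> where "\<eta> z = - e\<theta> z - of_real a * b z" for z
  define E1 where "E1 = L2 * (1 + M * L2 * Lb)"
  define U where "U = coh_const \<gamma> \<tau> / \<omega> ^ m * (E1 * \<epsilon>)"
  have \<omega>: "0 < \<omega>" "\<omega> < r" "r - \<omega> > 0" "r - \<delta> = (r - \<omega>) - \<omega>" "r - \<delta> > 0" using \<delta> by (auto simp: \<omega>_def)
  have z0: "0 \<in> strip r" using r_pos by (simp add: strip_def)
  have nonneg: "\<epsilon> \<ge> 0" "L1 \<ge> 0" "L2 \<ge> 0" "M \<ge> 0" "Lb \<ge> 0"
    using order_trans[OF norm_ge_zero e[OF z0]] order_trans[OF norm_ge_zero L1[OF z0]]
      order_trans[OF norm_ge_zero L2[OF z0]] order_trans[OF norm_ge_zero f_x_bound[OF \<alpha> h_strip[OF z0]]]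
      order_trans[OF norm_ge_zero Lb(2)] by auto
  have shift_per: "strip_per r (\<lambda>z. deriv h (z + of_real \<theta>))" by (rule strip_per_shift[OF deriv_per])
  have shift_nz: "deriv h (z + of_real \<theta>) \<noteq> 0" if "z \<in> strip r" for z using nz that by simp
  have shift_L2: "cmod (1 / deriv h (z + of_real \<theta>)) \<le> L2" if "z \<in> strip r" for z using L2 that by simp
  have b_per: "strip_per r b"
    unfolding b_def twist_fun_def by (intro strip_per_divide fa_h_per shift_per shift_nz)
  have b_real: "real_on_reals b"
    unfolding b_def twist_fun_def by (intro real_on_reals_divide fa_h_real real_on_reals_shift deriv_real)
  have e\<theta>_per: "strip_per r e\<theta>"
    unfolding e\<theta>_def err_def by (intro strip_per_divide conj_error_per shift_per shift_nz)
  have e\<theta>_real: "real_on_reals e\<theta>"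
    unfolding e\<theta>_def err_def by (intro real_on_reals_divide conj_error_real real_on_reals_shift deriv_real)
  have e\<theta>_bound: "cmod (e\<theta> z) \<le> \<epsilon> * L2" if z: "z \<in> strip r" for z
  proof -
    have "cmod (e\<theta> z) = cmod (err z) * cmod (1 / deriv h (z + of_real \<theta>))"
      by (simp add: e\<theta>_def norm_divide)
    also have "\<dots> \<le> \<epsilon> * L2" using e[OF z] shift_L2[OF z] nonneg by (intro mult_mono) (auto simp: err_def)
    finally show ?thesis .
  qed
  have b_bound: "cmod (b z) \<le> M * L2" if z: "z \<in> strip r" for z
  proof -
    have "cmod (b z) = cmod (fa \<alpha> (h z)) * cmod (1 / deriv h (z + of_real \<theta>))"
      by (simp add: b_def twist_fun_def norm_divide)
    also have "\<dots> \<le> M * L2"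
      using f_a_bound[OF \<alpha> h_strip[OF z]] shift_L2[OF z] nonneg by (intro mult_mono) auto
    finally show ?thesis .
  qed
  have a_eq: "of_real a = - average e\<theta> / average b"
    using average_real[OF e\<theta>_real] average_real[OF b_real] by (auto simp: a_def elim!: Reals_cases)
  have a_bound: "\<bar>a\<bar> \<le> Lb * L2 * \<epsilon>"
  proof -
    have "\<bar>a\<bar> = cmod (average e\<theta>) * cmod (1 / average b)"
      using arg_cong[OF a_eq, of cmod] by (simp add: norm_divide)
    also have "\<dots> \<le> (\<epsilon> * L2) * Lb"
      using average_bound_strip[OF e\<theta>_per r_pos e\<theta>_bound] Lb(2) nonneg by (intro mult_mono) (auto simp: b_def)
    finally show ?thesis by (simp add: mult_ac)
  qed
  have \<eta>_per: "strip_per r \<eta>"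
    unfolding \<eta>_def by (intro strip_per_diff strip_per_minus strip_per_mult strip_per_const e\<theta>_per b_per)
  have \<eta>_real: "real_on_reals \<eta>"
    unfolding \<eta>_def
    by (intro real_on_reals_diff real_on_reals_minus real_on_reals_mult real_on_reals_const e\<theta>_real b_real Reals_of_real)
  have \<eta>_avg: "average \<eta> = 0"
  proof -
    have "average \<eta> = average (\<lambda>z. - e\<theta> z) - average (\<lambda>z. of_real a * b z)"
      unfolding \<eta>_def by (intro average_diff[where r = r] strip_per_minus strip_per_mult strip_per_const e\<theta>_per b_per r_pos)
    also have "average (\<lambda>z. - e\<theta> z) = - average e\<theta>" using average_cmult[of "- 1" e\<theta>] by simp
    also have "average (\<lambda>z. of_real a * b z) = of_real a * average b" by (rule average_cmult)
    finally show ?thesis using Lb(1) by (simp add: a_eq b_def)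
  qed
  have \<eta>_bound: "cmod (\<eta> z) \<le> E1 * \<epsilon>" if z: "z \<in> strip r" for z
  proof -
    have "cmod (\<eta> z) \<le> cmod (e\<theta> z) + \<bar>a\<bar> * cmod (b z)"
      unfolding \<eta>_def using norm_triangle_ineq4[of "- e\<theta> z" "of_real a * b z"] by (simp add: norm_mult)
    also have "\<dots> \<le> \<epsilon> * L2 + (Lb * L2 * \<epsilon>) * (M * L2)"
      using e\<theta>_bound[OF z] b_bound[OF z] a_bound nonneg by (intro add_mono mult_mono) auto
    also have "\<dots> = E1 * \<epsilon>" by (simp add: E1_def algebra_simps)
    finally show ?thesis .
  qed
  obtain u where u: "strip_per (r - \<omega>) u" "real_on_reals u"
    and u_eq: "\<And>z. z \<in> strip (r - \<omega>) \<Longrightarrow> u z - u (z + of_real \<theta>) = \<eta> z"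
    and u_bound: "\<And>z. z \<in> strip (r - \<omega>) \<Longrightarrow> cmod (u z) \<le> U"
    using cohomological_equation[OF \<theta> \<gamma> \<eta>_per \<eta>_real \<eta>_avg \<eta>_bound \<omega>(1,2)] unfolding U_def m_def by blast
  have U0: "U \<ge> 0" using u_bound[of 0] \<omega>(3) by (auto simp: strip_def intro: order_trans[OF norm_ge_zero])
  have sub: "z \<in> strip r" if "z \<in> strip (r - \<omega>)" for z using that \<omega>(1) by (simp add: strip_def)
  have dh_per: "strip_per (r - \<omega>) (deriv h)" using strip_per_mono[OF deriv_per] \<omega>(1) by simp
  define \<kappa> where "\<kappa> = average (\<lambda>z. deriv h z * u z)"
  have \<kappa>_real: "\<kappa> \<in> \<real>" unfolding \<kappa>_def by (intro average_real real_on_reals_mult deriv_real u)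
  have \<kappa>_bound: "cmod \<kappa> \<le> L1 * U"
    unfolding \<kappa>_def
    by (rule average_bound_strip[OF strip_per_mult[OF dh_per u(1)] \<omega>(3)])
       (use L1[OF sub] u_bound nonneg U0 in \<open>simp add: norm_mult mult_mono\<close>)
  define \<xi> where "\<xi> z = u z - \<kappa>" for z
  define \<Delta> where "\<Delta> z = deriv h z * \<xi> z" for z
  have \<xi>_bound: "cmod (\<xi> z) \<le> (1 + L1) * U" if "z \<in> strip (r - \<omega>)" for z
    using norm_triangle_ineq4[of "u z" \<kappa>] u_bound[OF that] \<kappa>_bound by (simp add: \<xi>_def algebra_simps)
  have \<Delta>_per: "strip_per (r - \<omega>) \<Delta>"
    unfolding \<Delta>_def \<xi>_def by (intro strip_per_mult strip_per_diff strip_per_const dh_per u)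
  have \<Delta>_real: "real_on_reals \<Delta>"
    unfolding \<Delta>_def \<xi>_def by (intro real_on_reals_mult real_on_reals_diff real_on_reals_const deriv_real u \<kappa>_real)
  have \<Delta>_avg: "average \<Delta> = 0"
  proof -
    have "average \<Delta> = average (\<lambda>z. deriv h z * u z) - average (\<lambda>z. \<kappa> * deriv h z)"
      unfolding \<Delta>_def \<xi>_def right_diff_distrib
      by (subst average_diff[symmetric, where r = "r - \<omega>"])
         (auto intro!: strip_per_mult strip_per_const dh_per u \<omega>(2,3) simp: mult.commute)
    then show ?thesis by (simp add: average_cmult average_deriv \<kappa>_def)
  qed
  have \<Delta>_bound: "cmod (\<Delta> z) \<le> (1 + L1)\<^sup>2 * U" if "z \<in> strip (r - \<omega>)" for z
  proof -
    have "cmod (\<Delta> z) \<le> (1 + L1) * ((1 + L1) * U)"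
      unfolding \<Delta>_def norm_mult using L1[OF sub[OF that]] \<xi>_bound[OF that] nonneg U0 by (intro mult_mono) auto
    then show ?thesis by (simp add: power2_eq_square)
  qed
  define W where "W = 2 * (1 + L1)\<^sup>2 * (coh_const \<gamma> \<tau> * 2 ^ m * E1) + Lb * L2"
  define V where "V = W / \<delta> ^ (m + 1)"
  have C0: "coh_const \<gamma> \<tau> \<ge> 0" using \<gamma> by (simp add: coh_const_def)
  have E10: "E1 \<ge> 0" using nonneg by (simp add: E1_def)
  have W0: "W \<ge> 0" "V \<ge> 0" using nonneg C0 E10 \<delta>(1) by (auto simp: W_def V_def)
  have \<delta>m: "\<delta> ^ (m + 1) \<le> 1" using \<delta> by (intro power_le_one) auto
  have U_eq: "U / \<omega> * \<delta> ^ (m + 1) = 2 * (coh_const \<gamma> \<tau> * 2 ^ m * E1) * \<epsilon>"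
    using \<delta>(1) by (simp add: U_def \<omega>_def field_simps)
  have V1: "(1 + L1)\<^sup>2 * U / \<omega> \<le> V * \<epsilon>"
  proof -
    have "(1 + L1)\<^sup>2 * (U / \<omega> * \<delta> ^ (m + 1)) \<le> W * \<epsilon>"
      unfolding U_eq W_def using nonneg by (simp add: algebra_simps)
    then show ?thesis using \<delta>(1) by (simp add: V_def field_simps)
  qed
  have V2: "(1 + L1)\<^sup>2 * U \<le> V * \<epsilon>"
  proof -
    have "(1 + L1)\<^sup>2 * U * 1 \<le> (1 + L1)\<^sup>2 * U * (1 / \<omega>)"
      using U0 nonneg \<omega>(1) \<delta> by (intro mult_left_mono) (auto simp: \<omega>_def field_simps)
    then show ?thesis using V1 by simp
  qed
  have V3: "(1 + L1) * U / \<omega> \<le> V * \<epsilon>"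
  proof -
    have "(1 + L1) * (U / \<omega>) \<le> (1 + L1)\<^sup>2 * (U / \<omega>)"
      using U0 nonneg \<omega>(1) by (intro mult_right_mono) (auto simp: power2_eq_square)
    then show ?thesis using V1 by simp
  qed
  have V4: "\<bar>a\<bar> \<le> V * \<epsilon>"
  proof -
    have "Lb * L2 \<le> W" using nonneg C0 E10 by (simp add: W_def)
    also have "W * 1 \<le> W * (1 / \<delta> ^ (m + 1))"
      using W0 \<delta>m \<delta>(1) by (intro mult_left_mono) (auto simp: field_simps)
    finally have "Lb * L2 * \<epsilon> \<le> V * \<epsilon>" using nonneg by (intro mult_right_mono) (auto simp: V_def)
    then show ?thesis using a_bound by linarith
  qed
  \<comment> \<open>Since \<open>\<delta> \<le> 1\<close> the factor \<open>q\<close> is at least 1,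
    so the lower power of \<open>1 / \<delta>\<close> may be replaced by the higher one.\<close>
  have KV: "V + 4 * M * V\<^sup>2 \<le> K"
  proof -
    define q where "q = 1 / \<delta> ^ (m + 1)"
    have q: "q \<ge> 1" using \<delta>m \<delta>(1) by (simp add: q_def field_simps)
    have "q * 1 \<le> q * q" using q by (intro mult_left_mono) auto
    then have "V + 4 * M * V\<^sup>2 \<le> W * (q * q) + 4 * M * (W\<^sup>2 * (q * q))"
    proof -
      have V: "V = W * q" by (simp add: V_def q_def)
      have "W * q \<le> W * (q * q)" using \<open>q * 1 \<le> q * q\<close> W0 by (intro mult_left_mono) auto
      then show ?thesis by (simp add: V power2_eq_square mult_ac)
    qed
    also have "\<dots> = (W + 4 * M * W\<^sup>2) * (q * q)" by (simp add: algebra_simps)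
    also have "q * q = 1 / \<delta> ^ (2 * m + 2)" by (simp add: q_def power_add[symmetric] mult_2)
    finally show ?thesis unfolding K step_const_def Let_def W_def E1_def m_def by simp
  qed
  have MV: "4 * M * V\<^sup>2 \<ge> 0" using nonneg by simp
  have VK: "V * \<epsilon> \<le> K * \<epsilon>" using KV MV nonneg by (intro mult_right_mono) linarith+
  have sub': "z \<in> strip (r - \<omega>)" if "z \<in> strip (r - \<delta>)" for z using that \<delta> by (simp add: strip_def \<omega>_def)
  have b1: "cmod (\<Delta> z) \<le> V * \<epsilon>" if "z \<in> strip (r - \<delta>)" for z
    using \<Delta>_bound[OF sub'[OF that]] V2 by linarith
  have b2: "cmod (deriv \<Delta> z) \<le> V * \<epsilon>" if "z \<in> strip (r - \<delta>)" for z
    using Cauchy_deriv_bound[OF strip_perD(1)[OF \<Delta>_per] \<Delta>_bound \<omega>(1), of z] that V1 \<omega>(4) by simp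
  have b3: "cmod (conj_error f \<theta> (\<lambda>z. h z + \<Delta> z) (\<alpha> + a) z) \<le> K * \<epsilon>\<^sup>2"
    if small: "K * \<epsilon> \<le> d / 2" and seg: "closed_segment \<alpha> (\<alpha> + a) \<subseteq> A" and z: "z \<in> strip (r - \<delta>)" for z
  proof -
    have z1: "z \<in> strip (r - \<omega>)" and z2: "z \<in> strip r" using sub'[OF z] sub[OF sub'[OF z]] by auto
    \<comment> \<open>The point \<open>h z\<close> keeps distance \<open>d\<close> from the boundary
      and \<open>\<Delta> z\<close> has modulus at most \<open>d / 2\<close>, so the family may be
      evaluated at the corrected point.\<close>
    have w: "h z + \<Delta> z \<in> strip R"
      using h_im[OF z2] b1[OF z] VK small abs_Im_le_cmod[of "\<Delta> z"] d
      by (simp add: strip_def)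
    define Rem where "Rem = f (\<alpha> + a) (h z + \<Delta> z) - f \<alpha> (h z) - deriv (f \<alpha>) (h z) * \<Delta> z - fa \<alpha> (h z) * of_real a"
    have Rem: "cmod Rem \<le> 4 * M * V\<^sup>2 * \<epsilon>\<^sup>2"
    proof -
      have "cmod Rem \<le> M * (cmod (\<Delta> z) + \<bar>a\<bar>)\<^sup>2"
        using f_taylor[OF seg h_strip[OF z2] w] by (simp add: Rem_def)
      also have "\<dots> \<le> M * (V * \<epsilon> + V * \<epsilon>)\<^sup>2"
        using b1[OF z] V4 nonneg by (intro mult_left_mono power_mono add_mono) auto
      also have "\<dots> = 4 * M * V\<^sup>2 * \<epsilon>\<^sup>2" by (simp add: power2_eq_square)
      finally show ?thesis .
    qed
    have dE: "cmod (deriv err z) \<le> \<epsilon> / \<omega>"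
      unfolding err_def by (rule Cauchy_deriv_bound[OF strip_perD(1)[OF conj_error_per] e \<omega>(1) z1])
    have main: "conj_error f \<theta> (\<lambda>z. h z + \<Delta> z) (\<alpha> + a) z = deriv err z * \<xi> z + Rem"
    proof -
      have \<eta>z: "deriv h (z + of_real \<theta>) * \<eta> z = - err z - of_real a * fa \<alpha> (h z)"
        using shift_nz[OF z2] by (simp add: \<eta>_def e\<theta>_def b_def twist_fun_def right_diff_distrib)
      have "deriv (f \<alpha>) (h z) * \<Delta> z - \<Delta> (z + of_real \<theta>)
          = (deriv err z + deriv h (z + of_real \<theta>)) * \<xi> z - deriv h (z + of_real \<theta>) * \<xi> (z + of_real \<theta>)"
        using conj_error_deriv[OF z2] by (simp add: err_def \<Delta>_def algebra_simps)
      also have "\<dots> = deriv err z * \<xi> z + deriv h (z + of_real \<theta>) * (u z - u (z + of_real \<theta>))"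
        by (simp add: \<xi>_def algebra_simps)
      also have "\<dots> = deriv err z * \<xi> z - err z - of_real a * fa \<alpha> (h z)"
        unfolding u_eq[OF z1] using \<eta>z by (simp add: algebra_simps)
      finally have *: "deriv (f \<alpha>) (h z) * \<Delta> z - \<Delta> (z + of_real \<theta>)
          = deriv err z * \<xi> z - err z - of_real a * fa \<alpha> (h z)" .
      have "conj_error f \<theta> (\<lambda>z. h z + \<Delta> z) (\<alpha> + a) z
          = err z + (deriv (f \<alpha>) (h z) * \<Delta> z - \<Delta> (z + of_real \<theta>)) + of_real a * fa \<alpha> (h z) + Rem"
        by (simp add: conj_error_def err_def Rem_def algebra_simps)
      also have "\<dots> = deriv err z * \<xi> z + Rem" unfolding * by simp
      finally show ?thesis .
    qed
    have "cmod (deriv err z * \<xi> z) \<le> \<epsilon> / \<omega> * ((1 + L1) * U)"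
      unfolding norm_mult using dE \<xi>_bound[OF z1] nonneg \<omega>(1) by (intro mult_mono) auto
    also have "\<dots> = \<epsilon> * ((1 + L1) * U / \<omega>)" by simp
    also have "\<dots> \<le> \<epsilon> * (V * \<epsilon>)" using V3 nonneg by (intro mult_left_mono) auto
    finally have "cmod (deriv err z * \<xi> z) \<le> V * \<epsilon>\<^sup>2" by (simp add: power2_eq_square mult_ac)
    then have "cmod (deriv err z * \<xi> z + Rem) \<le> V * \<epsilon>\<^sup>2 + 4 * M * V\<^sup>2 * \<epsilon>\<^sup>2"
      using Rem by (intro norm_triangle_mono)
    also have "\<dots> = (V + 4 * M * V\<^sup>2) * \<epsilon>\<^sup>2" by (simp add: algebra_simps)
    also have "\<dots> \<le> K * \<epsilon>\<^sup>2" using KV by (intro mult_right_mono) auto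
    finally show ?thesis unfolding main .
  qed
  have "strip_per (r - \<delta>) \<Delta>" using strip_per_mono[OF \<Delta>_per] \<delta> by (simp add: \<omega>_def)
  moreover have "\<bar>a\<bar> \<le> K * \<epsilon>" using V4 VK by linarith
  ultimately show ?thesis
    using \<Delta>_real \<Delta>_avg b1 b2 b3 order_trans[OF _ VK] by blast
qed

section \<open>Persistence of the hypotheses near the initial pair\<close>

text \<open>Derivatives are compared too, because (H1) and (H2) involve \<open>h'\<close> and a
  bound on a function does not control its derivative on the same strip.\<close>

definition near :: "real \<Rightarrow> real \<Rightarrow> (complex \<Rightarrow> complex) \<Rightarrow> real \<Rightarrow> (complex \<Rightarrow> complex) \<Rightarrow> real \<Rightarrow> bool" where
  "near r \<mu> h0 \<alpha>0 h \<alpha> \<longleftrightarrow> \<bar>\<alpha> - \<alpha>0\<bar> \<le> \<mu> \<and>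
     (\<forall>z\<in>strip r. cmod (h z - h0 z) \<le> \<mu> \<and> cmod (deriv h z - deriv h0 z) \<le> \<mu>)"

text \<open>The fourth assumption is \<open>C \<le> 1 / S - 1 / L\<close> with the denominators
  cleared. Since \<open>x\<close> has modulus at least \<open>1 / S\<close>, a perturbation of size
  \<open>C\<close> leaves modulus at least \<open>1 / L\<close>.\<close>

lemma norm_inverse_perturb:
  fixes x y :: complex
  assumes "x \<noteq> 0" "cmod (1 / x) \<le> S" "cmod (y - x) \<le> C" "C * (S * L) \<le> L - S" "S \<le> L"
  shows "y \<noteq> 0" "cmod (1 / y) \<le> L"
proof -
  have x: "cmod x > 0" "1 / cmod x \<le> S" using assms by (auto simp: norm_divide)
  then have S: "S > 0" using order_less_le_trans[of 0 "1 / cmod x" S] by simp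
  have L: "L > 0" using S assms(5) by simp
  have "C \<le> (L - S) / (S * L)" using assms(4) S L by (simp add: field_simps)
  also have "\<dots> = 1 / S - 1 / L" using S L by (simp add: field_simps)
  finally have C: "C \<le> 1 / S - 1 / L" .
  have "1 / S \<le> cmod x" using x S by (simp add: field_simps)
  moreover have "cmod x \<le> cmod y + cmod (y - x)" by (metis norm_minus_commute norm_triangle_sub)
  ultimately have y: "1 / L \<le> cmod y" using C assms(3) by linarith
  then show "y \<noteq> 0" using L by auto
  then show "cmod (1 / y) \<le> L" using y L by (simp add: norm_divide field_simps)
qed

text \<open>\<open>S1\<close>, \<open>S2\<close>, \<open>Sb\<close> bound the sizes at the initial
  pair, and \<open>L1\<close>, \<open>L2\<close>, \<open>Lb\<close> are the larger bounds granted to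
  all iterates. Of the initial distance \<open>2 * d\<close> to the boundary, \<open>d\<close> may
  be used up. In \<open>\<mu>_b\<close> the factor multiplying \<open>\<mu>\<close> measures how
  fast the twist function can change with the pair.\<close>

locale initial_pair = C2_bounded_family A f R M + base: circle_lift \<rho> h0
  for A f R M \<rho> h0 +
  fixes \<alpha>0 \<theta> S1 S2 Sb L1 L2 Lb d \<mu> :: real
  assumes avg0: "average (\<lambda>z. h0 z - z) = 0"
    and S1: "\<And>z. z \<in> strip \<rho> \<Longrightarrow> cmod (deriv h0 z) \<le> S1"
    and nz0: "\<And>z. z \<in> strip \<rho> \<Longrightarrow> deriv h0 z \<noteq> 0"
    and S2: "\<And>z. z \<in> strip \<rho> \<Longrightarrow> cmod (1 / deriv h0 z) \<le> S2"
    and im0: "\<And>z. z \<in> strip \<rho> \<Longrightarrow> \<bar>Im (h0 z)\<bar> \<le> R - 2 * d"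
    and Sb: "average (twist_fun f \<theta> h0 \<alpha>0) \<noteq> 0" "cmod (1 / average (twist_fun f \<theta> h0 \<alpha>0)) \<le> Sb"
    and d_pos: "d > 0" and \<mu>_pos: "\<mu> > 0"
    and \<mu>_A: "cball \<alpha>0 \<mu> \<subseteq> A" and \<mu>_d: "\<mu> \<le> d" and \<mu>_1: "S1 + \<mu> \<le> L1"
    and \<mu>_2: "\<mu> * (S2 * L2) \<le> L2 - S2" "S2 \<le> L2"
    and \<mu>_b: "((2 * M * L2 + M * L2 * S2) * \<mu>) * (Sb * Lb) \<le> Lb - Sb" "Sb \<le> Lb"
begin

text \<open>Each controlled quantity moves by at most a multiple of \<open>\<mu>\<close>, and the
  conditions on \<open>\<mu>\<close> in the locale are exactly what keeps it within its relaxed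
  bound. Reciprocals go through \<open>norm_inverse_perturb\<close>.\<close>

lemma near_bounds:
  assumes lift: "circle_lift r h" and r: "r \<le> \<rho>" and near: "near r \<mu> h0 \<alpha>0 h \<alpha>"
  shows "\<alpha> \<in> A" and near_im: "z \<in> strip r \<Longrightarrow> \<bar>Im (h z)\<bar> \<le> R - d"
    and "z \<in> strip r \<Longrightarrow> cmod (deriv h z) \<le> L1"
    and "z \<in> strip r \<Longrightarrow> deriv h z \<noteq> 0" and "z \<in> strip r \<Longrightarrow> cmod (1 / deriv h z) \<le> L2"
    and "average (twist_fun f \<theta> h \<alpha>) \<noteq> 0" and "cmod (1 / average (twist_fun f \<theta> h \<alpha>)) \<le> Lb"
proof -
  interpret h: circle_lift r h by fact
  have near_a: "\<bar>\<alpha> - \<alpha>0\<bar> \<le> \<mu>" and near_h: "\<And>z. z \<in> strip r \<Longrightarrow> cmod (h z - h0 z) \<le> \<mu>"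
    and near_h': "\<And>z. z \<in> strip r \<Longrightarrow> cmod (deriv h z - deriv h0 z) \<le> \<mu>"
    using near by (auto simp: near_def)
  have sub: "z \<in> strip \<rho>" if "z \<in> strip r" for z using that r by (simp add: strip_def)
  have \<alpha>A: "\<alpha> \<in> cball \<alpha>0 \<mu>" "\<alpha>0 \<in> cball \<alpha>0 \<mu>" using near_a \<mu>_pos by (auto simp: dist_real_def abs_minus_commute)
  then show A: "\<alpha> \<in> A" using \<mu>_A by blast
  have seg: "closed_segment \<alpha>0 \<alpha> \<subseteq> A" using closed_segment_subset[OF \<alpha>A(2,1) convex_cball] \<mu>_A by blast
  show im: "\<bar>Im (h z)\<bar> \<le> R - d" if z: "z \<in> strip r" for z
    using near_h[OF z] im0[OF sub[OF z]] abs_Im_le_cmod[of "h z - h0 z"] \<mu>_d by auto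
  show "cmod (deriv h z) \<le> L1" if z: "z \<in> strip r" for z
    using near_h'[OF z] S1[OF sub[OF z]] norm_triangle_sub[of "deriv h z" "deriv h0 z"] \<mu>_1 by linarith
  show nz: "deriv h z \<noteq> 0" and L2: "cmod (1 / deriv h z) \<le> L2" if z: "z \<in> strip r" for z
    using norm_inverse_perturb[OF nz0[OF sub[OF z]] S2[OF sub[OF z]] near_h'[OF z] \<mu>_2] by auto
  have strip_h: "h z \<in> strip R" if "z \<in> strip r" for z using im[OF that] d_pos by (simp add: strip_def)
  have strip_h0: "h0 z \<in> strip R" if "z \<in> strip \<rho>" for z using im0[OF that] d_pos by (simp add: strip_def)
  interpret H: family_conj A f R M r h \<alpha> \<theta> by unfold_locales (use A strip_h in auto)
  interpret H0: family_conj A f R M \<rho> h0 \<alpha>0 \<theta> by unfold_locales (use \<alpha>A \<mu>_A strip_h0 in auto)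
  have M0: "M \<ge> 0" using f_x_bound[OF A, of 0] R_pos order_trans[OF norm_ge_zero] by (auto simp: strip_def)
  have z0: "0 \<in> strip r" using h.r_pos by (simp add: strip_def)
  have L20: "L2 \<ge> 0" "S2 \<ge> 0" using order_trans[OF norm_ge_zero L2[OF z0]] order_trans[OF norm_ge_zero S2[OF sub[OF z0]]] by auto
  have tw: "strip_per r (twist_fun f \<theta> h \<alpha>)"
    unfolding twist_fun_def by (intro strip_per_divide H.fa_h_per strip_per_shift[OF h.deriv_per]) (use nz in simp)
  have "strip_per \<rho> (twist_fun f \<theta> h0 \<alpha>0)"
    unfolding twist_fun_def by (intro strip_per_divide H0.fa_h_per strip_per_shift[OF base.deriv_per]) (use nz0 in simp)
  then have tw0: "strip_per r (twist_fun f \<theta> h0 \<alpha>0)" using r by (rule strip_per_mono)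
  have diff: "cmod (twist_fun f \<theta> h \<alpha> z - twist_fun f \<theta> h0 \<alpha>0 z) \<le> (2 * M * L2 + M * L2 * S2) * \<mu>" if z: "z \<in> strip r" for z
  proof -
    define x where "x = deriv h (z + of_real \<theta>)"
    define y where "y = deriv h0 (z + of_real \<theta>)"
    have zt: "z + of_real \<theta> \<in> strip r" using z by simp
    have x: "x \<noteq> 0" "cmod (1 / x) \<le> L2" and y: "y \<noteq> 0" "cmod (1 / y) \<le> S2" and xy: "cmod (x - y) \<le> \<mu>"
      using nz[OF zt] L2[OF zt] nz0[OF sub[OF zt]] S2[OF sub[OF zt]] near_h'[OF zt] by (auto simp: x_def y_def)
    have "cmod (fa \<alpha> (h z) - fa \<alpha> (h0 z)) \<le> M * cmod (h z - h0 z)"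
      by (rule fa_lipschitz_x[OF A strip_h[OF z] strip_h0[OF sub[OF z]]])
    also have "\<dots> \<le> M * \<mu>" using near_h[OF z] M0 by (rule mult_left_mono)
    finally have 1: "cmod (fa \<alpha> (h z) - fa \<alpha> (h0 z)) \<le> M * \<mu>" .
    have "cmod (fa \<alpha> (h0 z) - fa \<alpha>0 (h0 z)) \<le> M * \<bar>\<alpha> - \<alpha>0\<bar>"
      by (rule fa_lipschitz_a[OF seg strip_h0[OF sub[OF z]]])
    also have "\<dots> \<le> M * \<mu>" using near_a M0 by (rule mult_left_mono)
    finally have 2: "cmod (fa \<alpha> (h0 z) - fa \<alpha>0 (h0 z)) \<le> M * \<mu>" .
    have 12: "cmod (fa \<alpha> (h z) - fa \<alpha>0 (h0 z)) \<le> M * \<mu> + M * \<mu>"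
      using norm_triangle_mono[OF 1 2] by simp
    have "1 / x - 1 / y = - ((x - y) * (1 / x) * (1 / y))" using x(1) y(1) by (simp add: field_simps)
    then have "cmod (1 / x - 1 / y) = cmod (x - y) * cmod (1 / x) * cmod (1 / y)"
      by (simp add: norm_mult norm_divide)
    also have "\<dots> \<le> \<mu> * L2 * S2" using xy x(2) y(2) \<mu>_pos L20 by (intro mult_mono) auto
    finally have 3: "cmod (1 / x - 1 / y) \<le> \<mu> * L2 * S2" .
    \<comment> \<open>The numerator moves by at most \<open>2 * M * \<mu>\<close>, half through the
      point and half through the parameter, and the reciprocal derivative by at most
      \<open>\<mu> * L2 * S2\<close>. This is the origin of the constant in
      \<open>\<mu>_b\<close>.\<close>
    have e: "twist_fun f \<theta> h \<alpha> z - twist_fun f \<theta> h0 \<alpha>0 z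
        = (fa \<alpha> (h z) - fa \<alpha>0 (h0 z)) * (1 / x) + fa \<alpha>0 (h0 z) * (1 / x - 1 / y)"
      by (simp add: twist_fun_def x_def y_def algebra_simps diff_divide_distrib)
    have "cmod (twist_fun f \<theta> h \<alpha> z - twist_fun f \<theta> h0 \<alpha>0 z) \<le> (M * \<mu> + M * \<mu>) * L2 + M * (\<mu> * L2 * S2)"
      unfolding e by (intro norm_triangle_mono order_trans[OF norm_mult_ineq] mult_mono 12 x 3
          f_a_bound[OF H0.\<alpha> strip_h0[OF sub[OF z]]]) (use M0 \<mu>_pos in auto)
    also have "\<dots> = (2 * M * L2 + M * L2 * S2) * \<mu>" by (simp add: algebra_simps)
    finally show ?thesis .
  qed
  have "average (twist_fun f \<theta> h \<alpha>) - average (twist_fun f \<theta> h0 \<alpha>0)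
      = average (\<lambda>z. twist_fun f \<theta> h \<alpha> z - twist_fun f \<theta> h0 \<alpha>0 z)"
    by (rule average_diff[OF tw tw0 h.r_pos, symmetric])
  then have ad: "cmod (average (twist_fun f \<theta> h \<alpha>) - average (twist_fun f \<theta> h0 \<alpha>0)) \<le> (2 * M * L2 + M * L2 * S2) * \<mu>"
    using average_bound_strip[OF strip_per_diff[OF tw tw0] h.r_pos diff] by simp
  show "average (twist_fun f \<theta> h \<alpha>) \<noteq> 0" "cmod (1 / average (twist_fun f \<theta> h \<alpha>)) \<le> Lb"
    using norm_inverse_perturb[OF Sb ad \<mu>_b] by auto
qed

lemma near_family_conj:
  assumes "circle_lift r h" "r \<le> \<rho>" "near r \<mu> h0 \<alpha>0 h \<alpha>"
  shows "family_conj A f R M r h \<alpha>"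
proof -
  interpret h: circle_lift r h by fact
  show ?thesis
    by unfold_locales (use near_bounds(1,2)[OF assms] d_pos in \<open>force simp: strip_def\<close>)+
qed

end

section \<open>Convergence of the iteration\<close>

context initial_pair
begin

text \<open>The invariant of the iteration: \<open>r\<close> is the current half-width,
  \<open>\<nu>\<close> the displacement accumulated so far, \<open>\<epsilon>\<close> the current
  error bound.\<close>

definition kam_state :: "real \<Rightarrow> real \<Rightarrow> real \<Rightarrow> (complex \<Rightarrow> complex) \<times> real \<Rightarrow> bool" where
  "kam_state r \<nu> \<epsilon> = (\<lambda>(h, \<alpha>). circle_lift r h \<and> average (\<lambda>z. h z - z) = 0 \<and> near r \<nu> h0 \<alpha>0 h \<alpha> \<and>
     (\<forall>z\<in>strip r. cmod (conj_error f \<theta> h \<alpha> z) \<le> \<epsilon>))"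

lemma near_mono: "near r \<nu> g a h b \<Longrightarrow> \<nu> \<le> \<nu>' \<Longrightarrow> near r \<nu>' g a h b"
  unfolding near_def by (meson order_trans)

text \<open>While the accumulated displacement is at most \<open>\<mu>\<close>,
  \<open>near_bounds\<close> supplies the relaxed bounds, so \<open>K\<close> depends on the iterate
  only through the width \<open>\<delta>\<close> given up.\<close>

lemma kam_state_step:
  assumes state: "kam_state r \<nu> \<epsilon> (h, \<alpha>)" and r: "r \<le> \<rho>" and \<delta>: "0 < \<delta>" "\<delta> \<le> 1" "\<delta> < r"
    and \<theta>: "\<theta> \<in> diophantine \<gamma> \<tau>" and \<gamma>: "\<gamma> > 0"
    and K: "K = step_const \<gamma> \<tau> M L1 L2 Lb / \<delta> ^ (2 * coh_order \<tau> + 2)"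
    and small: "\<nu> + K * \<epsilon> \<le> \<mu>" "\<nu> \<le> \<mu>" "K * \<epsilon> \<le> d / 2"
  shows "\<exists>h' \<alpha>'. kam_state (r - \<delta>) (\<nu> + K * \<epsilon>) (K * \<epsilon>\<^sup>2) (h', \<alpha>') \<and> near (r - \<delta>) (K * \<epsilon>) h \<alpha> h' \<alpha>'"
proof -
  have lift: "circle_lift r h" and avg: "average (\<lambda>z. h z - z) = 0" and near\<nu>: "near r \<nu> h0 \<alpha>0 h \<alpha>"
    and err: "\<And>z. z \<in> strip r \<Longrightarrow> cmod (conj_error f \<theta> h \<alpha> z) \<le> \<epsilon>"
    using state by (auto simp: kam_state_def)
  have near: "near r \<mu> h0 \<alpha>0 h \<alpha>" by (rule near_mono[OF near\<nu> small(2)])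
  note nb = near_bounds[OF lift r near]
  interpret H: family_conj A f R M r h \<alpha> \<theta> by (rule near_family_conj[OF lift r near])
  obtain \<Delta> a where \<Delta>: "strip_per (r - \<delta>) \<Delta>" "real_on_reals \<Delta>" "average \<Delta> = 0" and a: "\<bar>a\<bar> \<le> K * \<epsilon>"
    and \<Delta>b: "\<And>z. z \<in> strip (r - \<delta>) \<Longrightarrow> cmod (\<Delta> z) \<le> K * \<epsilon>" "\<And>z. z \<in> strip (r - \<delta>) \<Longrightarrow> cmod (deriv \<Delta> z) \<le> K * \<epsilon>"
    and new: "\<And>z. closed_segment \<alpha> (\<alpha> + a) \<subseteq> A \<Longrightarrow> z \<in> strip (r - \<delta>) \<Longrightarrow>
       cmod (conj_error f \<theta> (\<lambda>z. h z + \<Delta> z) (\<alpha> + a) z) \<le> K * \<epsilon>\<^sup>2"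
    using H.newton_step[OF \<theta> \<gamma> d_pos nb(2,3,4,5,6,7) err \<delta> K] small(3) by blast
  have sub: "z \<in> strip r" if "z \<in> strip (r - \<delta>)" for z using that \<delta> by (simp add: strip_def)
  have r\<delta>: "r - \<delta> > 0" using \<delta> by simp
  have "strip_per (r - \<delta>) (\<lambda>z. (h z - z) + \<Delta> z)"
    using strip_per_mono[OF H.per] \<delta> by (intro strip_per_add \<Delta>) auto
  then have per: "strip_per (r - \<delta>) (\<lambda>z. (h z + \<Delta> z) - z)" by (simp add: algebra_simps)
  have lift': "circle_lift (r - \<delta>) (\<lambda>z. h z + \<Delta> z)"
    by unfold_locales (use r\<delta> per real_on_reals_add[OF H.real \<Delta>(2)] in auto)
  have "average (\<lambda>z. (h z - z) + \<Delta> z) = average (\<lambda>z. h z - z) + average \<Delta>"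
    by (rule average_add[OF strip_per_mono[OF H.per] \<Delta>(1) r\<delta>]) (use \<delta> in simp)
  then have avg': "average (\<lambda>z. (h z + \<Delta> z) - z) = 0" by (simp add: avg \<Delta>(3) algebra_simps)
  have der: "deriv (\<lambda>z. h z + \<Delta> z) z = deriv h z + deriv \<Delta> z" if z: "z \<in> strip (r - \<delta>)" for z
    by (rule DERIV_imp_deriv[OF DERIV_add[OF H.h_deriv[OF sub[OF z]] strip_perD(4)[OF \<Delta>(1) z]]])
  have near1: "near (r - \<delta>) (K * \<epsilon>) h \<alpha> (\<lambda>z. h z + \<Delta> z) (\<alpha> + a)"
    using a \<Delta>b by (auto simp: near_def der)
  have near2: "near (r - \<delta>) (\<nu> + K * \<epsilon>) h0 \<alpha>0 (\<lambda>z. h z + \<Delta> z) (\<alpha> + a)"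
    unfolding near_def
  proof (intro conjI ballI)
    show "\<bar>\<alpha> + a - \<alpha>0\<bar> \<le> \<nu> + K * \<epsilon>" using near\<nu> a by (auto simp: near_def)
    fix z assume z: "z \<in> strip (r - \<delta>)"
    have 1: "cmod (h z - h0 z) \<le> \<nu>" "cmod (deriv h z - deriv h0 z) \<le> \<nu>"
      using near\<nu> sub[OF z] by (auto simp: near_def)
    show "cmod (h z + \<Delta> z - h0 z) \<le> \<nu> + K * \<epsilon>"
      using norm_triangle_mono[OF 1(1) \<Delta>b(1)[OF z]] by (simp add: algebra_simps)
    show "cmod (deriv (\<lambda>z. h z + \<Delta> z) z - deriv h0 z) \<le> \<nu> + K * \<epsilon>"
      unfolding der[OF z] using norm_triangle_mono[OF 1(2) \<Delta>b(2)[OF z]] by (simp add: algebra_simps)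
  qed
  \<comment> \<open>Old and new parameter lie in a ball contained in \<open>A\<close>; its convexity
    supplies the segment required by the Taylor estimate.\<close>
  have "\<alpha> \<in> cball \<alpha>0 \<mu>" "\<alpha> + a \<in> cball \<alpha>0 \<mu>"
    using near near2 small(1) by (auto simp: near_def dist_real_def)
  then have "closed_segment \<alpha> (\<alpha> + a) \<subseteq> A"
    using closed_segment_subset[OF _ _ convex_cball] \<mu>_A by blast
  from new[OF this] show ?thesis
    using lift' avg' near1 near2 by (auto simp: kam_state_def)
qed

text \<open>Step \<open>n\<close> gives up the width \<open>\<delta>0 / 2^(n+1)\<close>, so the step
  constant grows by \<open>2^N\<close> each time. The error is only asked to shrink by the fixed
  ratio \<open>q = 2^(-N-1)\<close>. Then the displacement at step \<open>n\<close> is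
  \<open>\<kappa> / 2^n\<close>, and the quadratic estimate multiplies the error by that same
  number, which is at most \<open>q\<close>. The displacements add up to at most
  \<open>2 * \<kappa>\<close>.\<close>

lemma kam_sequence:
  assumes \<theta>: "\<theta> \<in> diophantine \<gamma> \<tau>" and \<gamma>: "\<gamma> > 0"
    and \<delta>0: "0 < \<delta>0" "\<delta>0 \<le> 1" "\<delta>0 < \<rho>"
    and err: "\<And>z. z \<in> strip \<rho> \<Longrightarrow> cmod (conj_error f \<theta> h0 \<alpha>0 z) \<le> \<epsilon>" and \<epsilon>: "\<epsilon> \<ge> 0"
    and N: "N = 2 * coh_order \<tau> + 2" and \<kappa>: "\<kappa> = step_const \<gamma> \<tau> M L1 L2 Lb * 2 ^ N / \<delta>0 ^ N * \<epsilon>"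
    and small: "\<kappa> \<le> (1 / 2) ^ (N + 1)" "2 * \<kappa> \<le> \<mu>" "\<kappa> \<le> d / 2" and \<kappa>0: "\<kappa> \<ge> 0"
  shows "\<exists>s. \<forall>n. kam_state (\<rho> - \<delta>0) (2 * \<kappa>) (\<epsilon> * (1 / 2) ^ n) (s n) \<and>
    near (\<rho> - \<delta>0) (\<kappa> * (1 / 2) ^ n) (fst (s n)) (snd (s n)) (fst (s (Suc n))) (snd (s (Suc n)))"
proof -
  define q where "q = (1 / 2 :: real) ^ (N + 1)"
  \<comment> \<open>These are partial sums: \<open>rad n\<close> has lost
    \<open>\<delta>0 / 2 + ... + \<delta>0 / 2^n\<close>, and \<open>dev n\<close> (0 for
    \<open>n = 0\<close>) is \<open>\<kappa> + ... + \<kappa> / 2^(n-1)\<close>.\<close>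
  define rad where "rad n = \<rho> - \<delta>0 * (1 - (1 / 2) ^ n)" for n
  define dev where "dev n = \<kappa> * (2 - 2 * (1 / 2) ^ n)" for n :: nat
  define P where "P n s \<longleftrightarrow> kam_state (rad n) (dev n) (\<epsilon> * q ^ n) s" for n s
  define Q where "Q n s s' \<longleftrightarrow> near (rad (Suc n)) (\<kappa> * (1 / 2) ^ n) (fst s) (snd s) (fst s') (snd s')"
    for n :: nat and s s' :: "(complex \<Rightarrow> complex) \<times> real"
  have half: "0 < (1 / 2 :: real) ^ n" "(1 / 2 :: real) ^ n \<le> 1" for n by (auto intro: power_le_one)
  have rad: "rad n \<le> \<rho>" "\<rho> - \<delta>0 < rad n" for n
    using \<delta>0(1) half[of n] by (auto simp: rad_def algebra_simps)
  have "\<exists>s. \<forall>n. P n (s n) \<and> Q n (s n) (s (Suc n))"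
  proof (rule dependent_nat_choice)
    have "P 0 (h0, \<alpha>0)"
      using err base.circle_lift_axioms avg0 by (simp add: P_def kam_state_def rad_def dev_def near_def)
    then show "\<exists>x. P 0 x" ..
  next
    fix x n assume Pn: "P n x"
    obtain h \<alpha> where x: "x = (h, \<alpha>)" by (cases x)
    define \<delta> where "\<delta> = \<delta>0 * (1 / 2) ^ (Suc n)"
    define K where "K = step_const \<gamma> \<tau> M L1 L2 Lb / \<delta> ^ (2 * coh_order \<tau> + 2)"
    have rS: "rad n - \<delta> = rad (Suc n)" by (simp add: rad_def \<delta>_def algebra_simps)
    have \<delta>: "0 < \<delta>" "\<delta> \<le> 1" "\<delta> < rad n"
    proof -
      show "0 < \<delta>" using \<delta>0(1) by (simp add: \<delta>_def)
      show "\<delta> \<le> 1" unfolding \<delta>_def using \<delta>0 half[of "Suc n"] by (intro mult_le_one) auto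
      show "\<delta> < rad n" using rS rad(2)[of "Suc n"] \<delta>0(3) by linarith
    qed
    have Keps: "K * (\<epsilon> * q ^ n) = \<kappa> * (1 / 2) ^ n"
    proof -
      have "\<delta> ^ N * (2 ^ N * (2 ^ N) ^ n) = \<delta>0 ^ N"
      proof -
        have "\<delta> * (2 * 2 ^ n) = \<delta>0" by (simp add: \<delta>_def power_divide)
        then have "(\<delta> * (2 * 2 ^ n)) ^ N = \<delta>0 ^ N" by simp
        then show ?thesis by (simp add: power_mult_distrib power_mult[symmetric] mult.commute)
      qed
      then have "K = step_const \<gamma> \<tau> M L1 L2 Lb * (2 ^ N * (2 ^ N) ^ n) / \<delta>0 ^ N"
        unfolding K_def N[symmetric] using \<delta>(1) \<delta>0(1) by (simp add: field_simps)
      then have "K * (\<epsilon> * q ^ n) = \<kappa> * ((2 ^ N) ^ n * q ^ n)" by (simp add: \<kappa> mult_ac)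
      also have "(2 ^ N) ^ n * q ^ n = (2 ^ N * q) ^ n" by (rule power_mult_distrib[symmetric])
      also have "2 ^ N * q = 1 / 2" by (simp add: q_def power_divide)
      finally show ?thesis .
    qed
    have dS: "dev n + K * (\<epsilon> * q ^ n) = dev (Suc n)" unfolding Keps by (simp add: dev_def algebra_simps)
    have dm: "dev n \<le> \<mu>" for n
    proof -
      have "dev n \<le> \<kappa> * 2" unfolding dev_def using \<kappa>0 half[of n] by (intro mult_left_mono) auto
      then show ?thesis using small(2) by simp
    qed
    have \<kappa>n: "\<kappa> * (1 / 2) ^ n \<le> \<kappa>" using \<kappa>0 half[of n] mult_left_mono[of "(1 / 2) ^ n" 1 \<kappa>] by simp
    obtain h' \<alpha>' where new: "kam_state (rad n - \<delta>) (dev n + K * (\<epsilon> * q ^ n)) (K * (\<epsilon> * q ^ n)\<^sup>2) (h', \<alpha>')"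
      and mv: "near (rad n - \<delta>) (K * (\<epsilon> * q ^ n)) h \<alpha> h' \<alpha>'"
      using kam_state_step[OF Pn[unfolded P_def x] rad(1) \<delta> \<theta> \<gamma> K_def] dm[of n] dm[of "Suc n"] \<kappa>n small(3)
      unfolding dS unfolding Keps by (metis order_trans)
    have "K * (\<epsilon> * q ^ n)\<^sup>2 = (K * (\<epsilon> * q ^ n)) * (\<epsilon> * q ^ n)" by (simp add: power2_eq_square)
    also have "\<dots> \<le> q * (\<epsilon> * q ^ n)"
      unfolding Keps using \<kappa>n small(1) \<epsilon> by (intro mult_right_mono) (auto simp: q_def)
    finally have "K * (\<epsilon> * q ^ n)\<^sup>2 \<le> \<epsilon> * q ^ Suc n" by (simp add: mult_ac)
    then have "P (Suc n) (h', \<alpha>')"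
      using new unfolding P_def rS dS by (auto simp: kam_state_def intro: order_trans)
    moreover have "Q n x (h', \<alpha>')" using mv unfolding rS Keps by (simp add: Q_def x)
    ultimately show "\<exists>y. P (Suc n) y \<and> Q n x y" by blast
  qed
  then obtain s where s: "\<And>n. P n (s n)" "\<And>n. Q n (s n) (s (Suc n))" by blast
  have sub: "strip (\<rho> - \<delta>0) \<subseteq> strip (rad n)" for n using rad(2)[of n] by (intro strip_mono) simp
  have r0: "\<rho> - \<delta>0 > 0" using \<delta>0 by simp
  \<comment> \<open>Passing to the limit requires one strip and one displacement bound for all
    \<open>n\<close>; the error rate is weakened from \<open>q ^ n\<close> to
    \<open>(1 / 2) ^ n\<close>.\<close>
  have "kam_state (\<rho> - \<delta>0) (2 * \<kappa>) (\<epsilon> * (1 / 2) ^ n) (s n)" for n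
  proof -
    obtain h \<alpha> where x: "s n = (h, \<alpha>)" by (cases "s n")
    have st: "circle_lift (rad n) h" "average (\<lambda>z. h z - z) = 0" "near (rad n) (dev n) h0 \<alpha>0 h \<alpha>"
      and e: "\<And>z. z \<in> strip (rad n) \<Longrightarrow> cmod (conj_error f \<theta> h \<alpha> z) \<le> \<epsilon> * q ^ n"
      using s(1)[of n] by (auto simp: P_def kam_state_def x)
    have lift: "circle_lift (\<rho> - \<delta>0) h"
      using st(1) r0 strip_per_mono[of "rad n" _ "\<rho> - \<delta>0"] rad(2)[of n] by (auto simp: circle_lift_def)
    have "near (\<rho> - \<delta>0) (dev n) h0 \<alpha>0 h \<alpha>" using st(3) sub[of n] by (auto simp: near_def)
    moreover have "dev n \<le> 2 * \<kappa>" using \<kappa>0 half[of n] by (simp add: dev_def algebra_simps)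
    ultimately have nr: "near (\<rho> - \<delta>0) (2 * \<kappa>) h0 \<alpha>0 h \<alpha>" by (rule near_mono)
    have "q \<le> 1 / 2" using half(2)[of N] by (simp add: q_def)
    then have "\<epsilon> * q ^ n \<le> \<epsilon> * (1 / 2) ^ n" using \<epsilon> by (intro mult_left_mono power_mono) (auto simp: q_def)
    then have "cmod (conj_error f \<theta> h \<alpha> z) \<le> \<epsilon> * (1 / 2) ^ n" if "z \<in> strip (\<rho> - \<delta>0)" for z
      using e[of z] sub[of n] that by force
    then show ?thesis using lift st(2) nr by (simp add: kam_state_def x)
  qed
  moreover have "near (\<rho> - \<delta>0) (\<kappa> * (1 / 2) ^ n) (fst (s n)) (snd (s n)) (fst (s (Suc n))) (snd (s (Suc n)))" for n
    using s(2)[of n] sub[of "Suc n"] by (auto simp: Q_def near_def)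
  ultimately show ?thesis by blast
qed

text \<open>Consecutive differences are dominated by a geometric series, so the maps converge
  uniformly on the open strip and, being holomorphic, their derivatives converge pointwise. The
  invariant consists of closed conditions and survives the limit.\<close>

lemma kam_limit:
  assumes st: "\<And>n. kam_state r \<nu> (\<epsilon> * (1 / 2) ^ n) (s n)"
    and mv: "\<And>n. near r (\<kappa> * (1 / 2) ^ n) (fst (s n)) (snd (s n)) (fst (s (Suc n))) (snd (s (Suc n)))"
    and r: "r \<le> \<rho>" and \<nu>: "\<nu> \<le> \<mu>"
  shows "\<exists>h \<alpha>. kam_state r \<nu> 0 (h, \<alpha>)"
proof -
  define H where "H n = fst (s n)" for n
  define a where "a n = snd (s n)" for n
  have lift: "circle_lift r (H n)" and avg: "average (\<lambda>z. H n z - z) = 0" and near: "near r \<nu> h0 \<alpha>0 (H n) (a n)"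
    and err: "\<And>z. z \<in> strip r \<Longrightarrow> cmod (conj_error f \<theta> (H n) (a n) z) \<le> \<epsilon> * (1 / 2) ^ n" for n
    using st[of n] by (auto simp: kam_state_def H_def a_def split: prod.splits)
  have r0: "r > 0" using lift[of 0] by (simp add: circle_lift_def)
  have geo: "summable (\<lambda>n. \<kappa> * (1 / 2) ^ n)" by (intro summable_mult summable_geometric) simp
  have dH: "cmod (H (Suc n) z - H n z) \<le> \<kappa> * (1 / 2) ^ n" if "z \<in> strip r" for n z
    using mv[of n] that by (simp add: near_def H_def)
  define h where "h z = H 0 z + (\<Sum>n. H (Suc n) z - H n z)" for z
  have "uniform_limit (strip r) (\<lambda>N z. H 0 z + (\<Sum>n<N. H (Suc n) z - H n z)) h sequentially"
    unfolding h_def by (intro uniform_limit_add uniform_limit_const Weierstrass_m_test[OF dH geo])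
  moreover have "H 0 z + (\<Sum>n<N. H (Suc n) z - H n z) = H N z" for N z
    using sum_lessThan_telescope[of "\<lambda>n. H n z" N] by simp
  ultimately have ul: "uniform_limit (strip r) H h sequentially" by simp
  have lim: "(\<lambda>n. H n z) \<longlonglongrightarrow> h z" if "z \<in> strip r" for z
    by (rule tendsto_uniform_limitI[OF ul that])
  have "summable (\<lambda>n. a (Suc n) - a n)"
    by (rule summable_comparison_test'[OF geo, of 0]) (use mv in \<open>auto simp: near_def a_def\<close>)
  then have "(\<lambda>N. \<Sum>n<N. a (Suc n) - a n) \<longlonglongrightarrow> (\<Sum>n. a (Suc n) - a n)" by (rule summable_LIMSEQ)
  from tendsto_add[OF tendsto_const[of "a 0"] this]
  obtain \<alpha> where lima: "a \<longlonglongrightarrow> \<alpha>" by (auto simp: sum_lessThan_telescope)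
  have hol: "H n holomorphic_on strip r" for n by (rule circle_lift.hol[OF lift])
  have h_hol: "h holomorphic_on strip r"
  proof (rule holomorphic_uniform_sequence[OF open_strip hol])
    show "\<exists>d>0. cball x d \<subseteq> strip r \<and> uniform_limit (cball x d) H h sequentially" if "x \<in> strip r" for x
      using open_contains_cball[THEN iffD1, OF open_strip, rule_format, OF that] uniform_limit_on_subset[OF ul] by blast
  qed
  have limd: "(\<lambda>n. deriv (H n) z) \<longlonglongrightarrow> deriv h z" if z: "z \<in> strip r" for z
    using higher_deriv_complex_uniform_limit[OF ul _ _ open_strip z, of 1] hol by simp
  have h_per: "strip_per r (\<lambda>z. h z - z)"
  proof -
    have "h (z + 1) = h z + 1" if z: "z \<in> strip r" for z
    proof (rule LIMSEQ_unique[OF lim])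
      show "(\<lambda>n. H n (z + 1)) \<longlonglongrightarrow> h z + 1"
        unfolding circle_lift.h_add_1[OF lift z] by (intro tendsto_intros lim z)
    qed (use z in simp)
    then show ?thesis unfolding strip_per_def using h_hol by (auto intro!: holomorphic_intros)
  qed
  have h_real: "real_on_reals h"
    unfolding real_on_reals_def
  proof
    fix t :: real
    have "\<forall>n. H n (of_real t) \<in> \<real>" using circle_lift.real[OF lift] by (simp add: real_on_reals_def)
    then show "h (of_real t) \<in> \<real>"
      using Lim_in_closed_set[OF closed_complex_Reals _ _ lim[of "of_real t"]] r0 by (simp add: always_eventually)
  qed
  have hl: "circle_lift r h" by unfold_locales (use r0 h_per h_real in auto)
  have nr: "near r \<nu> h0 \<alpha>0 h \<alpha>"
    unfolding near_def
  proof (intro conjI ballI)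
    show "\<bar>\<alpha> - \<alpha>0\<bar> \<le> \<nu>"
      by (rule LIMSEQ_le_const2[of "\<lambda>n. \<bar>a n - \<alpha>0\<bar>"]) (use near in \<open>auto simp: near_def intro!: tendsto_intros lima\<close>)
    show "cmod (h z - h0 z) \<le> \<nu>" if "z \<in> strip r" for z
      by (rule LIMSEQ_le_const2[of "\<lambda>n. cmod (H n z - h0 z)"]) (use near that in \<open>auto simp: near_def intro!: tendsto_intros lim\<close>)
    show "cmod (deriv h z - deriv h0 z) \<le> \<nu>" if "z \<in> strip r" for z
      by (rule LIMSEQ_le_const2[of "\<lambda>n. cmod (deriv (H n) z - deriv h0 z)"])
         (use near that in \<open>auto simp: near_def intro!: tendsto_intros limd\<close>)
  qed
  \<comment> \<open>Let \<open>e\<close> be half the modulus of a supposed nonzero average. An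
    iterate uniformly within \<open>e\<close> of the limit has average 0, which would make the
    modulus at most half of itself.\<close>
  have avg_h: "average (\<lambda>z. h z - z) = 0"
  proof (rule ccontr)
    assume ne: "average (\<lambda>z. h z - z) \<noteq> 0"
    define e where "e = cmod (average (\<lambda>z. h z - z)) / 2"
    have "e > 0" using ne by (simp add: e_def)
    from uniform_limitD[OF ul this] obtain n where n: "\<And>z. z \<in> strip r \<Longrightarrow> dist (H n z) (h z) < e"
      by (auto simp: eventually_sequentially)
    have "average (\<lambda>z. h z - z) - average (\<lambda>z. H n z - z) = average (\<lambda>z. (h z - z) - (H n z - z))"
      by (rule average_diff[OF h_per circle_lift.per[OF lift] r0, symmetric])
    also have "cmod \<dots> \<le> e"
      by (rule average_bound_strip[OF strip_per_diff[OF h_per circle_lift.per[OF lift]] r0])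
         (use n in \<open>auto simp: dist_norm norm_minus_commute intro: less_imp_le\<close>)
    finally show False using avg[of n] ne by (simp add: e_def)
  qed
  have zero: "cmod (conj_error f \<theta> h \<alpha> z) \<le> 0" if z: "z \<in> strip r" for z
  proof -
    have near\<mu>: "near r \<mu> h0 \<alpha>0 (H n) (a n)" for n by (rule near_mono[OF near \<nu>])
    have nrh: "near r \<mu> h0 \<alpha>0 h \<alpha>" by (rule near_mono[OF nr \<nu>])
    have an: "a n \<in> cball \<alpha>0 \<mu>" for n using near\<mu>[of n] by (auto simp: near_def dist_real_def abs_minus_commute)
    have \<alpha>c: "\<alpha> \<in> cball \<alpha>0 \<mu>" using nrh by (auto simp: near_def dist_real_def abs_minus_commute)
    have seg: "closed_segment \<alpha> (a n) \<subseteq> A" for n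
      using closed_segment_subset[OF \<alpha>c an convex_cball] \<mu>_A by blast
    have Hs: "H n z \<in> strip R" for n
      using near_im[OF lift r near\<mu> z, of n] d_pos by (simp add: strip_def)
    have hs: "h z \<in> strip R"
      using near_im[OF hl r nrh z] d_pos by (simp add: strip_def)
    \<comment> \<open>Joint continuity from the two Lipschitz bounds: the parameter is moved at the
      point \<open>H n z\<close>, then the point at the parameter \<open>\<alpha>\<close>.\<close>
    have "(\<lambda>n. f (a n) (H n z) - f \<alpha> (h z)) \<longlonglongrightarrow> 0"
    proof (rule Lim_null_comparison)
      have "cmod (f (a n) (H n z) - f \<alpha> (h z)) \<le> M * \<bar>a n - \<alpha>\<bar> + M * cmod (H n z - h z)" for n
        using norm_triangle_mono[OF f_lipschitz_a[OF seg[of n] Hs[of n]] f_lipschitz_x[OF _ Hs[of n] hs, of \<alpha>]]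
          subsetD[OF seg[of n] ends_in_segment(1)] by simp
      then show "\<forall>\<^sub>F n in sequentially. cmod (f (a n) (H n z) - f \<alpha> (h z)) \<le> M * \<bar>a n - \<alpha>\<bar> + M * cmod (H n z - h z)"
        by (rule always_eventually[OF allI])
      have "(\<lambda>n. M * \<bar>a n - \<alpha>\<bar> + M * cmod (H n z - h z)) \<longlonglongrightarrow> M * \<bar>\<alpha> - \<alpha>\<bar> + M * cmod (h z - h z)"
        by (intro tendsto_intros lim lima z)
      then show "(\<lambda>n. M * \<bar>a n - \<alpha>\<bar> + M * cmod (H n z - h z)) \<longlonglongrightarrow> 0" by simp
    qed
    moreover have "(\<lambda>n. H n (z + of_real \<theta>)) \<longlonglongrightarrow> h (z + of_real \<theta>)" using z by (intro lim) simp
    ultimately have "(\<lambda>n. (f (a n) (H n z) - f \<alpha> (h z)) + f \<alpha> (h z) - H n (z + of_real \<theta>))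
        \<longlonglongrightarrow> 0 + f \<alpha> (h z) - h (z + of_real \<theta>)"
      by (intro tendsto_diff tendsto_add tendsto_const)
    then have "(\<lambda>n. conj_error f \<theta> (H n) (a n) z) \<longlonglongrightarrow> conj_error f \<theta> h \<alpha> z"
      by (simp add: conj_error_def)
    then have 1: "(\<lambda>n. cmod (conj_error f \<theta> (H n) (a n) z)) \<longlonglongrightarrow> cmod (conj_error f \<theta> h \<alpha> z)"
      by (rule tendsto_norm)
    have 2: "(\<lambda>n. \<epsilon> * (1 / 2) ^ n) \<longlonglongrightarrow> 0"
      using tendsto_mult_right_zero[OF LIMSEQ_power_zero[of "1 / 2 :: real"], of \<epsilon>] by simp
    show ?thesis by (rule LIMSEQ_le[OF 1 2]) (use err[OF z] in blast)
  qed
  show ?thesis using hl avg_h nr zero by (auto simp: kam_state_def)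
qed

end

section \<open>Circle homeomorphisms and the choice of constants\<close>

lemma circle_lift_of_circle_maps:
  assumes "h \<in> circle_maps r" "r > 0"
  shows "circle_lift r h"
proof
  have P: "(\<lambda>x. h x - x) \<in> Per r" using assms by (simp add: circle_maps_def)
  have "strip r \<subseteq> closed_strip r" by (auto simp: strip_def closed_strip_def)
  then show "strip_per r (\<lambda>z. h z - z)" using P by (auto simp: Per_def strip_per_def)
  show "real_on_reals h" unfolding real_on_reals_def
  proof
    fix t :: real
    have "h (of_real t) - of_real t \<in> \<real>" using P by (auto simp: Per_def image_subset_iff)
    from Reals_add[OF this Reals_of_real[of t]] show "h (of_real t) \<in> \<real>" by simp
  qed
qed (rule assms)

text \<open>The derivative on the real line has no zero and its average is 1, hence it is positive.\<close>

lemma (in circle_lift) homeomorphism_reals: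
  assumes nz: "\<And>z. z \<in> strip r \<Longrightarrow> deriv h z \<noteq> 0"
  shows "\<exists>g. homeomorphism \<real> \<real> h g"
proof -
  define \<phi> where "\<phi> t = Re (h (of_real t))" for t
  define \<phi>' where "\<phi>' t = Re (deriv h (of_real t))" for t
  have h_eq: "h (of_real t) = of_real (\<phi> t)" for t
    using real by (simp add: \<phi>_def real_on_reals_def)
  have der: "(\<phi> has_real_derivative \<phi>' t) (at t)" for t
  proof -
    have "((\<lambda>t. h (of_real t)) has_vector_derivative deriv h (of_real t)) (at t)"
      using h_deriv[of "of_real t"] r_pos by (intro has_vector_derivative_real_field) simp
    then have "(\<phi> has_vector_derivative \<phi>' t) (at t)"
      unfolding \<phi>_def \<phi>'_def by (rule bounded_linear.has_vector_derivative[OF bounded_linear_Re])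
    then show ?thesis by (simp add: has_real_derivative_iff_has_vector_derivative)
  qed
  have \<phi>'_nz: "\<phi>' t \<noteq> 0" for t
    using nz[of "of_real t"] deriv_real r_pos by (auto simp: \<phi>'_def real_on_reals_def complex_is_Real_iff complex_eq_iff)
  have cont': "continuous_on UNIV \<phi>'"
    unfolding \<phi>'_def
    by (intro continuous_on_Re continuous_on_reals[OF strip_perD(5)[OF deriv_per] r_pos])
  have cont: "continuous_on UNIV \<phi>"
    using der by (intro continuous_at_imp_continuous_on) (auto intro: DERIV_isCont)
  have \<phi>1: "\<phi> (t + 1) = \<phi> t + 1" for t
    using h_add_1[of "of_real t"] r_pos by (simp add: \<phi>_def)
  obtain c where c: "\<phi>' c = 1"
    using MVT2[of 0 1 \<phi> \<phi>'] der \<phi>1[of 0] by auto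
  have pos: "\<phi>' t > 0" for t
  proof (rule ccontr)
    assume "\<not> \<phi>' t > 0"
    moreover have "{\<phi>' t..\<phi>' c} \<subseteq> range \<phi>'"
      by (rule connected_contains_Icc[OF connected_continuous_image[OF cont']]) auto
    ultimately have "0 \<in> range \<phi>'" using c by auto
    then show False using \<phi>'_nz by (metis imageE)
  qed
  have mono: "\<phi> s < \<phi> t" if "s < t" for s t
    using DERIV_pos_imp_increasing[OF that, of \<phi>] der pos by blast
  have inj: "inj \<phi>"
    by (rule linorder_injI) (use mono in fastforce)
  \<comment> \<open>Growth by 1 per period makes \<open>\<phi>\<close> unbounded in both directions,
    so surjectivity will follow from the intermediate value theorem.\<close>
  have shift: "\<phi> (real n) = \<phi> 0 + real n" "\<phi> (- real n) = \<phi> 0 - real n" for n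
  proof -
    show "\<phi> (real n) = \<phi> 0 + real n" 
    proof (induction n)
      case (Suc n)
      have "\<phi> (real (Suc n)) = \<phi> (real n) + 1" using \<phi>1[of "real n"] by (simp add: add.commute)
      then show ?case using Suc by simp
    qed simp
    show "\<phi> (- real n) = \<phi> 0 - real n"
    proof (induction n)
      case (Suc n)
      then show ?case using \<phi>1[of "- real (Suc n)"] by simp
    qed simp
  qed
  have surj: "range \<phi> = UNIV"
  proof -
    have "y \<in> range \<phi>" for y
    proof -
      obtain n where n: "\<bar>y - \<phi> 0\<bar> \<le> real n" using real_arch_simple by blast
      have "{\<phi> (- real n)..\<phi> (real n)} \<subseteq> range \<phi>"
        by (rule connected_contains_Icc[OF connected_continuous_image[OF cont]]) auto
      moreover have "y \<in> {\<phi> (- real n)..\<phi> (real n)}" using n by (auto simp: shift)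
      ultimately show ?thesis by blast
    qed
    then show ?thesis by blast
  qed
  define \<psi> where "\<psi> = inv \<phi>"
  have \<psi>: "\<psi> (\<phi> t) = t" "\<phi> (\<psi> y) = y" for t y
    using inj surj by (simp_all add: \<psi>_def surj_f_inv_f)
  have "range \<psi> = UNIV" using \<psi>(1) by (metis surjI)
  moreover have "\<psi> x \<le> \<psi> y" if "x \<le> y" for x y
    using mono[of "\<psi> y" "\<psi> x"] \<psi>(2) that by (metis not_le)
  \<comment> \<open>A monotone map onto the whole line is continuous.\<close>
  ultimately have cont\<psi>: "continuous_on UNIV \<psi>"
    by (intro continuous_onI_mono) auto
  have "homeomorphism \<real> \<real> h (\<lambda>z. of_real (\<psi> (Re z)))"
    unfolding homeomorphism_def
  proof (intro conjI ballI)
    show "h ` \<real> = \<real>"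
    proof
      show "h ` \<real> \<subseteq> \<real>" by (auto elim!: Reals_cases simp: h_eq)
      show "\<real> \<subseteq> h ` \<real>"
      proof
        fix z :: complex assume "z \<in> \<real>"
        then obtain y where "z = of_real y" by (auto elim: Reals_cases)
        then have "z = h (of_real (\<psi> y))" by (simp add: h_eq \<psi>)
        then show "z \<in> h ` \<real>" by (rule image_eqI) simp
      qed
    qed
    show "(\<lambda>z. complex_of_real (\<psi> (Re z))) ` \<real> = \<real>"
    proof
      show "\<real> \<subseteq> (\<lambda>z. complex_of_real (\<psi> (Re z))) ` \<real>"
      proof
        fix z :: complex assume "z \<in> \<real>"
        then obtain y where "z = of_real y" by (auto elim: Reals_cases)
        then have "z = of_real (\<psi> (Re (of_real (\<phi> y))))" by (simp add: \<psi>)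
        then show "z \<in> (\<lambda>z. complex_of_real (\<psi> (Re z))) ` \<real>" by (rule image_eqI) simp
      qed
    qed auto
    show "continuous_on \<real> h"
    proof (rule continuous_on_subset[OF holomorphic_on_imp_continuous_on[OF hol]])
      show "\<real> \<subseteq> strip r" using r_pos by (auto elim!: Reals_cases)
    qed
    show "continuous_on \<real> (\<lambda>z. complex_of_real (\<psi> (Re z)))"
      by (intro continuous_on_of_real continuous_on_compose2[OF cont\<psi>] continuous_intros) auto
  qed (auto elim!: Reals_cases simp: h_eq \<psi>)
  then show ?thesis by blast
qed

text \<open>The closed strip of half-width \<open>r'\<close> lies in the open strip of half-width
  \<open>r\<close>, so shrinking yields continuity up to the boundary.\<close>

lemma (in circle_lift) in_circle_maps:
  assumes "r' < r" "\<And>z. z \<in> strip r \<Longrightarrow> deriv h z \<noteq> 0"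
  shows "h \<in> circle_maps r'"
proof -
  have sub: "closed_strip r' \<subseteq> strip r" "strip r' \<subseteq> strip r" using assms(1) by (auto simp: strip_def closed_strip_def)
  have "(\<lambda>x. h x - x) ` \<real> \<subseteq> \<real>"
    using real by (auto elim!: Reals_cases simp: real_on_reals_def)
  then have "(\<lambda>x. h x - x) \<in> Per r'"
    using strip_perD(1,2,5)[OF per] sub unfolding Per_def
    by (auto intro: continuous_on_subset holomorphic_on_subset)
  then show ?thesis using homeomorphism_reals[OF assms(2)] by (simp add: circle_maps_def)
qed

section \<open>Consequences of the distance conditions\<close>

text \<open>The distance condition only keeps \<open>|Im h|\<close> away from the value
  \<open>R\<close>. That it stays below \<open>R\<close> is a connectedness argument:
  \<open>|Im h|\<close> is continuous on the strip and vanishes at 0.\<close>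

lemma (in circle_lift) Im_bound_of_setdist:
  assumes pos: "setdist (h ` closed_strip r) (strip_boundary R) = dh" "dh > 0" and R: "R > 0" and z: "z \<in> strip r"
  shows "\<bar>Im (h z)\<bar> \<le> R - dh"
proof -
  have far: "\<bar>\<bar>Im (h w)\<bar> - R\<bar> \<ge> dh" if w: "w \<in> strip r" for w
  proof -
    define y where "y = Complex (Re (h w)) (if Im (h w) \<ge> 0 then R else - R)"
    have "w \<in> closed_strip r" using w by (simp add: strip_def closed_strip_def)
    moreover have "y \<in> strip_boundary R" using R by (simp add: y_def strip_boundary_def)
    ultimately have "dh \<le> dist (h w) y" unfolding pos(1)[symmetric] by (intro setdist_le_dist) auto
    also have "dist (h w) y = \<bar>\<bar>Im (h w)\<bar> - R\<bar>"
      by (auto simp: dist_norm y_def cmod_def abs_if)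
    finally show ?thesis .
  qed
  define F where "F w = \<bar>Im (h w)\<bar>" for w
  have "continuous_on (strip r) F"
    unfolding F_def by (intro continuous_intros holomorphic_on_imp_continuous_on[OF hol])
  then have conn: "connected (F ` strip r)"
    by (rule connected_continuous_image) (rule convex_connected[OF convex_strip])
  have z0: "0 \<in> strip r" using r_pos by (simp add: strip_def)
  have "h (of_real 0) \<in> \<real>" using real by (simp only: real_on_reals_def)
  then have F0: "F 0 = 0" by (simp add: F_def complex_is_Real_iff)
  have "F z < R"
  proof (rule ccontr)
    assume "\<not> F z < R"
    moreover have "{F 0..F z} \<subseteq> F ` strip r"
      by (rule connected_contains_Icc[OF conn]) (use z0 z in auto)
    ultimately have "R \<in> F ` strip r" using R F0 by auto
    then obtain w where "w \<in> strip r" "F w = R" by auto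
    then show False using far[of w] pos(2) by (simp add: F_def)
  qed
  then show ?thesis using far[OF z] by (simp add: F_def)
qed

lemma frontier_dist_pos:
  assumes "open A" "\<alpha> \<in> A"
  shows "frontier_dist A \<alpha> > 0"
proof -
  obtain e where e: "e > 0" "ball \<alpha> e \<subseteq> A" using assms open_contains_ball by blast
  have "ereal e \<le> frontier_dist A \<alpha>"
    unfolding frontier_dist_def
  proof (rule INF_greatest)
    fix y assume "y \<in> frontier A"
    then have "y \<notin> A" using assms(1) by (simp add: frontier_def interior_open)
    then have "y \<notin> ball \<alpha> e" using e(2) by blast
    then show "ereal e \<le> ereal (dist \<alpha> y)" by simp
  qed
  then show ?thesis using e(1) by (metis ereal_less(2) order_less_le_trans)
qed

text \<open>A connected ball meeting both \<open>A\<close> and its complement would meet the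
  frontier. The case of an empty frontier, at infinite distance, is included.\<close>

lemma cball_subset_of_frontier_dist:
  assumes "\<alpha> \<in> A" "ereal \<mu> < frontier_dist A \<alpha>"
  shows "cball \<alpha> \<mu> \<subseteq> A"
proof
  fix y assume y: "y \<in> cball \<alpha> \<mu>"
  show "y \<in> A"
  proof (rule ccontr)
    assume "y \<notin> A"
    have "0 \<le> \<mu>" using y order_trans[OF zero_le_dist] by simp
    then have "\<alpha> \<in> cball \<alpha> \<mu> \<inter> A" using assms(1) by simp
    moreover have "y \<in> cball \<alpha> \<mu> - A" using y \<open>y \<notin> A\<close> by simp
    ultimately have "cball \<alpha> \<mu> \<inter> frontier A \<noteq> {}"
      by (intro connected_Int_frontier connected_cball) blast+
    then obtain w where w: "w \<in> frontier A" "dist \<alpha> w \<le> \<mu>" by auto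
    have "frontier_dist A \<alpha> \<le> ereal (dist \<alpha> w)" unfolding frontier_dist_def by (rule INF_lower[OF w(1)])
    also have "\<dots> \<le> ereal \<mu>" using w(2) by simp
    finally show False using assms(2) by simp
  qed
qed

lemma positive_lower_bound:
  fixes F :: "real set"
  assumes "finite F" "\<And>x. x \<in> F \<Longrightarrow> x > 0"
  shows "\<exists>\<mu>>0. \<forall>x\<in>F. \<mu> \<le> x"
  using assms
proof (induction F rule: finite_induct)
  case (insert x F)
  then obtain \<mu> where "\<mu> > 0" "\<forall>x\<in>F. \<mu> \<le> x" by auto
  then show ?case using insert by (intro exI[of _ "min \<mu> x"]) (auto simp: min_le_iff_disj)
qed (auto intro: exI[of _ 1])

text \<open>The constants come before \<open>A\<close>, \<open>f\<close>, \<open>\<theta>\<close>,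
  \<open>h\<close> and \<open>\<alpha>\<close>, hence are uniform over all data with the same bounds
  and the same initial sizes. For \<open>e = 0\<close> the right-hand sides of the closeness
  estimates are 0, so strict inequality is asserted for \<open>e \<noteq> 0\<close> and the weak one
  always.\<close>

theorem theorem3p1:
  fixes \<gamma> \<tau> \<rho>hat \<rho> \<delta> \<rho>inf \<sigma>1 \<sigma>2 \<sigma>b :: real
    and c :: "nat \<Rightarrow> nat \<Rightarrow> real"
    and s1 s2 :: ereal and sb dh :: real and dA :: ereal
  assumes "\<gamma> > 0" and "\<tau> \<ge> 1" and "\<rho>hat > 0" and "\<rho> > 0"
    and "0 < \<delta>" and "\<delta> < \<rho> / 2" and "0 < \<rho>inf" and "\<rho>inf < \<rho> - 2 * \<delta>"
  shows "\<exists>C1 C2 C3 :: real. C1 > 0 \<and> C2 > 0 \<and> C3 > 0 \<and>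
    (\<forall>(A :: real set) (f :: real \<Rightarrow> complex \<Rightarrow> complex) (\<theta> :: real)
      (h :: complex \<Rightarrow> complex) (\<alpha> :: real).
       open A \<and> C2_family A \<rho>hat f \<and>
       (\<forall>i j. 1 \<le> i + j \<and> i + j \<le> 2 \<longrightarrow> family_norm A \<rho>hat (pd i j f) \<le> ereal (c i j)) \<and>
       \<theta> \<in> diophantine \<gamma> \<tau> \<and>
       h \<in> circle_maps \<rho> \<and> \<alpha> \<in> A \<and>
       admissible_conj \<rho> \<rho>hat \<sigma>1 \<sigma>2 h \<and>
       nondegenerate f \<theta> \<sigma>b h \<alpha> \<and>
       initial_sizes A f \<theta> \<rho> \<rho>hat h \<alpha> s1 s2 sb dh dA
       \<longrightarrow>
       (let e = strip_norm \<rho> (conj_error f \<theta> h \<alpha>) in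
          ereal C1 * e / ereal (\<gamma>\<^sup>2 * \<rho> powr (2 * \<tau>)) < 1 \<longrightarrow>
          (\<exists>hinf \<alpha>inf.
             hinf \<in> circle_maps \<rho>inf \<and> \<alpha>inf \<in> A \<and>
             (\<forall>x \<in> closed_strip \<rho>inf. f \<alpha>inf (hinf x) = hinf (x + of_real \<theta>)) \<and>
             admissible_conj \<rho>inf \<rho>hat \<sigma>1 \<sigma>2 hinf \<and>
             nondegenerate f \<theta> \<sigma>b hinf \<alpha>inf \<and>
             strip_norm \<rho>inf (\<lambda>x. hinf x - h x) \<le> ereal C2 * e / ereal (\<gamma> * \<rho> powr \<tau>) \<and>
             ereal \<bar>\<alpha>inf - \<alpha>\<bar> \<le> ereal C3 * e \<and>
             (e \<noteq> 0 \<longrightarrow>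
                strip_norm \<rho>inf (\<lambda>x. hinf x - h x) < ereal C2 * e / ereal (\<gamma> * \<rho> powr \<tau>) \<and>
                ereal \<bar>\<alpha>inf - \<alpha>\<bar> < ereal C3 * e))))"
  (is "\<exists>C1 C2 C3. C1 > 0 \<and> C2 > 0 \<and> C3 > 0 \<and> (\<forall>A f \<theta> h \<alpha>. ?hyp A f \<theta> h \<alpha> \<longrightarrow> ?concl C1 C2 C3 A f \<theta> h \<alpha>)")
proof (cases "\<exists>A f \<theta> h \<alpha>. ?hyp A f \<theta> h \<alpha>")
  \<comment> \<open>If no data satisfy the hypotheses with the given numbers, the claim is vacuous
    and any positive constants do.\<close>
  case False
  show ?thesis
  proof (rule exI[of _ 1], rule exI[of _ 1], rule exI[of _ 1], intro conjI allI impI zero_less_one)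
    fix A f \<theta> h \<alpha>
    assume "?hyp A f \<theta> h \<alpha>"
    then have "\<exists>A f \<theta> h \<alpha>. ?hyp A f \<theta> h \<alpha>" by (intro exI)
    with False show "?concl 1 1 1 A f \<theta> h \<alpha>" by (rule notE)
  qed
next
  case True
  \<comment> \<open>Some admissible configuration certifies relations such as
    \<open>S1 < \<sigma>1\<close> between the given numbers. The constants are then built from those
    numbers alone and do not refer to this configuration.\<close>
  then obtain A0 f0 \<theta>0 h0 \<alpha>0 where hyp0: "?hyp A0 f0 \<theta>0 h0 \<alpha>0" by (elim exE)
  define S1 where "S1 = real_of_ereal s1"
  define S2 where "S2 = real_of_ereal s2"
  have sizes: "s1 = ereal S1 \<and> s2 = ereal S2 \<and> S1 < \<sigma>1 \<and> 0 < S2 \<and> S2 < \<sigma>2 \<and> 0 < sb \<and> sb < \<sigma>b \<and> 0 < dh \<and> 0 < dA"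
    if "?hyp A f \<theta> h \<alpha>" for A f \<theta> h \<alpha>
  proof -
    note adm = that[unfolded admissible_conj_def nondegenerate_def initial_sizes_def]
    have z0: "0 \<in> strip \<rho>" using \<open>\<rho> > 0\<close> by (simp add: strip_def)
    have up: "ereal (cmod (g 0)) \<le> strip_norm \<rho> g" for g unfolding strip_norm_def by (rule SUP_upper[OF z0])
    have "0 \<le> s1" using adm order_trans[OF _ up[of "deriv h"], of 0] by simp
    moreover have "0 < s2" using adm order_less_le_trans[OF _ up[of "\<lambda>x. 1 / deriv h x"], of 0] z0 by simp
    moreover have "s1 < ereal \<sigma>1" "s2 < ereal \<sigma>2" using adm by auto
    ultimately have "s1 = ereal S1 \<and> s2 = ereal S2 \<and> S1 < \<sigma>1 \<and> 0 < S2 \<and> S2 < \<sigma>2"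
      unfolding S1_def S2_def by (cases s1; cases s2) auto
    moreover have "0 < sb" "sb < \<sigma>b" using adm by auto
    moreover have "0 < dh" using adm by auto
    moreover have "0 < dA" using adm frontier_dist_pos[of A \<alpha>] by auto
    ultimately show ?thesis by blast
  qed
  \<comment> \<open>\<open>dA\<close> may be infinite; \<open>D\<close> is a finite radius strictly
    below it.\<close>
  obtain D where D: "D > 0" "ereal D < dA"
  proof -
    have "0 < dA" using sizes[OF hyp0] by simp
    then obtain x where "0 < x" "x < dA" using dense by blast
    then show ?thesis using that[of "real_of_ereal x"] by (cases x) auto
  qed
  have ineq: "S1 < \<sigma>1" "0 < S2" "S2 < \<sigma>2" "0 < sb" "sb < \<sigma>b" "0 < dh"
    using sizes[OF hyp0] by simp_all
  \<comment> \<open>Midpoints: the iteration may use half of each gap below the threshold, and the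
    other half keeps the final inequalities strict.\<close>
  define L1 where "L1 = (S1 + \<sigma>1) / 2"
  define L2 where "L2 = (S2 + \<sigma>2) / 2"
  define Lb where "Lb = (sb + \<sigma>b) / 2"
  define d where "d = dh / 2"
  define M where "M = \<bar>c 1 0\<bar> + \<bar>c 0 1\<bar> + \<bar>c 2 0\<bar> + \<bar>c 1 1\<bar> + \<bar>c 0 2\<bar>"
  \<comment> \<open>The summand 1 keeps \<open>Cb\<close> positive even for \<open>M = 0\<close>, so
    that \<open>\<mu>\<close> can be bounded by a quotient with this denominator.\<close>
  define Cb where "Cb = (2 * M * L2 + M * L2 * S2) * (sb * Lb) + 1"
  have L: "S1 < L1" "L1 < \<sigma>1" "S2 < L2" "L2 < \<sigma>2" "sb < Lb" "Lb < \<sigma>b" "d > 0"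
    using ineq by (auto simp: L1_def L2_def Lb_def d_def)
  have M0: "M \<ge> 0" by (simp add: M_def)
  have cM: "c i j \<le> M" if "1 \<le> i + j" "i + j \<le> 2" for i j
  proof -
    have "(i = 1 \<and> j = 0) \<or> (i = 0 \<and> j = 1) \<or> (i = 2 \<and> j = 0) \<or> (i = 1 \<and> j = 1) \<or> (i = 0 \<and> j = 2)"
      using that by presburger
    then show ?thesis unfolding M_def by (elim disjE) (auto simp: abs_if)
  qed
  have Cb: "Cb > 0" using M0 L ineq by (auto simp: Cb_def intro!: add_nonneg_pos)
  obtain \<mu> where \<mu>: "\<mu> > 0" "\<mu> \<le> D" "\<mu> \<le> d" "\<mu> \<le> L1 - S1" "\<mu> \<le> (L2 - S2) / (S2 * L2)" "\<mu> \<le> (Lb - sb) / Cb"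
  proof -
    have "\<exists>\<mu>>0. \<forall>x\<in>{D, d, L1 - S1, (L2 - S2) / (S2 * L2), (Lb - sb) / Cb}. \<mu> \<le> x"
      by (rule positive_lower_bound) (use D L Cb ineq in auto)
    then show ?thesis using that by auto
  qed
  have \<mu>2: "\<mu> * (S2 * L2) \<le> L2 - S2" using \<mu>(5) L ineq by (simp add: field_simps)
  have \<mu>b: "((2 * M * L2 + M * L2 * S2) * \<mu>) * (sb * Lb) \<le> Lb - sb"
  proof -
    have "((2 * M * L2 + M * L2 * S2) * \<mu>) * (sb * Lb) \<le> \<mu> * Cb"
      using \<mu>(1) by (simp add: Cb_def algebra_simps)
    also have "\<dots> \<le> Lb - sb" using \<mu>(6) Cb by (simp add: field_simps)
    finally show ?thesis .
  qed
  \<comment> \<open>Using only half of the gap leaves an open strip around the closed target strip;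
    the cap 1 meets the requirement on the width in the Newton step.\<close>
  define \<delta>0 where "\<delta>0 = min 1 ((\<rho> - \<rho>inf) / 2)"
  have \<delta>0: "0 < \<delta>0" "\<delta>0 \<le> 1" "\<delta>0 < \<rho>" "\<rho>inf < \<rho> - \<delta>0"
  proof -
    have lt: "\<rho>inf < \<rho>" using assms by linarith
    then show "0 < \<delta>0" "\<delta>0 \<le> 1" by (simp_all add: \<delta>0_def)
    have le: "\<delta>0 \<le> (\<rho> - \<rho>inf) / 2" unfolding \<delta>0_def by (rule min.cobounded2)
    show "\<delta>0 < \<rho>" "\<rho>inf < \<rho> - \<delta>0" using lt le \<open>\<rho>inf > 0\<close> by (simp_all add: field_simps)
  qed
  define N where "N = 2 * coh_order \<tau> + 2"
  define K where "K = step_const \<gamma> \<tau> M L1 L2 Lb * 2 ^ N / \<delta>0 ^ N"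
  have K0: "K \<ge> 0"
  proof -
    have "S1 \<ge> 0"
    proof -
      have "strip_norm \<rho> (deriv h0) = ereal S1" using hyp0 sizes[OF hyp0] by (simp add: initial_sizes_def)
      then have "cmod (deriv h0 0) \<le> S1" using \<open>\<rho> > 0\<close> by (intro strip_norm_leD[of \<rho>]) (auto simp: strip_def)
      then show ?thesis using norm_ge_zero order_trans by blast
    qed
    then have "step_const \<gamma> \<tau> M L1 L2 Lb \<ge> 0"
      using M0 L ineq \<open>\<gamma> > 0\<close> unfolding step_const_def Let_def coh_const_def
      by (intro add_nonneg_nonneg mult_nonneg_nonneg divide_nonneg_nonneg) auto
    then show ?thesis using \<delta>0 by (simp add: K_def)
  qed
  \<comment> \<open>\<open>E\<close> will bound \<open>\<kappa>\<close>, and its three upper bounds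
    are the smallness conditions of \<open>kam_sequence\<close>.\<close>
  obtain E where E: "E > 0" "E \<le> (1 / 2) ^ (N + 1)" "E \<le> \<mu> / 2" "E \<le> d / 2"
  proof -
    define q where "q = (1 / 2 :: real) ^ (N + 1)"
    have q: "q > 0" by (simp add: q_def)
    have "\<exists>E>0. \<forall>x\<in>{q, \<mu> / 2, d / 2}. E \<le> x"
      by (rule positive_lower_bound) (use \<mu>(1) L q in auto)
    then show ?thesis using that unfolding q_def by blast
  qed
  define G where "G = \<gamma>\<^sup>2 * \<rho> powr (2 * \<tau>)"
  define G' where "G' = \<gamma> * \<rho> powr \<tau>"
  have G: "G > 0" "G' > 0" using assms by (auto simp: G_def G'_def)
  \<comment> \<open>\<open>G\<close> cancels the denominator of the smallness condition, which
    becomes \<open>(K + 1) * \<epsilon> < E\<close>; the added 1 keeps \<open>C1\<close> positive.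
    The total displacement is at most \<open>2 * K * \<epsilon>\<close>, and the 1 added in
    \<open>C2\<close> and \<open>C3\<close> makes the closeness bounds strict for nonzero
    error.\<close>
  define C1 where "C1 = G * (K + 1) / E"
  define C2 where "C2 = (2 * K + 1) * G'"
  define C3 where "C3 = 2 * K + 1"
  have C: "C1 > 0" "C2 > 0" "C3 > 0" using G K0 E by (auto simp: C1_def C2_def C3_def)
  have "?concl C1 C2 C3 A f \<theta> h \<alpha>" if hyp: "?hyp A f \<theta> h \<alpha>" for A f \<theta> h \<alpha>
    unfolding Let_def
  proof (intro impI)
    define e where "e = strip_norm \<rho> (conj_error f \<theta> h \<alpha>)"
    assume small: "ereal C1 * strip_norm \<rho> (conj_error f \<theta> h \<alpha>) / ereal (\<gamma>\<^sup>2 * \<rho> powr (2 * \<tau>)) < 1"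
    have fam: "open A" "C2_family A \<rho>hat f"
      "\<And>i j. 1 \<le> i + j \<Longrightarrow> i + j \<le> 2 \<Longrightarrow> family_norm A \<rho>hat (pd i j f) \<le> ereal (c i j)"
      and \<theta>: "\<theta> \<in> diophantine \<gamma> \<tau>" and h: "h \<in> circle_maps \<rho>" and \<alpha>: "\<alpha> \<in> A"
      and h_avg: "average (\<lambda>x. h x - x) = 0" and h_nz: "\<And>x. x \<in> strip \<rho> \<Longrightarrow> deriv h x \<noteq> 0"
      and b_nz: "average (twist_fun f \<theta> h \<alpha>) \<noteq> 0"
      and h1: "strip_norm \<rho> (deriv h) = s1" and h2: "strip_norm \<rho> (\<lambda>x. 1 / deriv h x) = s2"
      and hb: "cmod (1 / average (twist_fun f \<theta> h \<alpha>)) = sb"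
      and hd: "setdist (h ` closed_strip \<rho>) (strip_boundary \<rho>hat) = dh" and hA: "frontier_dist A \<alpha> = dA"
      using hyp by (auto simp: admissible_conj_def nondegenerate_def initial_sizes_def)
    have s: "s1 = ereal S1" "s2 = ereal S2" using sizes[OF hyp] by auto
    interpret base: circle_lift \<rho> h using circle_lift_of_circle_maps[OF h \<open>\<rho> > 0\<close>] .
    interpret ip: initial_pair A f \<rho>hat M \<rho> h \<alpha> \<theta> S1 S2 sb L1 L2 Lb d \<mu>
    proof unfold_locales
      show "family_norm A \<rho>hat (pd i j f) \<le> ereal M" if "1 \<le> i + j" "i + j \<le> 2" for i j
        using order_trans[OF fam(3)[OF that], of "ereal M"] cM[OF that] by simp
      show "cmod (deriv h z) \<le> S1" if "z \<in> strip \<rho>" for z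
        by (rule strip_norm_leD[OF _ that]) (simp add: h1 s)
      show "cmod (1 / deriv h z) \<le> S2" if "z \<in> strip \<rho>" for z
        by (rule strip_norm_leD[OF _ that]) (simp add: h2 s)
      show "\<bar>Im (h z)\<bar> \<le> \<rho>hat - 2 * d" if "z \<in> strip \<rho>" for z
        using base.Im_bound_of_setdist[OF hd ineq(6) \<open>\<rho>hat > 0\<close> that] by (simp add: d_def)
      have "ereal \<mu> < frontier_dist A \<alpha>" using \<mu>(2) D(2) order_le_less_trans[of "ereal \<mu>" "ereal D"] by (simp add: hA)
      then show "cball \<alpha> \<mu> \<subseteq> A" by (rule cball_subset_of_frontier_dist[OF \<alpha>])
    qed (use fam \<open>\<rho>hat > 0\<close> h_avg h_nz b_nz hb \<mu> \<mu>2 \<mu>b L in auto)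
    have "0 \<le> e"
    proof -
      have "ereal (cmod (conj_error f \<theta> h \<alpha> 0)) \<le> e"
        unfolding e_def strip_norm_def by (rule SUP_upper) (use \<open>\<rho> > 0\<close> in \<open>simp add: strip_def\<close>)
      then show ?thesis by (rule order_trans[rotated]) simp
    qed
    \<comment> \<open>An infinite error norm would violate the smallness condition, because
      \<open>C1\<close> is positive.\<close>
    moreover have "e \<noteq> \<infinity>" using small C(1) G(1) by (auto simp: e_def[symmetric] G_def[symmetric])
    ultimately obtain \<epsilon> where \<epsilon>: "e = ereal \<epsilon>" "\<epsilon> \<ge> 0" by (cases e) auto
    have "C1 * \<epsilon> / G < 1" using small G(1) by (simp add: e_def[symmetric] G_def[symmetric] \<epsilon>(1))
    moreover have "C1 * \<epsilon> / G = (K + 1) * \<epsilon> / E" using G(1) by (simp add: C1_def)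
    ultimately have "(K + 1) * \<epsilon> < E" using E(1) by (simp only: divide_less_eq_1_pos)
    then have KE: "K * \<epsilon> \<le> E" using \<epsilon>(2) by (simp add: algebra_simps)
    define \<kappa> where "\<kappa> = K * \<epsilon>"
    have \<kappa>: "\<kappa> = step_const \<gamma> \<tau> M L1 L2 Lb * 2 ^ N / \<delta>0 ^ N * \<epsilon>" "\<kappa> \<ge> 0"
      "\<kappa> \<le> (1 / 2) ^ (N + 1)" "2 * \<kappa> \<le> \<mu>" "\<kappa> \<le> d / 2"
    proof -
      show "\<kappa> = step_const \<gamma> \<tau> M L1 L2 Lb * 2 ^ N / \<delta>0 ^ N * \<epsilon>" by (simp only: \<kappa>_def K_def)
      show "\<kappa> \<ge> 0" using K0 \<epsilon>(2) by (simp add: \<kappa>_def)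
      have "\<kappa> \<le> E" using KE by (simp add: \<kappa>_def)
      with E show "\<kappa> \<le> (1 / 2) ^ (N + 1)" "2 * \<kappa> \<le> \<mu>" "\<kappa> \<le> d / 2" by linarith+
    qed
    have err: "cmod (conj_error f \<theta> h \<alpha> z) \<le> \<epsilon>" if "z \<in> strip \<rho>" for z
      by (rule strip_norm_leD[OF _ that]) (simp add: e_def[symmetric] \<epsilon>(1))
    obtain s where st: "\<And>n. ip.kam_state (\<rho> - \<delta>0) (2 * \<kappa>) (\<epsilon> * (1 / 2) ^ n) (s n)"
      and mv: "\<And>n. near (\<rho> - \<delta>0) (\<kappa> * (1 / 2) ^ n) (fst (s n)) (snd (s n)) (fst (s (Suc n))) (snd (s (Suc n)))"
      using ip.kam_sequence[OF \<theta> \<open>\<gamma> > 0\<close> \<delta>0(1,2,3) err \<epsilon>(2) N_def \<kappa>(1,3,4,5,2)] by blast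
    have r\<rho>: "\<rho> - \<delta>0 \<le> \<rho>" using \<delta>0(1) by simp
    obtain hi ai where "ip.kam_state (\<rho> - \<delta>0) (2 * \<kappa>) 0 (hi, ai)"
      using ip.kam_limit[OF st mv r\<rho> \<kappa>(4)] by blast
    then have lift: "circle_lift (\<rho> - \<delta>0) hi" and avg: "average (\<lambda>z. hi z - z) = 0"
      and near\<kappa>: "near (\<rho> - \<delta>0) (2 * \<kappa>) h \<alpha> hi ai"
      and sol: "\<And>z. z \<in> strip (\<rho> - \<delta>0) \<Longrightarrow> conj_error f \<theta> hi ai z = 0"
      by (auto simp: ip.kam_state_def)
    interpret hi: circle_lift "\<rho> - \<delta>0" hi by fact
    note nb = ip.near_bounds[OF lift r\<rho> ip.near_mono[OF near\<kappa> \<kappa>(4)]]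
    have sub: "z \<in> strip (\<rho> - \<delta>0)" if "z \<in> strip \<rho>inf" for z using that \<delta>0(4) by (simp add: strip_def)
    have subc: "z \<in> strip (\<rho> - \<delta>0)" if "z \<in> closed_strip \<rho>inf" for z using that \<delta>0(4) by (simp add: strip_def closed_strip_def)
    have "admissible_conj \<rho>inf \<rho>hat \<sigma>1 \<sigma>2 hi"
      unfolding admissible_conj_def
    proof (intro conjI avg ballI)
      have "d \<le> setdist (hi ` closed_strip \<rho>inf) (strip_boundary \<rho>hat)"
      proof (rule le_setdistI)
        show "hi ` closed_strip \<rho>inf \<noteq> {}" using \<open>\<rho>inf > 0\<close> by (auto simp: closed_strip_def intro!: exI[of _ 0])
        have "\<i> * of_real \<rho>hat \<in> strip_boundary \<rho>hat" using \<open>\<rho>hat > 0\<close> by (simp add: strip_boundary_def)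
        then show "strip_boundary \<rho>hat \<noteq> {}" by blast
        fix x y assume "x \<in> hi ` closed_strip \<rho>inf" and y: "y \<in> strip_boundary \<rho>hat"
        then have "\<bar>Im x\<bar> \<le> \<rho>hat - d" using nb(2)[OF subc] by auto
        moreover have "\<bar>Im y\<bar> = \<rho>hat" using y by (simp add: strip_boundary_def)
        moreover have "\<bar>Im x - Im y\<bar> \<le> dist x y" using abs_Im_le_cmod[of "x - y"] by (simp add: dist_norm)
        ultimately show "d \<le> dist x y" by linarith
      qed
      then show "0 < setdist (hi ` closed_strip \<rho>inf) (strip_boundary \<rho>hat)" using L(7) by linarith
      have "strip_norm \<rho>inf (deriv hi) \<le> ereal L1" using nb(3)[OF sub] by (rule strip_norm_leI)
      then show "strip_norm \<rho>inf (deriv hi) < ereal \<sigma>1" using L(2) by (metis ereal_less(1) less_ereal.simps(1) order_le_less_trans)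
      have "strip_norm \<rho>inf (\<lambda>x. 1 / deriv hi x) \<le> ereal L2" using nb(5)[OF sub] by (rule strip_norm_leI)
      then show "strip_norm \<rho>inf (\<lambda>x. 1 / deriv hi x) < ereal \<sigma>2" using L(4) by (metis less_ereal.simps(1) order_le_less_trans)
      show "deriv hi x \<noteq> 0" if "x \<in> strip \<rho>inf" for x using nb(4)[OF sub[OF that]] .
    qed
    moreover have "nondegenerate f \<theta> \<sigma>b hi ai"
      using nb(6,7) L(6) by (simp add: nondegenerate_def)
    moreover have "hi \<in> circle_maps \<rho>inf" using hi.in_circle_maps[OF \<delta>0(4) nb(4)] .
    moreover have "\<forall>x \<in> closed_strip \<rho>inf. f ai (hi x) = hi (x + of_real \<theta>)"
      using sol[OF subc] by (simp add: conj_error_def)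
    moreover have dist_h: "strip_norm \<rho>inf (\<lambda>x. hi x - h x) \<le> ereal (2 * K * \<epsilon>)"
      using near\<kappa> sub by (intro strip_norm_leI) (auto simp: near_def \<kappa>_def mult.assoc)
    moreover have dist_a: "\<bar>ai - \<alpha>\<bar> \<le> 2 * K * \<epsilon>" using near\<kappa> by (simp add: near_def \<kappa>_def)
    moreover have e2: "ereal C2 * e / ereal G' = ereal ((2 * K + 1) * \<epsilon>)"
      using G(2) by (simp add: \<epsilon>(1) C2_def)
    moreover have e3: "ereal C3 * e = ereal ((2 * K + 1) * \<epsilon>)" by (simp add: \<epsilon>(1) C3_def)
    moreover have le: "2 * K * \<epsilon> \<le> (2 * K + 1) * \<epsilon>" using \<epsilon>(2) by (simp add: algebra_simps)
    moreover have lt: "2 * K * \<epsilon> < (2 * K + 1) * \<epsilon>" if "e \<noteq> 0" using \<epsilon> that by (simp add: algebra_simps)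
    ultimately show "\<exists>hinf \<alpha>inf.
             hinf \<in> circle_maps \<rho>inf \<and> \<alpha>inf \<in> A \<and>
             (\<forall>x \<in> closed_strip \<rho>inf. f \<alpha>inf (hinf x) = hinf (x + of_real \<theta>)) \<and>
             admissible_conj \<rho>inf \<rho>hat \<sigma>1 \<sigma>2 hinf \<and>
             nondegenerate f \<theta> \<sigma>b hinf \<alpha>inf \<and>
             strip_norm \<rho>inf (\<lambda>x. hinf x - h x) \<le> ereal C2 * strip_norm \<rho> (conj_error f \<theta> h \<alpha>) / ereal (\<gamma> * \<rho> powr \<tau>) \<and>
             ereal \<bar>\<alpha>inf - \<alpha>\<bar> \<le> ereal C3 * strip_norm \<rho> (conj_error f \<theta> h \<alpha>) \<and>
             (strip_norm \<rho> (conj_error f \<theta> h \<alpha>) \<noteq> 0 \<longrightarrow>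
                strip_norm \<rho>inf (\<lambda>x. hinf x - h x) < ereal C2 * strip_norm \<rho> (conj_error f \<theta> h \<alpha>) / ereal (\<gamma> * \<rho> powr \<tau>) \<and>
                ereal \<bar>\<alpha>inf - \<alpha>\<bar> < ereal C3 * strip_norm \<rho> (conj_error f \<theta> h \<alpha>))"
      unfolding e_def[symmetric] G'_def[symmetric] e2 e3
      using nb(1) order_trans[OF dist_h] order_le_less_trans[OF dist_h]
      by (intro exI[of _ hi] exI[of _ ai]) (auto intro: order_le_less_trans)
  qed
  then show ?thesis using C by blast
qed

end
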